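(* There is a bijection between, on the one hand, planar maps $M$ with at least one edge and a marked node, and, on the other hand, the disjoint union of the set of planar maps $M'$ with a marked corner and the set of pairs of planar maps $(M_1,M_2)$ each having a marked vertex. Under this bijection the total number of faces is preserved and the total number of edges decreases by one. Consequently, for every $n\ge 1$ and $f\ge 1$, the number of planar maps with $n$ edges, $f$ faces and a marked node is $$(2n-1)Q(n-1,f)+\sum_{\substack{i+j=n-1\\ i,j\geq 0}}\ \sum_{\substack{f_1+f_2=f\\ f_1,f_2\geq 1}}v_1Q(i,f_1)\,v_2Q(j,f_2),$$ the number of planar maps with $n$ edges, $f$ faces and a marked leaf is $(2n-1)Q(n-1,f)$, and $$v\,Q(n,f)=2(2n-1)Q(n-1,f)+\sum_{\substack{i+j=n-1\\ i,j\geq 0}}\ \sum_{\substack{f_1+f_2=f\\ f_1,f_2\geq 1}}v_1Q(i,f_1)\,v_2Q(j,f_2),$$ where $Q(n,f)$ is the number of planar maps with $n$ edges and $f$ faces, and $v=2+n-f$, $v_1=2+i-f_1$, $v_2=2+j-f_2$ are the corresponding numbers of vertices.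
   Context: A map is a connected multigraph (loops and multiple edges allowed) embedded in a compact connected oriented surface so that the complement is a disjoint union of open disks (the faces), considered up to (orientation-preserving) homeomorphism. A corner is an angular sector between two consecutive half-edges around a vertex. A rooted map is a map with a distinguished corner, in which a small arrow is placed, splitting that corner into two corners; hence a rooted map with $n$ edges has $2n+1$ corners (the single-vertex map has $n=0$ and one corner). The arrow does not count in vertex degrees. A planar map is a rooted map of genus $0$. The root vertex is the vertex carrying the arrow. A leaf is a vertex of degree $1$ that is not the root vertex; a node is a vertex that is not a leaf. *)

theory Defs
  imports Main "HOL-Combinatorics.Combinatorics"
begin

text \<open>
  A map on an oriented surface, up to orientation-preserving homeomorphism, is encoded in the
  standard way by its half-edges (darts), the permutation \<open>rot\<close> sending a dart to the next one
  in counterclockwise order around its vertex, and the permutation \<open>opp\<close> exchanging the two halves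
  of every edge.

  The root arrow is itself recorded as a dart: it takes part in the cyclic order around the root
  vertex, and so splits the root corner in two, but it is not half of an edge; it is the unique
  fixed point of \<open>opp\<close>.  The single-vertex map is the case in which the arrow is the only dart.
\<close>

record 'd rmap =
  darts :: "'d set"
  rot :: "'d \<Rightarrow> 'd"
  opp :: "'d \<Rightarrow> 'd"
  arrow :: 'd

definition rooted_map :: "'d rmap \<Rightarrow> bool" where
  "rooted_map M \<longleftrightarrow>
     finite (darts M) \<and> arrow M \<in> darts M \<and>
     rot M permutes darts M \<and> opp M permutes darts M \<and>
     (\<forall>d\<in>darts M. opp M (opp M d) = d) \<and>
     (\<forall>d\<in>darts M. opp M d = d \<longleftrightarrow> d = arrow M) \<and>
     (\<forall>d\<in>darts M. \<forall>e\<in>darts M.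
        (d, e) \<in> {(x, y). x \<in> darts M \<and> (y = rot M x \<or> y = opp M x)}\<^sup>*)"

definition vertices :: "'d rmap \<Rightarrow> 'd set set" where
  "vertices M = orbit (rot M) ` darts M"

definition edges :: "'d rmap \<Rightarrow> 'd set set" where
  "edges M = orbit (opp M) ` (darts M - {arrow M})"

text \<open>
  A face is the cyclic sequence of darts met along its boundary: follow an edge, then turn to the
  next dart.  At the arrow one only turns, so the arrow does not create or merge faces.
\<close>

definition faces :: "'d rmap \<Rightarrow> 'd set set" where
  "faces M = orbit (rot M \<circ> opp M) ` darts M"

definition corners :: "'d rmap \<Rightarrow> ('d \<times> 'd) set" where
  "corners M = (\<lambda>d. (d, rot M d)) ` darts M"

definition root_vertex :: "'d rmap \<Rightarrow> 'd set" where
  "root_vertex M = orbit (rot M) (arrow M)"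

definition vertex_degree :: "'d rmap \<Rightarrow> 'd set \<Rightarrow> nat" where
  "vertex_degree M v = card (v - {arrow M})"

definition leaves :: "'d rmap \<Rightarrow> 'd set set" where
  "leaves M = {v \<in> vertices M. vertex_degree M v = 1 \<and> v \<noteq> root_vertex M}"

definition nodes :: "'d rmap \<Rightarrow> 'd set set" where
  "nodes M = vertices M - leaves M"

definition has_genus :: "'d rmap \<Rightarrow> nat \<Rightarrow> bool" where
  "has_genus M g \<longleftrightarrow>
     int (card (vertices M)) - int (card (edges M)) + int (card (faces M)) = 2 - 2 * int g"

definition planar_map :: "'d rmap \<Rightarrow> bool" where
  "planar_map M \<longleftrightarrow> rooted_map M \<and> has_genus M 0"

definition is_iso :: "('d \<Rightarrow> 'e) \<Rightarrow> 'd rmap \<Rightarrow> 'e rmap \<Rightarrow> bool" where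
  "is_iso h M N \<longleftrightarrow>
     bij_betw h (darts M) (darts N) \<and> h (arrow M) = arrow N \<and>
     (\<forall>d\<in>darts M. h (rot M d) = rot N (h d) \<and> h (opp M d) = opp N (h d))"

text \<open>
  Maps are considered up to isomorphism.  As dart sets are finite, every isomorphism class has
  representatives whose darts are natural numbers, so it suffices to take classes of such maps.
  An isomorphism of maps with a marked vertex or corner must respect the mark.
\<close>

definition map_iso :: "nat rmap rel" where
  "map_iso = {(M, N). rooted_map M \<and> rooted_map N \<and> (\<exists>h. is_iso h M N)}"

definition vertex_marked_iso :: "(nat rmap \<times> nat set) rel" where
  "vertex_marked_iso = {((M, v), (N, w)). rooted_map M \<and> rooted_map N \<and>
     v \<in> vertices M \<and> w \<in> vertices N \<and> (\<exists>h. is_iso h M N \<and> h ` v = w)}"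

definition corner_marked_iso :: "(nat rmap \<times> (nat \<times> nat)) rel" where
  "corner_marked_iso = {((M, c), (N, d)). rooted_map M \<and> rooted_map N \<and>
     c \<in> corners M \<and> d \<in> corners N \<and> (\<exists>h. is_iso h M N \<and> map_prod h h c = d)}"

definition node_marked_maps :: "(nat rmap \<times> nat set) set set" where
  "node_marked_maps =
     {(M, v). planar_map M \<and> card (edges M) \<ge> 1 \<and> v \<in> nodes M} // vertex_marked_iso"

definition vertex_marked_maps :: "(nat rmap \<times> nat set) set set" where
  "vertex_marked_maps = {(M, v). planar_map M \<and> v \<in> vertices M} // vertex_marked_iso"

definition corner_marked_maps :: "(nat rmap \<times> (nat \<times> nat)) set set" where
  "corner_marked_maps = {(M, c). planar_map M \<and> c \<in> corners M} // corner_marked_iso"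

definition Q :: "nat \<Rightarrow> nat \<Rightarrow> nat" where
  "Q n f = card ({M. planar_map M \<and> card (edges M) = n \<and> card (faces M) = f} // map_iso)"

definition node_marked_count :: "nat \<Rightarrow> nat \<Rightarrow> nat" where
  "node_marked_count n f =
     card ({(M, v). planar_map M \<and> card (edges M) = n \<and> card (faces M) = f \<and> v \<in> nodes M}
             // vertex_marked_iso)"

definition leaf_marked_count :: "nat \<Rightarrow> nat \<Rightarrow> nat" where
  "leaf_marked_count n f =
     card ({(M, v). planar_map M \<and> card (edges M) = n \<and> card (faces M) = f \<and> v \<in> leaves M}
             // vertex_marked_iso)"

end

theory Submission
  imports Defs "HOL-Computational_Algebra.Polynomial" "HOL-Computational_Algebra.Formal_Power_Series"
begin

text \<open>
  Deleting the root edge of a planar map either contracts it or, if it is a loop, cuts the map in two.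
  This gives Tutte's equation for the series \<open>N\<close> of planar maps, with \<open>t\<close> marking edges (shifted by one),
  \<open>y\<close> faces and \<open>x\<close> the root degree. Let \<open>A\<close> and \<open>B\<close> be the series at \<open>x = 1\<close> of maps with a marked vertex and
  with a marked face. The derivatives of \<open>N\<close> satisfy linear equations with a common injective
  operator, and a linear dependence between their right-hand sides yields \<open>t = B (1 - B - 2 A)\<close>; duality
  yields \<open>t y = A (1 - A - 2 B)\<close>. Integrating along \<open>t\<close>, the series of all maps is \<open>A B (1 - 2 A - 2 B)\<close>, and
  the formula for \<open>v Q(n, f)\<close> is an algebraic consequence.

  Removing a marked leaf with its edge leaves a marked corner, and rooted maps have no
  automorphisms, so leaves, and by subtraction nodes, are counted as claimed. The number of edges and the
  number of faces then cut both sides of the bijection into finite pieces of equal size, which are matched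
  arbitrarily.
\<close>

section \<open>Tutte's equation for generating series\<close>

unbundle fps_syntax

text \<open>The obstacle is the catalytic variable. Tutte's equation cannot be stated without
  \<open>x\<close>, but at \<open>x = 1\<close>, where all maps are counted, it degenerates to
  \<open>0 = 0\<close>. The equation is never solved. Every derivation that kills \<open>x\<close>
  turns it into a linear equation with one and the same operator, and this operator is linear over
  series free of \<open>x\<close>, such as \<open>A\<close> and \<open>B\<close>. A dependence
  between the images therefore becomes a relation between the derivatives themselves, and that
  relation is still meaningful at \<open>x = 1\<close>.

  The integration rests on Euler's relation: if a map with \<open>n\<close> edges carries
  \<open>t\<close> to the power \<open>n + 2 = v + f\<close>, then differentiation in
  \<open>t\<close> marks either a vertex or a face, so the derivative of the series of all maps is a
  combination of \<open>A\<close> and \<open>B\<close>.\<close>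

definition fps_map :: "('a \<Rightarrow> 'b) \<Rightarrow> 'a fps \<Rightarrow> 'b fps" where
  "fps_map d F = Abs_fps (\<lambda>n. d (F $ n))"

lemma fps_map_nth [simp]: "fps_map d F $ n = d (F $ n)"
  by (simp add: fps_map_def)

lemma fps_map_add:
  assumes "\<And>a b. d (a + b) = d a + d b"
  shows "fps_map d (F + G) = fps_map d F + fps_map d G"
  by (rule fps_ext) (simp add: assms)

lemma fps_map_diff:
  fixes d :: "'a::ab_group_add \<Rightarrow> 'b::ab_group_add"
  assumes "\<And>a b. d (a + b) = d a + d b"
  shows "fps_map d (F - G) = fps_map d F - fps_map d G"
proof (rule fps_ext)
  fix n
  have "d (F $ n - G $ n) + d (G $ n) = d (F $ n)" using assms[of "F $ n - G $ n" "G $ n"] by simp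
  then show "fps_map d (F - G) $ n = (fps_map d F - fps_map d G) $ n" by (simp add: algebra_simps)
qed

lemma additive_sum:
  fixes d :: "'a::ab_group_add \<Rightarrow> 'b::ab_group_add"
  assumes "\<And>a b. d (a + b) = d a + d b"
  shows "d (sum f I) = (\<Sum>i\<in>I. d (f i))"
proof -
  have "d 0 = 0" using assms[of 0 0] by simp
  then show ?thesis by (induction I rule: infinite_finite_induct) (auto simp: assms)
qed

lemma fps_map_hom_mult:
  fixes d :: "'a::ring \<Rightarrow> 'b::ring"
  assumes "\<And>a b. d (a + b) = d a + d b" "\<And>a b. d (a * b) = d a * d b"
  shows "fps_map d (F * G) = fps_map d F * fps_map d G"
  by (rule fps_ext) (simp add: fps_mult_nth additive_sum[of d, OF assms(1)] assms(2))

lemma fps_map_leibniz: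
  fixes d :: "'a::ring \<Rightarrow> 'a"
  assumes "\<And>a b. d (a + b) = d a + d b" "\<And>a b. d (a * b) = d a * b + a * d b"
  shows "fps_map d (F * G) = fps_map d F * G + F * fps_map d G"
  by (rule fps_ext) (simp add: fps_mult_nth additive_sum[of d, OF assms(1)] assms(2) sum.distrib)

lemma map_pderiv_add: "map_poly pderiv (p + q) = map_poly pderiv p + map_poly pderiv q"
  for p q :: "'a::idom poly poly"
  by (rule poly_eqI) (simp add: coeff_map_poly pderiv_add)

lemma map_pderiv_mult: "map_poly pderiv (p * q) = map_poly pderiv p * q + p * map_poly pderiv q"
  for p q :: "'a::idom poly poly"
proof (rule poly_eqI)
  fix n
  have "coeff (map_poly pderiv (p * q)) n = (\<Sum>i\<le>n. pderiv (coeff p i) * coeff q (n - i) + coeff p i * pderiv (coeff q (n - i)))"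
    by (simp add: coeff_map_poly coeff_mult additive_sum[of pderiv] pderiv_add pderiv_mult algebra_simps)
  then show "coeff (map_poly pderiv (p * q)) n = coeff (map_poly pderiv p * q + p * map_poly pderiv q) n"
    by (simp add: coeff_map_poly coeff_mult sum.distrib)
qed

text \<open>Series in \<open>t\<close> whose coefficients are polynomials in an outer variable \<open>x\<close> (root degree)
  and an inner variable \<open>y\<close> (faces).\<close>

type_synonym gseries = "real poly poly fps"

definition tR :: gseries where "tR = fps_X"
definition xR :: gseries where "xR = fps_const [:0, 1:]"
definition yR :: gseries where "yR = fps_const [:[:0, 1:]:]"

definition dy :: "gseries \<Rightarrow> gseries" where "dy = fps_map (map_poly pderiv)"
definition dt :: "gseries \<Rightarrow> gseries" where "dt F = tR * fps_deriv F"
text \<open>On a term of degree n + 1 in t and f in y, \<open>du\<close> is multiplication by n + 1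
  - f. With t shifted by one this is v - 1 by Euler's relation, so F + \<open>du\<close> F marks a
  vertex, while \<open>dy\<close> F marks a face.\<close>

definition du :: "gseries \<Rightarrow> gseries" where "du F = dt F - yR * dy F"
definition at1 :: "gseries \<Rightarrow> gseries" where "at1 = fps_map (\<lambda>p. [:poly p 1:])"

lemma at1_simps [simp]:
  "at1 (F + G) = at1 F + at1 G" "at1 (F - G) = at1 F - at1 G" "at1 (F * G) = at1 F * at1 G"
  "at1 tR = tR" "at1 xR = 1" "at1 yR = yR" "at1 1 = 1" "at1 0 = 0" "at1 (numeral k) = numeral k"
  "at1 (at1 F) = at1 F"
proof -
  show "at1 (F + G) = at1 F + at1 G" "at1 (F - G) = at1 F - at1 G" "at1 (F * G) = at1 F * at1 G"
    by (simp_all add: at1_def fps_map_add fps_map_diff fps_map_hom_mult)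
  have *: "at1 (fps_const c) = fps_const [:poly c 1:]" for c
    by (rule fps_ext) (simp add: at1_def)
  show "at1 tR = tR" by (rule fps_ext) (simp add: at1_def tR_def one_pCons)
  show "at1 xR = 1" "at1 yR = yR" "at1 1 = 1" "at1 0 = 0"
    using *[of "[:0,1:]"] *[of "[:[:0,1:]:]"] *[of 1] *[of 0]
    by (simp_all add: xR_def yR_def flip: fps_const_1_eq_1) (simp_all add: one_pCons)
  show "at1 (numeral k) = numeral k"
    using *[of "numeral k"] by (simp add: numeral_poly numeral_fps_const)
  show "at1 (at1 F) = at1 F" by (rule fps_ext) (simp add: at1_def)
qed

lemma dy_simps:
  "dy (F + G) = dy F + dy G" "dy (F - G) = dy F - dy G" "dy (F * G) = dy F * G + F * dy G"
  "dy tR = 0" "dy xR = 0" "dy yR = 1" "dy 1 = 0"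
proof -
  show "dy (F + G) = dy F + dy G" "dy (F - G) = dy F - dy G" "dy (F * G) = dy F * G + F * dy G"
    by (simp_all add: dy_def fps_map_add fps_map_diff fps_map_leibniz map_pderiv_add map_pderiv_mult)
  have *: "dy (fps_const c) = fps_const (map_poly pderiv c)" for c
    by (rule fps_ext) (simp add: dy_def)
  show "dy tR = 0" by (rule fps_ext) (simp add: dy_def tR_def map_poly_1)
  show "dy xR = 0" "dy yR = 1" "dy 1 = 0"
    using *[of "[:0,1:]"] *[of "[:[:0,1:]:]"] *[of 1]
    by (simp_all add: xR_def yR_def map_poly_pCons pderiv_pCons map_poly_1 flip: fps_const_1_eq_1)
      (simp_all add: one_pCons)
qed

lemma dt_simps:
  "dt (F + G) = dt F + dt G" "dt (F - G) = dt F - dt G" "dt (F * G) = dt F * G + F * dt G"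
  "dt tR = tR" "dt xR = 0" "dt yR = 0" "dt 1 = 0"
  by (simp_all add: dt_def tR_def xR_def yR_def algebra_simps)

lemma du_simps:
  "du (F + G) = du F + du G" "du (F - G) = du F - du G" "du (F * G) = du F * G + F * du G"
  "du tR = tR" "du xR = 0" "du yR = - yR" "du 1 = 0"
  by (simp_all add: du_def dt_simps dy_simps algebra_simps)

lemma poly_map_pderiv: "poly (map_poly pderiv p) 1 = pderiv (poly p 1)" for p :: "real poly poly"
  by (induction p) (simp_all add: map_poly_pCons pderiv_add)

lemma at1_dy: "at1 (dy F) = dy (at1 F)"
  by (rule fps_ext) (simp add: at1_def dy_def poly_map_pderiv map_poly_pCons)

lemma at1_dt: "at1 (dt F) = dt (at1 F)"
proof -
  have "at1 (fps_deriv F) = fps_deriv (at1 F)"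
    by (rule fps_ext) (simp add: at1_def of_nat_poly)
  then show ?thesis by (simp add: dt_def)
qed

lemma at1_du: "at1 (du F) = du (at1 F)"
  by (simp add: du_def at1_dt at1_dy)

text \<open>Differentiating Tutte's equation in any parameter gives a linear equation whose left-hand side is
  \<open>kern N\<close>, so two combinations of derivatives with the same image coincide.\<close>

definition kern :: "gseries \<Rightarrow> gseries \<Rightarrow> gseries" where
  "kern N F = (xR - 1) * (1 - 2 * xR^2 * N) * F - tR * xR^2 * F + tR * xR * at1 F"

text \<open>Apart from (x - 1) F, every term of \<open>kern N F\<close> has a factor N or t, and
  neither has a constant term in t. Once the lower coefficients of F vanish, the coefficient of t^n
  therefore gives (x - 1) F_n = 0, and x - 1 is not a zero divisor.\<close>

lemma kern_inj:
  assumes N0: "N $ 0 = 0" and "kern N F = 0"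
  shows "F = 0"
proof -
  have eq: "(xR - 1) * F = (xR - 1) * (2 * xR^2) * (N * F) + tR * (xR^2 * F - xR * at1 F)"
    using assms(2) by (simp add: kern_def algebra_simps)
  have "F $ n = 0" for n
  proof (induction n rule: less_induct)
    case (less n)
    have "((xR - 1) * F) $ n = ([:0,1:] - 1) * F $ n"
      by (simp add: xR_def algebra_simps)
    moreover have "(N * F) $ m = 0" if "m \<le> n" for m
    proof -
      have "N $ i * F $ (m - i) = 0" if "i \<in> {0..m}" for i
        using less[of "m - i"] N0 that \<open>m \<le> n\<close> by (cases "i = 0") auto
      then show ?thesis unfolding fps_mult_nth by (intro sum.neutral) blast
    qed
    then have "((xR - 1) * (2 * xR^2) * (N * F)) $ n = 0"
      unfolding fps_mult_nth[of "(xR - 1) * (2 * xR^2)"] by (intro sum.neutral) simp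
    moreover have "(tR * (xR^2 * F - xR * at1 F)) $ n = 0"
    proof (cases n)
      case (Suc m)
      then show ?thesis
        using less[of m] by (simp add: tR_def xR_def at1_def fps_mult_left_const_nth)
    qed (simp add: tR_def)
    ultimately have "([:0,1:] - 1) * F $ n = 0" using eq by (metis add.right_neutral fps_add_nth)
    moreover have "([:0,1:] - 1 :: real poly poly) \<noteq> 0" by (simp add: one_pCons)
    ultimately show ?case by (metis mult_eq_0_iff)
  qed
  then show ?thesis by (simp add: fps_eq_iff)
qed

text \<open>\<open>kern N\<close> commutes with multiplication by series free of x, such as A and B,
  and a factor x only produces a correction containing \<open>at1\<close>. The images of t, (x - 1)
  \<open>du\<close> N, \<open>dy\<close> N and x \<open>dy\<close> N are therefore explicit. They
  are dependent over the series free of x, injectivity transfers the dependence to the arguments,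
  and its value at x = 1 is the relation.\<close>

lemma tutte_imp_relation:
  assumes N0: "N $ 0 = 0"
    and tutte: "(xR - 1) * N = (xR - 1) * (tR * yR + xR^2 * N^2) + tR * xR * (xR * N - at1 N)"
  defines "A \<equiv> at1 N + du (at1 N)" and "B \<equiv> dy (at1 N)"
  shows "tR = B * (1 - B - 2 * A)"
proof -
  define M where "M = at1 N"
  have A1: "at1 A = A" "at1 B = B" by (simp_all add: A_def B_def at1_du at1_dy)
  have y: "kern N (dy N) = (xR - 1) * tR"
  proof -
    have "dy ((xR - 1) * N) = dy ((xR - 1) * (tR * yR + xR^2 * N^2) + tR * xR * (xR * N - M))"
      unfolding M_def using tutte by simp
    then have "(xR - 1) * dy N = (xR - 1) * (tR + xR^2 * (2 * N * dy N)) + tR * xR * (xR * dy N - dy M)"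
      by (simp add: dy_simps power2_eq_square algebra_simps)
    then show ?thesis by (simp add: kern_def M_def at1_dy algebra_simps power2_eq_square)
  qed
  \<comment> \<open>\<open>du\<close> annihilates t y, so only the explicit factor t of the last
    term leaves a remainder. That remainder contains N, which later cancels against the image of
    t.\<close>
  have u: "kern N (du N) = tR * xR * (xR * N - M)"
  proof -
    have "du ((xR - 1) * N) = du ((xR - 1) * (tR * yR + xR^2 * N^2) + tR * xR * (xR * N - M))"
      unfolding M_def using tutte by simp
    then have "(xR - 1) * du N = (xR - 1) * (xR^2 * (2 * N * du N)) + tR * xR * (xR * du N - du M)
        + tR * xR * (xR * N - M)"
      by (simp add: du_simps power2_eq_square algebra_simps)
    then show ?thesis by (simp add: kern_def M_def at1_du algebra_simps power2_eq_square)
  qed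
  have AM: "A = M + du M" by (simp add: A_def M_def)
  \<comment> \<open>\<open>G\<close> is chosen so that the multiples of \<open>t (x - 1)\<close> and \<open>t (x - 1) x\<close> in its image cancel.\<close>
  define G where "G = (1 - B) * (tR + 2 * (xR - 1) * du N - dy N) + (tR + 2 * A) * (xR * dy N)"
  \<comment> \<open>The factor x - 1 removes \<open>du N\<close>, so only t, A and B remain at x =
    1.\<close>
  have G1: "at1 G = (1 - B) * (tR - B) + (tR + 2 * A) * B"
    by (simp add: G_def A1 at1_dy at1_du B_def[symmetric])
  \<comment> \<open>The first bracket is sent to -t (x - 1) x (t + 2 A): twice the image of (x - 1)
    \<open>du\<close> N cancels the term 2 x^2 N of the image of t, and subtracting the image of
    \<open>dy\<close> N cancels the constant 1. The image of x \<open>dy\<close> N is t (x - 1) x (1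
    - B); comparing the two dictates the outer factors 1 - B and t + 2 A.\<close>
  have "kern N G = (1 - B) * (kern N tR + 2 * kern N ((xR - 1) * du N) - kern N (dy N)) + (tR + 2 * A) * kern N (xR * dy N)"
    by (simp add: kern_def G_def A1 algebra_simps)
  moreover have k1: "kern N tR = tR * (xR - 1) * (1 - 2 * xR^2 * N - tR * xR)"
    by (simp add: kern_def algebra_simps power2_eq_square)
  moreover have k2: "kern N ((xR - 1) * du N) = (xR - 1) * tR * (xR^2 * N - xR * A)"
  proof -
    have "kern N ((xR - 1) * du N) = (xR - 1) * (kern N (du N) - tR * xR * du M)"
      by (simp add: kern_def M_def at1_du algebra_simps)
    then show ?thesis unfolding u AM by (simp add: algebra_simps power2_eq_square)
  qed
  moreover have k3: "kern N (xR * dy N) = tR * (xR - 1) * xR * (1 - B)"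
  proof -
    have "kern N (xR * dy N) = xR * (kern N (dy N) - tR * xR * B) + tR * xR * B"
      by (simp add: kern_def B_def at1_dy algebra_simps)
    then show ?thesis unfolding y by (simp add: algebra_simps)
  qed
  ultimately have "kern N G = 0" by (simp only: y k1 k2 k3) (simp add: algebra_simps power2_eq_square)
  then have "G = 0" using kern_inj N0 by blast
  then have "at1 G = 0" by simp
  then show ?thesis unfolding G1 by (simp add: algebra_simps)
qed

section \<open>From the two relations to the counting identity\<close>

lemma fps_scale_nth: "(F oo (fps_const c * fps_X)) $ n = c ^ n * F $ n" for F :: "'a::comm_ring_1 fps"
  by (simp add: fps_compose_linear)

text \<open>Here w is a value of y. Multiplying the differentiated relations by a and b and adding
  them shows that a + w b is the derivative of a b (1 - 2 a - 2 b). Hence q is this polynomial, and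
  the claim becomes algebra modulo the two relations. The coefficients 4, 4, -6 come from 4 v + 4 f
  - 6 = 4 m + 2 on maps with m edges, which is 2 (2 n - 1) for n = m + 1.\<close>

lemma relations_imp_identity:
  fixes a b q :: "real fps" and w :: real
  assumes r1: "fps_X = b * (1 - b - 2 * a)" and r2: "fps_const w * fps_X = a * (1 - a - 2 * b)"
    and q: "fps_deriv q = a + fps_const w * b" and 0: "q $ 0 = 0" "a $ 0 = 0"
  shows "a = fps_const w * fps_X + 4 * fps_X * a + 4 * fps_const w * fps_X * b - 6 * q + a * a"
proof -
  have "fps_deriv (b * (1 - b - 2 * a)) = 1" "fps_deriv (a * (1 - a - 2 * b)) = fps_const w"
    unfolding r1[symmetric] r2[symmetric] by simp_all
  then have d: "1 = fps_deriv b * (1 - 2 * b - 2 * a) - 2 * b * fps_deriv a"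
     "fps_const w = fps_deriv a * (1 - 2 * a - 2 * b) - 2 * a * fps_deriv b"
    by (simp_all add: algebra_simps)
  have "fps_deriv (a * b * (1 - 2 * a - 2 * b)) =
      fps_deriv a * (b * (1 - 4 * a - 2 * b)) + fps_deriv b * (a * (1 - 2 * a - 4 * b))"
    by (simp add: algebra_simps)
  also have "\<dots> = a * (fps_deriv b * (1 - 2 * b - 2 * a) - 2 * b * fps_deriv a)
      + (fps_deriv a * (1 - 2 * a - 2 * b) - 2 * a * fps_deriv b) * b"
    by (simp add: algebra_simps)
  also have "\<dots> = a + fps_const w * b" using d by simp
  finally have "fps_deriv q = fps_deriv (a * b * (1 - 2 * a - 2 * b))" using q by simp
  \<comment> \<open>Neither q nor a has a constant term, so the constant of integration is
    0.\<close>
  then have q': "q = a * b * (1 - 2 * a - 2 * b)" unfolding fps_deriv_eq_iff using 0 by simp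
  have "fps_const w * fps_X + 4 * fps_X * a + 4 * fps_const w * fps_X * b - 6 * q + a * a
     = fps_const w * fps_X + 4 * fps_X * a + 4 * (fps_const w * fps_X) * b - 6 * q + a * a"
    by (simp add: mult.assoc)
  also have "\<dots> = a" unfolding r2 q' by (subst r1) (simp add: algebra_simps)
  finally show ?thesis by simp
qed

text \<open>All that the algebra has to know about maps is in the hypotheses: Tutte's equation, the
  range of f, and duality. The variable y is evaluated at real numbers w, so that series in t alone
  suffice; an identity valid for all nonzero w is then one of polynomials in y.\<close>

lemma counting_identity:
  fixes q :: "nat \<Rightarrow> nat \<Rightarrow> nat" and W :: "nat \<Rightarrow> real poly poly"
  assumes tutte: "\<And>n. ([:0,1:] - 1) * W n =
      (if n = 0 then ([:0,1:] - 1) * [:[:0,1:]:]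
       else [:0,1:] * ([:0,1:] * W (n - 1) - [:poly (W (n - 1)) 1:])
         + ([:0,1:] - 1) * [:0,1:]^2 * (\<Sum>i<n. W i * W (n - 1 - i)))"
    and W1: "\<And>n f. coeff (poly (W n) 1) f = q n f"
    and q0: "\<And>n f. f = 0 \<or> f > n + 1 \<Longrightarrow> q n f = 0"
    and dual: "\<And>n f. f \<le> n + 2 \<Longrightarrow> q n (n + 2 - f) = q n f"
    and n: "n \<ge> 1"
  shows "(2 + int n - int f) * int (q n f) = 2 * (2 * int n - 1) * int (q (n - 1) f) +
    (\<Sum>i\<le>n - 1. \<Sum>g\<le>f. ((2 + int i - int g) * int (q i g)) *
       ((2 + int (n - 1 - i) - int (f - g)) * int (q (n - 1 - i) (f - g))))"
proof -
  \<comment> \<open>The shift makes N vanish at t = 0, as \<open>kern_inj\<close> requires, and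
    makes the exponents of t and y differ by v - 1.\<close>
  define N :: gseries where "N = Abs_fps (\<lambda>m. case m of 0 \<Rightarrow> 0 | Suc n \<Rightarrow> W n)"
  have N0: "N $ 0 = 0" and NS: "N $ Suc n = W n" for n by (simp_all add: N_def)
  have tutteN: "(xR - 1) * N = (xR - 1) * (tR * yR + xR^2 * N^2) + tR * xR * (xR * N - at1 N)"
  proof -
    \<comment> \<open>The coefficients of the unshifted series match the hypothesis directly;
      multiplying by t then gives the equation for N.\<close>
    define V :: gseries where "V = Abs_fps W"
    have NV: "N = tR * V"
      by (rule fps_ext) (simp add: N_def V_def tR_def split: nat.split)
    have "(xR - 1) * V = (xR - 1) * yR + tR * ((xR - 1) * xR^2 * (V * V) + xR * (xR * V - at1 V))" (is "?l = ?r")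
    proof (rule fps_ext)
      fix n
      have c: "xR - 1 = fps_const ([:0,1:] - 1)" by (simp add: xR_def flip: fps_const_1_eq_1)
      have l: "?l $ n = ([:0,1:] - 1) * W n" unfolding c by (simp add: V_def)
      have c2: "(xR - 1) * xR^2 = fps_const (([:0,1:] - 1) * [:0,1:]^2)" unfolding c by (simp add: xR_def)
      show "?l $ n = ?r $ n"
      proof (cases n)
        case 0
        have "?r $ n = ([:0,1:] - 1) * [:[:0,1:]:]" unfolding c by (simp add: tR_def yR_def 0)
        then show ?thesis using l tutte[of n] 0 by simp
      next
        case (Suc k)
        have VV: "(V * V) $ k = (\<Sum>i<n. W i * W (k - i))"
          by (simp add: fps_mult_nth V_def Suc lessThan_Suc_atMost atMost_atLeast0)
        have "?r $ n = ([:0,1:] - 1) * [:0,1:]^2 * (\<Sum>i<n. W i * W (k - i)) + [:0,1:] * ([:0,1:] * W k - [:poly (W k) 1:])"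
          unfolding c2 unfolding c
          by (simp add: tR_def yR_def Suc VV[unfolded Suc] xR_def at1_def) (simp add: V_def)
        then show ?thesis using l tutte[of n] Suc by simp
      qed
    qed
    then have "tR * ((xR - 1) * V) = tR * ((xR - 1) * yR + tR * ((xR - 1) * xR^2 * (V * V) + xR * (xR * V - at1 V)))"
      by simp
    then show ?thesis by (simp add: NV algebra_simps power2_eq_square)
  qed
  from tutte_imp_relation[OF N0 tutteN]
  have rel: "tR = dy (at1 N) * (1 - dy (at1 N) - 2 * (at1 N + du (at1 N)))" .
  define p where "p n = poly (W n) 1" for n
  define pa where "pa n = (\<Sum>f\<le>n+1. monom ((2 + real n - real f) * q n f) f)" for n
  have pa_coeff: "coeff (pa n) f = (2 + real n - real f) * q n f" for n f
    using q0[of f n] by (auto simp: pa_def coeff_sum)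
  have p_eq: "p n = (\<Sum>f\<le>n+1. monom (real (q n f)) f)" for n
    by (rule poly_eqI) (use q0 in \<open>auto simp: p_def W1 coeff_sum not_le\<close>)
  define a where "a w = Abs_fps (\<lambda>m. case m of 0 \<Rightarrow> 0 | Suc n \<Rightarrow> \<Sum>f\<le>n+1. (2 + real n - real f) * q n f * w ^ f)" for w :: real
  \<comment> \<open>At f = 0 the truncated exponent is harmless, because the factor f is 0.\<close>
  define b where "b w = Abs_fps (\<lambda>m. case m of 0 \<Rightarrow> 0 | Suc n \<Rightarrow> \<Sum>f\<le>n+1. real f * q n f * w ^ (f - 1))" for w :: real
  \<comment> \<open>The exponent of t is n + 2, and differentiation brings down n + 2 = (2 + n - f)
    + f; the two summands give \<open>a w\<close> and w times \<open>b w\<close>.\<close>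
  define Qs where "Qs w = fps_X * fps_X * Abs_fps (\<lambda>n. \<Sum>f\<le>n+1. q n f * w ^ f)" for w :: real
  define ev where "ev w = fps_map (\<lambda>P. poly (poly P 1) w)" for w :: real
  have ev: "ev w (F + G) = ev w F + ev w G" "ev w (F - G) = ev w F - ev w G" "ev w (F * G) = ev w F * ev w G"
    "ev w 1 = 1" "ev w 2 = 2" "ev w tR = fps_X" for w :: real and F G :: gseries
  proof -
    show "ev w (F + G) = ev w F + ev w G" "ev w (F - G) = ev w F - ev w G" "ev w (F * G) = ev w F * ev w G"
      by (simp_all add: ev_def fps_map_add fps_map_diff fps_map_hom_mult)
    show "ev w 1 = 1" by (rule fps_ext) (simp add: ev_def)
    have "ev w (1 + 1) = ev w 1 + ev w 1" unfolding ev_def by (rule fps_map_add) simp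
    then show "ev w 2 = 2" using \<open>ev w 1 = 1\<close> by simp
    show "ev w tR = fps_X" by (rule fps_ext) (simp add: ev_def tR_def)
  qed
  have evb: "ev w (dy (at1 N)) = b w" and eva: "ev w (at1 N + du (at1 N)) = a w" for w
  proof -
    have d: "poly (pderiv (p n)) w = (\<Sum>f\<le>n+1. real f * q n f * w ^ (f - 1))" for n
      by (simp add: p_eq additive_sum[of pderiv] pderiv_add poly_sum pderiv_monom poly_monom del: sum.atMost_Suc)
    have M: "at1 N $ Suc n = [:p n:]" "at1 N $ 0 = 0" for n
      by (simp_all add: at1_def NS N0 p_def)
    show "ev w (dy (at1 N)) = b w"
      by (rule fps_ext) (simp add: ev_def dy_def b_def M map_poly_pCons d split: nat.split del: sum.atMost_Suc)
    show "ev w (at1 N + du (at1 N)) = a w"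
    proof (rule fps_ext)
      fix m
      show "ev w (at1 N + du (at1 N)) $ m = a w $ m"
      proof (cases m)
        case (Suc n)
        have wp: "w * (real f * q n f * w ^ (f - 1)) = real f * q n f * w ^ f" for f
          by (cases f) auto
        have "ev w (at1 N + du (at1 N)) $ m = poly (p n) w + real (Suc n) * poly (p n) w - w * poly (pderiv (p n)) w"
          by (simp add: Suc ev_def du_def dt_def dy_def tR_def yR_def M map_poly_pCons of_nat_poly algebra_simps)
        also have "\<dots> = (\<Sum>f\<le>n+1. (2 + real n - real f) * q n f * w ^ f)"
        proof -
          have "(\<Sum>f\<le>n+1. (2 + real n - real f) * q n f * w ^ f)
             = (\<Sum>f\<le>n+1. (2 + real n) * (real (q n f) * w ^ f) - w * (real f * q n f * w ^ (f - 1)))"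
            unfolding wp by (rule sum.cong) (auto simp: algebra_simps)
          also have "\<dots> = (2 + real n) * (\<Sum>f\<le>n+1. real (q n f) * w ^ f) - w * poly (pderiv (p n)) w"
            unfolding d by (simp only: sum_subtractf sum_distrib_left)
          also have "(\<Sum>f\<le>n+1. real (q n f) * w ^ f) = poly (p n) w"
            by (simp only: p_eq poly_sum poly_monom)
          finally show ?thesis by (simp add: algebra_simps)
        qed
        finally show ?thesis by (simp add: a_def Suc)
      qed (simp add: ev_def a_def du_def dt_def dy_def tR_def M)
    qed
  qed
  have r1: "fps_X = b w * (1 - b w - 2 * a w)" for w
  proof -
    \<comment> \<open>With the sum folded into \<open>C\<close>, the additivity rule for
      \<open>ev w\<close> cannot split it before \<open>eva\<close> applies.\<close>
    define C where "C = at1 N + du (at1 N)"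
    show ?thesis using arg_cong[OF rel[folded C_def], of "ev w"] eva[folded C_def] by (simp add: ev evb)
  qed
  \<comment> \<open>Replacing t by w t and y by 1 / w turns the weight of a face-marked map into f
    w^(k + 2 - f). By duality k + 2 - f may be read as the number of faces and f as the number of
    vertices. The substitution thus exchanges \<open>a\<close> and \<open>b\<close> in
    \<open>r1\<close>.\<close>
  have r2: "fps_const w * fps_X = a w * (1 - a w - 2 * b w)" if "w \<noteq> 0" for w
  proof -
    let ?s = "\<lambda>F. F oo (fps_const w * fps_X)"
    have z: "(fps_const w * fps_X) $ 0 = 0" by simp
    have "?s fps_X = ?s (b (1/w) * (1 - b (1/w) - (a (1/w) + a (1/w))))"
      using r1[of "1/w"] by (simp only: mult_2)
    also have "\<dots> = ?s (b (1/w)) * (1 - ?s (b (1/w)) - (?s (a (1/w)) + ?s (a (1/w))))"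
      by (simp only: fps_compose_mult_distrib[OF z] fps_compose_sub_distrib fps_compose_add_distrib fps_compose_1)
    finally have "fps_const w * fps_X = ?s (b (1/w)) * (1 - ?s (b (1/w)) - (?s (a (1/w)) + ?s (a (1/w))))"
      by simp
    moreover have "?s (b (1/w)) = a w"
    proof (rule fps_ext)
      fix m
      show "?s (b (1/w)) $ m = a w $ m"
      proof (cases m)
        case (Suc k)
        have "?s (b (1/w)) $ m = (\<Sum>f\<le>k+1. w ^ m * (real f * q k f * (1/w) ^ (f - 1)))"
          unfolding fps_scale_nth by (simp add: Suc b_def sum_distrib_left del: sum.atMost_Suc)
        also have "\<dots> = (\<Sum>f\<in>{1..k+1}. w ^ m * (real f * q k f * (1/w) ^ (f - 1)))"
          by (rule sum.mono_neutral_right) auto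
        also have "\<dots> = (\<Sum>f\<in>{1..k+1}. (2 + real k - real f) * q k f * w ^ f)"
        proof (rule sum.reindex_bij_witness[of _ "\<lambda>f. k + 2 - f" "\<lambda>f. k + 2 - f"])
          fix f assume f: "f \<in> {1..k+1}"
          have "w ^ m = w ^ (k + 2 - f) * w ^ (f - 1)" using f by (simp add: Suc flip: power_add)
          then have "w ^ m * (1/w) ^ (f - 1) = w ^ (k + 2 - f)" using that by (simp add: power_divide)
          then have "w ^ m * (c * (1/w) ^ (f - 1)) = c * w ^ (k + 2 - f)" for c
            by (subst mult.left_commute) simp
          note this[of "real f * real (q k f)"]
          then show "(2 + real k - real (k + 2 - f)) * real (q k (k + 2 - f)) * w ^ (k + 2 - f) =
              w ^ m * (real f * real (q k f) * (1 / w) ^ (f - 1))"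
            using f dual[of f k] by (auto simp: of_nat_diff)
        qed auto
        also have "\<dots> = (\<Sum>f\<le>k+1. (2 + real k - real f) * q k f * w ^ f)"
          by (rule sum.mono_neutral_left) (auto simp: q0 not_le)
        finally show ?thesis by (simp add: a_def Suc)
      qed (simp add: a_def b_def)
    qed
    moreover have "?s (a (1/w)) = b w"
    proof (rule fps_ext)
      fix m
      show "?s (a (1/w)) $ m = b w $ m"
      proof (cases m)
        case (Suc k)
        have "?s (a (1/w)) $ m = (\<Sum>f\<le>k+1. w ^ m * ((2 + real k - real f) * q k f * (1/w) ^ f))"
          unfolding fps_scale_nth by (simp add: Suc a_def sum_distrib_left del: sum.atMost_Suc)
        also have "\<dots> = (\<Sum>f\<in>{1..k+1}. w ^ m * ((2 + real k - real f) * q k f * (1/w) ^ f))"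
          by (rule sum.mono_neutral_right) (auto simp: q0 not_le)
        also have "\<dots> = (\<Sum>f\<in>{1..k+1}. real f * q k f * w ^ (f - 1))"
        proof (rule sum.reindex_bij_witness[of _ "\<lambda>f. k + 2 - f" "\<lambda>f. k + 2 - f"])
          fix f assume f: "f \<in> {1..k+1}"
          have "w ^ m = w ^ (k + 1 - f) * w ^ f" using f by (simp add: Suc flip: power_add)
          then have "w ^ m * (1/w) ^ f = w ^ (k + 1 - f)" using that by (simp add: power_divide)
          then have "w ^ m * (c * (1/w) ^ f) = c * w ^ (k + 1 - f)" for c
            by (subst mult.left_commute) simp
          note this[of "(2 + real k - real f) * real (q k f)"]
          moreover have "k + 2 - f - 1 = k + 1 - f" using f by simp
          ultimately show "real (k + 2 - f) * real (q k (k + 2 - f)) * w ^ (k + 2 - f - 1) =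
              w ^ m * ((2 + real k - real f) * real (q k f) * (1 / w) ^ f)"
            using f dual[of f k] by (auto simp: of_nat_diff)
        qed auto
        also have "\<dots> = (\<Sum>f\<le>k+1. real f * q k f * w ^ (f - 1))"
          by (rule sum.mono_neutral_left) auto
        finally show ?thesis by (simp add: b_def Suc)
      qed (simp add: a_def b_def)
    qed
    ultimately show ?thesis by (simp only: mult_2)
  qed
  have "fps_deriv (Qs w) = a w + fps_const w * b w" for w
  proof (rule fps_ext)
    fix m
    show "fps_deriv (Qs w) $ m = (a w + fps_const w * b w) $ m"
    proof (cases m)
      case (Suc n)
      have wp: "w * (real f * q n f * w ^ (f - 1)) = real f * q n f * w ^ f" for f
        by (cases f) auto
      have "fps_deriv (Qs w) $ m = (2 + real n) * (\<Sum>f\<le>n+1. q n f * w ^ f)"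
        by (simp add: Suc Qs_def mult.assoc distrib_right del: sum.atMost_Suc)
      also have "\<dots> = (\<Sum>f\<le>n+1. (2 + real n - real f) * q n f * w ^ f) + w * (\<Sum>f\<le>n+1. real f * q n f * w ^ (f - 1))"
      proof -
        have "(2 + real n) * (\<Sum>f\<le>n+1. q n f * w ^ f) = (\<Sum>f\<le>n+1. (2 + real n) * (q n f * w ^ f))"
          by (rule sum_distrib_left)
        also have "\<dots> = (\<Sum>f\<le>n+1. (2 + real n - real f) * q n f * w ^ f + w * (real f * q n f * w ^ (f - 1)))"
          unfolding wp by (rule sum.cong) (auto simp: algebra_simps)
        finally show ?thesis by (simp only: sum.distrib sum_distrib_left)
      qed
      finally show ?thesis by (simp add: Suc a_def b_def del: sum.atMost_Suc)
    qed (simp add: Qs_def a_def b_def mult.assoc)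
  qed
  then have id: "a w = fps_const w * fps_X + 4 * fps_X * a w + 4 * fps_const w * fps_X * b w - 6 * Qs w + a w * a w" 
    if "w \<noteq> 0" for w
    by (intro relations_imp_identity r1 r2 that) (simp_all add: Qs_def a_def)
  obtain m where m: "n = Suc m" using n by (cases n) auto
  have "poly (pa n) w = poly (smult (2 * (2 * real n - 1)) (p m) + (\<Sum>i\<le>m. pa i * pa (m - i))) w" if "w \<noteq> 0" for w
  proof -
    have pa: "a w $ Suc n = poly (pa n) w" for n
      by (simp add: a_def pa_def poly_sum poly_monom del: sum.atMost_Suc)
    have a0: "a w $ 0 = 0" by (simp add: a_def)
    have "(a w * a w) $ Suc (Suc m) = (\<Sum>i\<in>{0..Suc (Suc m)}. a w $ i * a w $ (Suc (Suc m) - i))"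
      by (rule fps_mult_nth)
    \<comment> \<open>The end terms vanish because \<open>a w\<close> has no constant term. What
      remains pairs the exponents i + 1 and m - i + 1, of sum m + 2.\<close>
    also have "\<dots> = (\<Sum>i\<in>{1..Suc m}. a w $ i * a w $ (Suc (Suc m) - i))"
    proof (rule sum.mono_neutral_right, goal_cases)
      case 3
      have "i = 0 \<or> i = Suc (Suc m)" if "i \<in> {0..Suc (Suc m)} - {1..Suc m}" for i using that by auto
      then show ?case using a0 by fastforce
    qed auto
    also have "\<dots> = (\<Sum>i\<le>m. a w $ Suc i * a w $ (Suc (m - i)))"
      by (rule sum.reindex_bij_witness[of _ Suc "\<lambda>i. i - 1"]) (auto simp: Suc_diff_le)
    finally have aa: "(a w * a w) $ Suc (Suc m) = poly (\<Sum>i\<le>m. pa i * pa (m - i)) w"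
      by (simp add: pa poly_sum)
    \<comment> \<open>This is the coefficient of t^(n + 1) = t^(m + 2) in \<open>id\<close>; since n
      is at least 1, the linear term w t does not contribute.\<close>
    have "poly (pa n) w = 4 * a w $ Suc m + 4 * w * b w $ Suc m - 6 * Qs w $ Suc (Suc m) + (a w * a w) $ Suc (Suc m)"
    proof -
      have "(4 * fps_X * a w) $ Suc (Suc m) = 4 * a w $ Suc m"
        "(4 * fps_const w * fps_X * b w) $ Suc (Suc m) = 4 * w * b w $ Suc m"
        "(6 * Qs w) $ Suc (Suc m) = 6 * Qs w $ Suc (Suc m)"
        by (simp_all add: mult.assoc numeral_fps_const)
      then show ?thesis using arg_cong[OF id[OF that], of "\<lambda>F. F $ Suc (Suc m)"] m pa by simp
    qed
    \<comment> \<open>Termwise 4 (2 + m - f) + 4 f - 6 = 4 m + 2, independently of f.\<close>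
    also have "4 * a w $ Suc m + 4 * w * b w $ Suc m - 6 * Qs w $ Suc (Suc m) = 2 * (2 * real n - 1) * poly (p m) w"
    proof -
      have wp: "w * (real f * q m f * w ^ (f - 1)) = real f * q m f * w ^ f" for f
        by (cases f) auto
      have "4 * a w $ Suc m + 4 * (w * b w $ Suc m) - 6 * Qs w $ Suc (Suc m) =
         (\<Sum>f\<le>m+1. 4 * ((2 + real m - real f) * q m f * w ^ f) + 4 * (w * (real f * q m f * w ^ (f - 1))) - 6 * (q m f * w ^ f))"
        by (simp add: a_def b_def Qs_def mult.assoc sum.distrib sum_subtractf sum_distrib_left del: sum.atMost_Suc)
      also have "\<dots> = (\<Sum>f\<le>m+1. 2 * (2 * real n - 1) * (q m f * w ^ f))"
        unfolding wp by (rule sum.cong) (auto simp: m algebra_simps)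
      also have "\<dots> = 2 * (2 * real n - 1) * poly (p m) w"
        unfolding p_eq poly_sum poly_monom sum_distrib_left ..
      finally show ?thesis by (simp add: mult.assoc)
    qed
    finally show ?thesis unfolding aa by simp
  qed
  then have "pa n = smult (2 * (2 * real n - 1)) (p m) + (\<Sum>i\<le>m. pa i * pa (m - i))" (is "?l = ?r")
  proof -
    assume *: "\<And>w. w \<noteq> 0 \<Longrightarrow> poly ?l w = poly ?r w"
    \<comment> \<open>A nonzero polynomial has finitely many roots, whereas the difference vanishes
      at every positive real.\<close>
    have "infinite {w :: real. poly (?l - ?r) w = 0}"
    proof
      assume "finite {w :: real. poly (?l - ?r) w = 0}"
      moreover have "{0<..} \<subseteq> {w :: real. poly (?l - ?r) w = 0}" using * by auto
      ultimately have "finite {0 :: real <..}" by (rule rev_finite_subset)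
      then show False using infinite_Ioi by blast
    qed
    then show "?l = ?r" using poly_roots_finite[of "?l - ?r"] by auto
  qed
  then have "coeff (pa n) f = coeff (smult (2 * (2 * real n - 1)) (p m) + (\<Sum>i\<le>m. pa i * pa (m - i))) f" by simp
  then have "(2 + real n - real f) * real (q n f) = 2 * (2 * real n - 1) * real (q m f) +
    (\<Sum>i\<le>m. \<Sum>g\<le>f. ((2 + real i - real g) * real (q i g)) *
       ((2 + real (m - i) - real (f - g)) * real (q (m - i) (f - g))))"
    by (simp add: pa_coeff coeff_sum coeff_mult p_def W1)
  then have "real_of_int ((2 + int n - int f) * int (q n f)) = real_of_int (2 * (2 * int n - 1) * int (q m f) +
    (\<Sum>i\<le>m. \<Sum>g\<le>f. ((2 + int i - int g) * int (q i g)) *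
       ((2 + int (m - i) - int (f - g)) * int (q (m - i) (f - g)))))"
    by simp
  then show ?thesis unfolding of_int_eq_iff using m by simp
qed

section \<open>Cycles of permutations\<close>

text \<open>The carrier D is explicit because fixed points in D count as cycles: enlarging D by a
  dart that s does not move adds one.\<close>

definition ncyc :: "'a set \<Rightarrow> ('a \<Rightarrow> 'a) \<Rightarrow> nat" where
  "ncyc D s = card (orbit s ` D)"

lemma perm_self_in_orbit: "s permutes D \<Longrightarrow> finite D \<Longrightarrow> x \<in> orbit s x"
  by (rule permutation_self_in_orbit) (auto simp: permutation_permutes)

lemma perm_orbit_eq:
  assumes "s permutes D" "finite D" "y \<in> orbit s x"
  shows "orbit s y = orbit s x"
  using assms cyclic_on_orbit orbit_cyclic_eq3 by metis

lemma orbit_subset_closed: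
  assumes "x \<in> S" "\<And>y. y \<in> S \<Longrightarrow> s y \<in> S"
  shows "orbit s x \<subseteq> S"
proof
  fix y assume "y \<in> orbit s x"
  then show "y \<in> S" by induction (auto intro: assms)
qed

text \<open>From a the new permutation continues as s does from b, runs through the whole cycle of
  b, and on reaching b continues as s does from a. The two cycles are concatenated and all others
  are untouched.\<close>

lemma orbit_merge:
  assumes s: "s permutes D" "finite D" and b: "b \<notin> orbit s a"
  shows "orbit (s \<circ> transpose a b) a = orbit s a \<union> orbit s b"
    "orbit (s \<circ> transpose a b) b = orbit s a \<union> orbit s b"
    "x \<notin> orbit s a \<Longrightarrow> x \<notin> orbit s b \<Longrightarrow> orbit (s \<circ> transpose a b) x = orbit s x"
proof -
  let ?s = "s \<circ> transpose a b"
  note self = perm_self_in_orbit[OF s]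
  have a: "a \<notin> orbit s b" using perm_orbit_eq[OF s, of a b] b self by auto
  have B: "y \<in> orbit ?s a" if "y \<in> orbit s b" for y
    using that
  proof induction
    case base
    have "s b = ?s a" by simp
    then show ?case by (metis orbit.base)
  next
    case (step y)
    show ?case
    proof (cases "y = b")
      case True
      have "s b = ?s a" by simp
      then show ?thesis using True by (metis orbit.base)
    next
      case False
      then have "s y = ?s y" using step a by (auto simp: transpose_def)
      then show ?thesis using step by (metis orbit.step)
    qed
  qed
  have A: "y \<in> orbit ?s a" if "y \<in> orbit s a" for y
    using that
  proof induction
    case base
    have "s a = ?s b" by simp
    then show ?case using B[OF self] by (metis orbit.step)
  next
    case (step y)
    show ?case
    proof (cases "y = a")
      case True
      have "s a = ?s b" by simp
      then show ?thesis using True B[OF self] by (metis orbit.step)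
    next
      case False
      then have "s y = ?s y" using step b by (auto simp: transpose_def)
      then show ?thesis using step by (metis orbit.step)
    qed
  qed
  have cl: "?s y \<in> orbit s a \<union> orbit s b" if "y \<in> orbit s a \<union> orbit s b" for y
    using that by (auto simp: transpose_def intro: orbit.intros)
  show 1: "orbit ?s a = orbit s a \<union> orbit s b"
    using orbit_subset_closed[of a "orbit s a \<union> orbit s b" ?s] cl self A B by blast
  have "orbit ?s b \<subseteq> orbit s a \<union> orbit s b"
    using orbit_subset_closed[of b "orbit s a \<union> orbit s b" ?s] cl self by blast
  moreover have "a \<in> orbit ?s b"
  proof (rule orbit_swap)
    show "a \<in> orbit ?s a" "b \<in> orbit ?s a" using A B self by blast+
  qed
  then have "orbit ?s a \<subseteq> orbit ?s b" by (meson orbit_trans subsetI)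
  ultimately show "orbit ?s b = orbit s a \<union> orbit s b" using 1 by blast
  assume x: "x \<notin> orbit s a" "x \<notin> orbit s b"
  show "orbit ?s x = orbit s x"
  proof (rule orbit_cong[OF self])
    fix y assume "y \<in> orbit s x"
    then have "orbit s y = orbit s x" by (rule perm_orbit_eq[OF s])
    then have "y \<noteq> a" "y \<noteq> b" using x self by auto
    then show "?s y = s y" by simp
  qed
qed

lemma ncyc_merge:
  assumes s: "s permutes D" "finite D" and ab: "a \<in> D" "b \<in> D" and b: "b \<notin> orbit s a"
  shows "ncyc D s = Suc (ncyc D (s \<circ> transpose a b))"
proof -
  let ?s = "s \<circ> transpose a b" and ?A = "orbit s a" and ?B = "orbit s b"
  note self = perm_self_in_orbit[OF s] and eq = perm_orbit_eq[OF s] and m = orbit_merge[OF s b]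
  have AB: "?A \<noteq> ?B" using b self by metis
  have "orbit ?s ` D = insert (?A \<union> ?B) (orbit s ` D - {?A, ?B})" (is "_ = ?R")
  proof (rule set_eqI)
    fix X
    have "X \<in> orbit ?s ` D" if X: "X \<in> ?R"
    proof (cases "X = ?A \<union> ?B")
      case True
      then have "X = orbit ?s a" using m(1) by simp
      then show ?thesis using ab(1) by blast
    next
      case False
      then obtain x where x: "x \<in> D" "X = orbit s x" "X \<noteq> ?A" "X \<noteq> ?B" using X by auto
      have "x \<notin> ?A" "x \<notin> ?B" using eq[of x a] eq[of x b] x(2-4) by auto
      then have "X = orbit ?s x" using m(3)[of x] x(2) by simp
      then show ?thesis using x(1) by blast
    qed
    moreover have "X \<in> ?R" if "X \<in> orbit ?s ` D"
    proof -
      from that obtain x where x: "x \<in> D" "X = orbit ?s x" by auto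
      show ?thesis
      proof (cases "x \<in> ?A \<union> ?B")
        case True
        have "?s permutes D" using s ab by (intro permutes_compose permutes_swap_id) 
        then have "orbit ?s x = orbit ?s a" using perm_orbit_eq[of ?s D x a] True m(1) s by simp
        then show ?thesis using m(1) x(2) by simp
      next
        case False
        then have X: "X = orbit s x" using m(3)[of x] x(2) by simp
        then have "X \<noteq> ?A" "X \<noteq> ?B" using self[of x] False by auto
        then show ?thesis using X x(1) by blast
      qed
    qed
    ultimately show "X \<in> orbit ?s ` D \<longleftrightarrow> X \<in> ?R" by blast
  qed
  moreover have "?A \<union> ?B \<notin> orbit s ` D - {?A, ?B}"
  proof
    assume "?A \<union> ?B \<in> orbit s ` D - {?A, ?B}"
    then obtain x where "?A \<union> ?B = orbit s x" "orbit s x \<noteq> ?A" by auto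
    moreover have "a \<in> ?A \<union> ?B" using self[of a] by blast
    ultimately show False using eq[of a x] by simp
  qed
  moreover have "card (orbit s ` D) = card (orbit s ` D - {?A, ?B}) + 2"
  proof -
    have "card (orbit s ` D - {?A, ?B}) = card (orbit s ` D) - card {?A, ?B}"
      using ab by (intro card_Diff_subset) auto
    moreover have "card {?A, ?B} \<le> card (orbit s ` D)" using ab s by (intro card_mono) auto
    ultimately show ?thesis using AB by simp
  qed
  ultimately show ?thesis using s by (simp add: ncyc_def)
qed

text \<open>Let s lead from b to a for the first time after k steps. The new permutation sends a to
  s b, so it closes the path s b, ..., s^k b = a into a cycle, and b is not on that path.\<close>

lemma orbit_split:
  assumes s: "s permutes D" "finite D" and b: "b \<in> orbit s a" and ab: "a \<noteq> b"
  shows "b \<notin> orbit (s \<circ> transpose a b) a"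
proof -
  let ?s = "s \<circ> transpose a b"
  have ba: "a \<in> orbit s b" using perm_orbit_eq[OF s b] perm_self_in_orbit[OF s] by metis
  define k where "k = funpow_dist1 s b a"
  have k: "(s ^^ k) b = a" "0 < k" using funpow_dist1_prop[OF ba] by (auto simp: k_def)
  have least: "(s ^^ i) b \<noteq> a" if "0 < i" "i < k" for i
    using funpow_dist1_least[of i s b a] that by (simp add: k_def)
  \<comment> \<open>If the walk returned to b after i < k steps, it would reach a already after k -
    i steps.\<close>
  have nb: "(s ^^ i) b \<noteq> b" if "0 < i" "i \<le> k" for i
  proof
    assume i: "(s ^^ i) b = b"
    then have "i < k" using that k ab by (cases "i = k") auto
    have "(s ^^ (k - i + i)) b = (s ^^ (k - i)) ((s ^^ i) b)" by (simp only: funpow_add o_apply)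
    then have "(s ^^ k) b = (s ^^ (k - i)) ((s ^^ i) b)" using that by simp
    then show False using i least[of "k - i"] k that \<open>i < k\<close> by simp
  qed
  have "orbit ?s a \<subseteq> (\<lambda>i. (s ^^ i) b) ` {1..k}"
  proof (rule orbit_subset_closed)
    show "a \<in> (\<lambda>i. (s ^^ i) b) ` {1..k}" using k by (intro image_eqI[of _ _ k]) auto
    fix y assume "y \<in> (\<lambda>i. (s ^^ i) b) ` {1..k}"
    then obtain i where i: "1 \<le> i" "i \<le> k" "y = (s ^^ i) b" by auto
    show "?s y \<in> (\<lambda>i. (s ^^ i) b) ` {1..k}"
    proof (cases "i = k")
      case True
      then have "?s y = (s ^^ 1) b" using i k by simp
      then show ?thesis using k(2) by (intro image_eqI[of _ _ 1]) auto
    next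
      case False
      then have "y \<noteq> a" "y \<noteq> b" using i least[of i] nb[of i] by auto
      then have "?s y = (s ^^ Suc i) b" using i by simp
      then show ?thesis using False i by (intro image_eqI[of _ _ "Suc i"]) auto
    qed
  qed
  moreover have "b \<notin> (\<lambda>i. (s ^^ i) b) ` {1..k}"
    using nb by (metis (no_types, lifting) atLeastAtMost_iff imageE less_le_trans zero_less_one)
  ultimately show ?thesis by blast
qed

text \<open>Composing with the transposition a second time restores s, so this is
  \<open>ncyc_merge\<close> read backwards.\<close>

lemma ncyc_split:
  assumes s: "s permutes D" "finite D" and ab: "a \<in> D" "b \<in> D" "a \<noteq> b" and b: "b \<in> orbit s a"
  shows "ncyc D (s \<circ> transpose a b) = Suc (ncyc D s)"
proof -
  have "s \<circ> transpose a b permutes D" using s ab by (intro permutes_compose permutes_swap_id)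
  from ncyc_merge[OF this s(2) ab(1,2) orbit_split[OF s b ab(3)]] show ?thesis
    by (simp add: comp_assoc)
qed

lemma ncyc_insert_fixed:
  assumes s: "s permutes D" "finite D" and d: "d \<notin> D"
  shows "ncyc (insert d D) s = Suc (ncyc D s)"
proof -
  have "s d = d" using s d by (simp add: permutes_not_in)
  then have od: "orbit s d = {d}" by (simp add: orbit_eq_singleton_iff)
  have "orbit s d \<notin> orbit s ` D"
    using od permutes_orbit_subset[OF s(1)] d by (metis (no_types, lifting) imageE insert_subset)
  then show ?thesis using s by (simp add: ncyc_def)
qed

text \<open>The fresh d first counts as a cycle of its own and is then merged with the cycle of p;
  the two changes cancel.\<close>

lemma ncyc_insert_merge:
  assumes s: "s permutes D" "finite D" and d: "d \<notin> D" "p \<in> D"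
  shows "ncyc (insert d D) (s \<circ> transpose p d) = ncyc D s"
proof -
  have "d \<notin> orbit s p" using permutes_orbit_subset[OF s(1) d(2)] d by auto
  then show ?thesis
    using ncyc_merge[of s "insert d D" p d] ncyc_insert_fixed[OF s d(1)] s d
    by (simp add: permutes_imp_permutes_insert)
qed

section \<open>Products of permutations of disjoint sets\<close>

lemma comp_disjoint_apply:
  assumes "s permutes D" "t permutes E" "D \<inter> E = {}"
  shows "x \<in> D \<Longrightarrow> (s \<circ> t) x = s x" "x \<in> E \<Longrightarrow> (s \<circ> t) x = t x"
  using assms permutes_in_image[OF assms(2), of x] permutes_not_in[OF assms(1), of "t x"]
    permutes_not_in[OF assms(2), of x] by auto

lemma comp_disjoint_permutes:
  assumes "s permutes D" "t permutes E"
  shows "s \<circ> t permutes D \<union> E"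
  using assms by (intro permutes_compose) (auto intro: permutes_subset)

lemma orbit_comp_disjoint:
  assumes s: "s permutes D" "t permutes E" "D \<inter> E = {}" "finite D" "finite E"
  shows "x \<in> D \<Longrightarrow> orbit (s \<circ> t) x = orbit s x" "x \<in> E \<Longrightarrow> orbit (s \<circ> t) x = orbit t x"
proof -
  assume x: "x \<in> D"
  show "orbit (s \<circ> t) x = orbit s x"
    by (rule orbit_cong[OF perm_self_in_orbit[OF s(1,4)]])
       (use permutes_orbit_subset[OF s(1) x] comp_disjoint_apply[OF s(1-3)] in auto)
next
  assume x: "x \<in> E"
  show "orbit (s \<circ> t) x = orbit t x"
    by (rule orbit_cong[OF perm_self_in_orbit[OF s(2,5)]])
       (use permutes_orbit_subset[OF s(2) x] comp_disjoint_apply[OF s(1-3)] in auto)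
qed

lemma ncyc_comp_disjoint:
  assumes s: "s permutes D" "t permutes E" "D \<inter> E = {}" "finite D" "finite E"
  shows "ncyc (D \<union> E) (s \<circ> t) = ncyc D s + ncyc E t"
proof -
  have "orbit (s \<circ> t) ` (D \<union> E) = orbit s ` D \<union> orbit t ` E"
    unfolding image_Un using orbit_comp_disjoint[OF s] by (intro arg_cong2[of _ _ _ _ "(\<union>)"] image_cong) auto
  moreover have "orbit s ` D \<inter> orbit t ` E = {}"
  proof -
    have "orbit s x \<noteq> orbit t y" if "x \<in> D" "y \<in> E" for x y
      using permutes_orbit_subset[OF s(1) that(1)] permutes_orbit_subset[OF s(2) that(2)] s(3) orbit_nonempty[of s x]
      by blast
    then show ?thesis by auto
  qed
  ultimately show ?thesis using s by (simp add: ncyc_def card_Un_disjoint)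
qed

lemma ncyc_pos: "finite D \<Longrightarrow> D \<noteq> {} \<Longrightarrow> ncyc D s > 0"
  by (simp add: ncyc_def card_gt_0_iff)

section \<open>Subsets closed under a permutation\<close>

lemma perm_closed_image:
  assumes "s permutes D" "finite D" "S \<subseteq> D" "s ` S \<subseteq> S"
  shows "s ` S = S"
  using assms by (metis endo_inj_surj finite_subset permutes_inj_on)

text \<open>On a finite set a closed subset is mapped onto itself, so nothing can enter it from
  outside. This makes forward reachability symmetric and lets a map be cut into components.\<close>

lemma perm_closed_complement:
  assumes "s permutes D" "finite D" "S \<subseteq> D" "s ` S \<subseteq> S"
  shows "s ` (D - S) \<subseteq> D - S"
  using perm_closed_image[OF assms] assms
  by (metis image_set_diff permutes_image permutes_inj set_eq_subset)

lemma perm_restrict_permutes: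
  assumes "s permutes D" "finite D" "S \<subseteq> D" "s ` S \<subseteq> S"
  shows "perm_restrict s S permutes S"
proof (rule bij_imp_permutes)
  have "bij_betw s S S"
    using perm_closed_image[OF assms] assms permutes_inj_on by (auto simp: bij_betw_def)
  then show "bij_betw (perm_restrict s S) S S"
    by (rule bij_betw_cong[THEN iffD1, rotated]) (simp add: perm_restrict_simps)
qed (simp add: perm_restrict_simps)

lemma funpow_orbit_card:
  assumes s: "s permutes D" "finite D"
  shows "(s ^^ card (orbit s a)) a = a" "inj_on (\<lambda>i. (s ^^ i) a) {..<card (orbit s a)}"
    "(\<lambda>i. (s ^^ i) a) ` {..<card (orbit s a)} = orbit s a"
proof -
  note a = perm_self_in_orbit[OF s, of a]
  have eq: "orbit s a = (\<lambda>i. (s ^^ i) a) ` {..<funpow_dist1 s a a}"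
    using orbit_conv_funpow_dist1[OF a] by (simp add: atLeast0LessThan)
  have inj: "inj_on (\<lambda>i. (s ^^ i) a) {..<funpow_dist1 s a a}"
    using inj_on_funpow_dist1[OF a] by (simp only: atLeast0LessThan)
  have c: "card (orbit s a) = funpow_dist1 s a a" by (subst eq) (simp add: card_image[OF inj])
  show "(s ^^ card (orbit s a)) a = a" "inj_on (\<lambda>i. (s ^^ i) a) {..<card (orbit s a)}"
    "(\<lambda>i. (s ^^ i) a) ` {..<card (orbit s a)} = orbit s a"
    unfolding c using funpow_dist1_prop[OF a] inj eq by auto
qed

section \<open>Maps with two arrows\<close>

text \<open>Maps whose involution fixes the darts in \<open>F\<close>, every component of which meets \<open>R\<close>.\<close>

definition premap :: "'d rmap \<Rightarrow> 'd set \<Rightarrow> 'd set \<Rightarrow> bool" where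
  "premap M F R \<longleftrightarrow> finite (darts M) \<and> arrow M \<in> R \<and> R \<subseteq> F \<and> F \<subseteq> darts M \<and>
     rot M permutes darts M \<and> opp M permutes darts M \<and> (\<forall>x. opp M (opp M x) = x) \<and>
     (\<forall>x\<in>darts M. opp M x = x \<longleftrightarrow> x \<in> F) \<and>
     (\<forall>S\<subseteq>darts M. R \<subseteq> S \<longrightarrow> rot M ` S \<subseteq> S \<longrightarrow> opp M ` S \<subseteq> S \<longrightarrow> S = darts M)"

lemma premapD:
  assumes "premap M F R"
  shows "finite (darts M)" "arrow M \<in> R" "R \<subseteq> F" "F \<subseteq> darts M" "rot M permutes darts M" "opp M permutes darts M"
    "opp M (opp M x) = x" "x \<in> darts M \<Longrightarrow> opp M x = x \<longleftrightarrow> x \<in> F" "x \<in> F \<Longrightarrow> opp M x = x"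
    "rot M x \<in> darts M \<longleftrightarrow> x \<in> darts M" "opp M x \<in> darts M \<longleftrightarrow> x \<in> darts M"
    "x \<notin> darts M \<Longrightarrow> rot M x = x" "x \<notin> darts M \<Longrightarrow> opp M x = x"
  using assms by (auto simp: premap_def image_subset_iff permutes_not_in permutes_in_image)

lemma premap_conn:
  assumes "premap M F R" "S \<subseteq> darts M" "R \<subseteq> S" "\<And>x. x \<in> S \<Longrightarrow> rot M x \<in> S" "\<And>x. x \<in> S \<Longrightarrow> opp M x \<in> S"
  shows "S = darts M"
  using assms by (auto simp: premap_def image_subset_iff)

lemma premapI:
  assumes "finite (darts M)" "arrow M \<in> R" "R \<subseteq> F" "F \<subseteq> darts M" "rot M permutes darts M" "opp M permutes darts M"
    "\<And>x. opp M (opp M x) = x" "\<And>x. x \<in> darts M \<Longrightarrow> opp M x = x \<longleftrightarrow> x \<in> F"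
    "\<And>S. S \<subseteq> darts M \<Longrightarrow> R \<subseteq> S \<Longrightarrow> (\<And>x. x \<in> S \<Longrightarrow> rot M x \<in> S) \<Longrightarrow> (\<And>x. x \<in> S \<Longrightarrow> opp M x \<in> S) \<Longrightarrow> S = darts M"
  shows "premap M F R"
  using assms by (auto simp: premap_def image_subset_iff)

text \<open>The relation in \<open>rooted_map\<close> only steps forward. If x did not reach the
  arrow, the complement of its reachable set would be closed by finiteness and contain the arrow,
  hence be everything, although x is missing. Closed sets are the convenient form of connectedness
  here, because each construction below changes the permutations at a few darts only.\<close>

lemma rooted_map_iff: "rooted_map M \<longleftrightarrow> premap M {arrow M} {arrow M}"
proof
  assume M: "rooted_map M"
  let ?R = "{(x, y). x \<in> darts M \<and> (y = rot M x \<or> y = opp M x)}"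
  show "premap M {arrow M} {arrow M}"
  proof (rule premapI)
    fix x show "opp M (opp M x) = x"
      using M by (cases "x \<in> darts M") (auto simp: rooted_map_def permutes_not_in)
  next
    fix S assume S: "S \<subseteq> darts M" "{arrow M} \<subseteq> S" "\<And>x. x \<in> S \<Longrightarrow> rot M x \<in> S" "\<And>x. x \<in> S \<Longrightarrow> opp M x \<in> S"
    have "y \<in> S" if "(arrow M, y) \<in> ?R\<^sup>*" for y
      using that by induction (use S(2-4) in auto)
    then show "S = darts M" using M S by (auto simp: rooted_map_def)
  qed (use M in \<open>auto simp: rooted_map_def\<close>)
next
  assume M: "premap M {arrow M} {arrow M}"
  let ?R = "{(x, y). x \<in> darts M \<and> (y = rot M x \<or> y = opp M x)}"
  note D = premapD[OF M]
  note C = premap_conn[OF M]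
  have reach: "?R\<^sup>* `` {x} = darts M" if x: "x \<in> darts M" for x
  proof -
    let ?S = "?R\<^sup>* `` {x}"
    have "y \<in> darts M" if "(x, y) \<in> ?R\<^sup>*" for y
      using that by induction (use x D in auto)
    then have sub: "?S \<subseteq> darts M" by auto
    have cl: "rot M y \<in> ?S" "opp M y \<in> ?S" if "y \<in> ?S" for y
      using that sub by (auto intro!: rtrancl.rtrancl_into_rtrancl[of x y])
    then have cl': "rot M ` (darts M - ?S) \<subseteq> darts M - ?S" "opp M ` (darts M - ?S) \<subseteq> darts M - ?S"
      using sub D(1,5,6) by (intro perm_closed_complement; blast)+
    have "arrow M \<in> ?S"
    proof (rule ccontr)
      assume "arrow M \<notin> ?S"
      then have "darts M - ?S = darts M" using D(2-4) cl' by (intro C) auto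
      moreover have "x \<in> ?S" by auto
      ultimately show False using x by blast
    qed
    then show ?thesis using sub cl by (intro C) auto
  qed
  show "rooted_map M"
    unfolding rooted_map_def using D(1-9) reach by auto
qed

lemmas rootedD = premapD[OF rooted_map_iff[THEN iffD1]] and rooted_conn = premap_conn[OF rooted_map_iff[THEN iffD1]]

text \<open>\<open>add_root\<close> accepts maps with one component per arrow; with this lemma it
  also applies to maps that are connected from the first arrow alone.\<close>

lemma premap_mono:
  assumes "premap M F R" "R \<subseteq> R'" "R' \<subseteq> F"
  shows "premap M F R'"
proof (rule premapI)
  note D = premapD[OF assms(1)]
  note C = premap_conn[OF assms(1)]
  show "S = darts M" if "S \<subseteq> darts M" "R' \<subseteq> S" "\<And>x. x \<in> S \<Longrightarrow> rot M x \<in> S" "\<And>x. x \<in> S \<Longrightarrow> opp M x \<in> S" for S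
    using that assms(2) by (intro C) auto
  show "arrow M \<in> R'" using D(2) assms(2) by blast
qed (use assms premapD(1-9)[OF assms(1)] in \<open>simp_all\<close>)

section \<open>Vertex, face and dart numbers\<close>

definition nv :: "'d rmap \<Rightarrow> nat" where "nv M = ncyc (darts M) (rot M)"
definition nf :: "'d rmap \<Rightarrow> nat" where "nf M = ncyc (darts M) (rot M \<circ> opp M)"

lemma card_vertices: "card (vertices M) = nv M" and card_faces: "card (faces M) = nf M"
  by (simp_all add: vertices_def faces_def nv_def nf_def ncyc_def)

lemma card_darts:
  assumes "rooted_map M"
  shows "card (darts M) = 2 * card (edges M) + 1"
proof -
  note D = rootedD[OF assms]
  have orb: "orbit (opp M) x = {x, opp M x}" for x
  proof -
    have "(opp M ^^ 2) x = x" using D(7)[of x] by (simp add: numeral_2_eq_2)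
    from orbit_altdef_bounded[OF this] have "orbit (opp M) x = (\<lambda>m. (opp M ^^ m) x) ` {..<2}" by auto
    also have "{..<2::nat} = {0, 1}" by auto
    finally show ?thesis by simp
  qed
  have edges: "edges M = (\<lambda>x. {x, opp M x}) ` (darts M - {arrow M})" by (simp add: edges_def orb)
  have "2 * card (edges M) = card (\<Union>(edges M))"
  proof (rule card_partition)
    show "finite (edges M)" "finite (\<Union>(edges M))" using D(1) by (simp_all add: edges)
    show "card c = 2" if "c \<in> edges M" for c
    proof -
      obtain x where x: "x \<in> darts M" "x \<noteq> arrow M" "c = {x, opp M x}" using \<open>c \<in> edges M\<close> unfolding edges by blast
      then have "x \<noteq> opp M x" using D(8)[of x] by auto
      then show ?thesis using x by simp
    qed
    show "c1 \<inter> c2 = {}" if c: "c1 \<in> edges M" "c2 \<in> edges M" "c1 \<noteq> c2" for c1 c2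
    proof -
      obtain x where x: "c1 = {x, opp M x}" using c(1) unfolding edges by blast
      obtain y where y: "c2 = {y, opp M y}" using c(2) unfolding edges by blast
      have "c1 = c2" if "z \<in> c1" "z \<in> c2" for z
        using that unfolding x y using D(7)[of x] D(7)[of y] by (elim insertE emptyE) auto
      then show ?thesis using c(3) by blast
    qed
  qed
  also have "\<Union>(edges M) = darts M - {arrow M}"
  proof -
    have "opp M x \<in> darts M - {arrow M}" if "x \<in> darts M - {arrow M}" for x
      using that D(11)[of x] D(7)[of x] D(9)[of "arrow M"] by auto
    then have "(\<Union>x\<in>darts M - {arrow M}. {x, opp M x}) = darts M - {arrow M}" by fast
    then show ?thesis by (simp add: edges_def orb)
  qed
  also have "card \<dots> = card (darts M) - 1" using D(1,4) by (intro card_Diff_singleton) auto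
  finally have "2 * card (edges M) = card (darts M) - 1" .
  moreover have "0 < card (darts M)" using D(1,4) by (auto simp: card_gt_0_iff)
  ultimately show ?thesis by simp
qed

text \<open>Since the number of darts is 2 e + 1, doubling Euler's formula turns it into an equation
  of natural numbers without subtraction.\<close>

lemma planar_map_iff:
  "planar_map M \<longleftrightarrow> rooted_map M \<and> 2 * (nv M + nf M) = card (darts M) + 3"
  unfolding planar_map_def has_genus_def card_vertices card_faces using card_darts[of M] by auto

text \<open>For a fresh b the cyclic order becomes p, b, rot p: a second arrow is placed in the
  corner after p. As \<open>opp\<close> is unchanged, b is one of its fixed points.\<close>

definition ins :: "'d \<Rightarrow> 'd \<Rightarrow> 'd rmap \<Rightarrow> 'd rmap" where
  "ins p b M = M\<lparr>darts := insert b (darts M), rot := rot M \<circ> transpose p b\<rparr>"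

text \<open>If \<open>a\<close> is the arrow and \<open>b\<close> a second one, the new edge \<open>{d, b}\<close> starts right after \<open>a\<close>: the
  rotation becomes \<open>a \<mapsto> d\<close>, \<open>d \<mapsto> rot b\<close>, \<open>b \<mapsto> rot a\<close>. It is a loop exactly if \<open>a\<close> and \<open>b\<close> were at
  different vertices.\<close>

definition add_root :: "'d \<Rightarrow> 'd \<Rightarrow> 'd rmap \<Rightarrow> 'd rmap" where
  "add_root b d M = M\<lparr>darts := insert d (darts M),
     rot := rot M \<circ> transpose (arrow M) b \<circ> transpose (arrow M) d, opp := opp M \<circ> transpose b d\<rparr>"

text \<open>The second arrow b becomes a half-edge. Its fresh partner l is fixed by
  \<open>rot\<close> and so forms a vertex of degree 1.\<close>

definition add_leaf :: "'d \<Rightarrow> 'd \<Rightarrow> 'd rmap \<Rightarrow> 'd rmap" where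
  "add_leaf b l M = M\<lparr>darts := insert l (darts M), opp := opp M \<circ> transpose b l\<rparr>"

text \<open>For maps on disjoint darts each permutation is trivial on the darts of the other map, so
  composition yields the disjoint union. The arrow of N survives as a second fixed point of
  \<open>opp\<close>.\<close>

definition join :: "'d rmap \<Rightarrow> 'd rmap \<Rightarrow> 'd rmap" where
  "join M N = M\<lparr>darts := darts M \<union> darts N, rot := rot M \<circ> rot N, opp := opp M \<circ> opp N\<rparr>"

lemma ins_simps [simp]:
  "darts (ins p b M) = insert b (darts M)" "rot (ins p b M) = rot M \<circ> transpose p b"
  "opp (ins p b M) = opp M" "arrow (ins p b M) = arrow M"
  by (simp_all add: ins_def)

lemma add_root_simps [simp]:
  "darts (add_root b d M) = insert d (darts M)"
  "rot (add_root b d M) = rot M \<circ> transpose (arrow M) b \<circ> transpose (arrow M) d"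
  "opp (add_root b d M) = opp M \<circ> transpose b d" "arrow (add_root b d M) = arrow M"
  by (simp_all add: add_root_def)

lemma add_leaf_simps [simp]:
  "darts (add_leaf b d M) = insert d (darts M)" "rot (add_leaf b d M) = rot M"
  "opp (add_leaf b d M) = opp M \<circ> transpose b d" "arrow (add_leaf b d M) = arrow M"
  by (simp_all add: add_leaf_def)

lemma join_simps [simp]:
  "darts (join M N) = darts M \<union> darts N" "rot (join M N) = rot M \<circ> rot N"
  "opp (join M N) = opp M \<circ> opp N" "arrow (join M N) = arrow M"
  by (simp_all add: join_def)

lemma permutes_insert_transpose:
  "s permutes D \<Longrightarrow> a \<in> insert d D \<Longrightarrow> b \<in> insert d D \<Longrightarrow> s \<circ> transpose a b permutes insert d D"
  by (intro permutes_compose permutes_swap_id permutes_imp_permutes_insert)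

lemma premap_ins:
  assumes M: "rooted_map M" and p: "p \<in> darts M" and b: "b \<notin> darts M"
  shows "premap (ins p b M) {arrow M, b} {arrow M}"
proof (rule premapI)
  note D = rootedD[OF M]
  note C = rooted_conn[OF M]
  show "rot (ins p b M) permutes darts (ins p b M)" "opp (ins p b M) permutes darts (ins p b M)"
    using D(5,6) p by (simp_all add: permutes_insert_transpose permutes_imp_permutes_insert)
  show "opp (ins p b M) x = x \<longleftrightarrow> x \<in> {arrow M, b}" if "x \<in> darts (ins p b M)" for x
    using that D(8) D(13) b by auto
  fix S assume S: "S \<subseteq> darts (ins p b M)" "{arrow M} \<subseteq> S"
    "\<And>x. x \<in> S \<Longrightarrow> rot (ins p b M) x \<in> S" "\<And>x. x \<in> S \<Longrightarrow> opp (ins p b M) x \<in> S"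
  have "S - {b} = darts M"
  proof (rule C)
    show "{arrow M} \<subseteq> S - {b}" using S(2) D(2-4) b by auto
    fix x assume x: "x \<in> S - {b}"
    then have xD: "x \<in> darts M" using S(1) by auto
    show "rot M x \<in> S - {b}"
    proof (cases "x = p")
      case True
      then have "b \<in> S" using S(3)[of p] x D(12)[OF b] by simp
      then show ?thesis using S(3)[of b] True D(10)[of p] p b by auto
    next
      case False
      then show ?thesis using S(3)[of x] x D(10)[of x] xD b by auto
    qed
    show "opp M x \<in> S - {b}" using S(4)[of x] x D(11)[of x] xD b by auto
  qed (use S(1,2) in auto)
  moreover have "b \<in> S" using S(3)[of p] D(12)[OF b] p calculation by auto
  ultimately show "S = darts (ins p b M)" by auto
qed (use rootedD(1-7)[OF M] in auto)

lemma premap_obtain_ins: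
  assumes M: "premap M {arrow M, b} {arrow M}" and b: "b \<noteq> arrow M"
  obtains N p where "rooted_map N" "p \<in> darts N" "b \<notin> darts N" "M = ins p b N" "arrow N = arrow M"
proof -
  note D = premapD[OF M]
  note C = premap_conn[OF M]
  define p where "p = inv (rot M) b"
  have p: "rot M p = b" using D(5) by (simp add: p_def permutes_inverses)
  have bD: "b \<in> darts M" using D(4) by auto
  have pD: "p \<in> darts M" using D(10)[of p] p bD by simp
  \<comment> \<open>If \<open>rot\<close> fixed b, then b would be a component of its own without
    the arrow.\<close>
  have pb: "p \<noteq> b"
  proof
    assume "p = b"
    then have rb: "rot M x = b \<longleftrightarrow> x = b" for x using p inj_eq[OF permutes_inj[OF D(5)], of x b] by simp
    have ob: "opp M x = b \<longleftrightarrow> x = b" for x using D(7)[of x] D(9)[of b] by auto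
    have "darts M - {b} = darts M"
    proof (rule C)
      show "{arrow M} \<subseteq> darts M - {b}" using D(4) b by auto
      show "rot M x \<in> darts M - {b}" if "x \<in> darts M - {b}" for x using that rb[of x] D(10)[of x] by simp
      show "opp M x \<in> darts M - {b}" if "x \<in> darts M - {b}" for x using that ob[of x] D(11)[of x] by simp
    qed auto
    then show False using bD by blast
  qed
  define N where "N = M\<lparr>darts := darts M - {b}, rot := rot M \<circ> transpose p b\<rparr>"
  have N: "darts N = darts M - {b}" "rot N = rot M \<circ> transpose p b" "opp N = opp M" "arrow N = arrow M"
    by (simp_all add: N_def)
  have rb: "rot N b = b" by (simp add: N p)
  have ob: "opp M b = b" using D(9)[of b] by simp
  have "premap N {arrow M} {arrow M}"
  proof (rule premapI)
    have "rot N permutes darts M" using N D(5) bD pD by (simp add: permutes_compose permutes_swap_id)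
    then show "rot N permutes darts N"
      by (rule permutes_superset) (use rb in \<open>auto simp: N\<close>)
    have "opp M permutes darts M - {b}"
      by (rule permutes_superset[OF D(6)]) (use ob in auto)
    then show "opp N permutes darts N" by (simp add: N)
    fix S assume S: "S \<subseteq> darts N" "{arrow M} \<subseteq> S" "\<And>x. x \<in> S \<Longrightarrow> rot N x \<in> S" "\<And>x. x \<in> S \<Longrightarrow> opp N x \<in> S"
    \<comment> \<open>In M the dart b follows p, so a closed set of N has to be completed by b
      exactly when it contains p.\<close>
    let ?S = "if p \<in> S then insert b S else S"
    have nb: "b \<notin> S" using S(1) N by auto
    have "?S = darts M"
    proof (rule C)
      fix x assume x: "x \<in> ?S"
      show "rot M x \<in> ?S"
      proof (cases "x = b")
        case True
        then have "p \<in> S" using x nb by (auto split: if_splits)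
        then show ?thesis using S(3)[of p] True N by simp
      next
        case False
        then have "x \<in> S" using x by (auto split: if_splits)
        then show ?thesis using S(3)[of x] False N p by (cases "x = p") auto
      qed
      show "opp M x \<in> ?S" using x S(4)[of x] N ob by (auto split: if_splits)
    qed (use S(1,2) bD N(1) in auto)
    then show "S = darts N" using nb N by (auto split: if_splits)
  qed (use D(1-4,7,8) b N in \<open>auto simp del: o_apply\<close>)
  then have "rooted_map N" unfolding rooted_map_iff by (simp add: N)
  moreover have "M = ins p b N"
  proof -
    have "insert b (darts M - {b}) = darts M" using bD by auto
    then show ?thesis by (simp add: N_def ins_def comp_assoc)
  qed
  moreover have "p \<in> darts N" "b \<notin> darts N" "arrow N = arrow M" using pD pb by (simp_all only: N) auto
  ultimately show ?thesis by (intro that[of N p])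
qed

lemma ins_counts:
  assumes M: "rooted_map M" and p: "p \<in> darts M" and b: "b \<notin> darts M"
  shows "nv (ins p b M) = nv M" "nf (ins p b M) = nf M" "card (darts (ins p b M)) = Suc (card (darts M))"
proof -
  note D = rootedD[OF M]
  show "nv (ins p b M) = nv M" unfolding nv_def using ncyc_insert_merge[OF D(5,1) b p] by simp
  \<comment> \<open>Moving the transposition past the involution replaces p by
    \<open>opp M p\<close>: in the face permutation b is inserted right after that dart.\<close>
  have "rot M \<circ> transpose p b \<circ> opp M = (rot M \<circ> opp M) \<circ> transpose (opp M p) b"
  proof (rule ext)
    fix x
    have "opp M x = b \<longleftrightarrow> x = b" "opp M x = p \<longleftrightarrow> x = opp M p"
      using D(7)[of x] D(7)[of p] D(13)[OF b] by auto
    then show "(rot M \<circ> transpose p b \<circ> opp M) x = (rot M \<circ> opp M \<circ> transpose (opp M p) b) x"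
      using D(7) D(13)[OF b] by (auto simp: transpose_def)
  qed
  then show "nf (ins p b M) = nf M"
    unfolding nf_def using ncyc_insert_merge[of "rot M \<circ> opp M" "darts M" b "opp M p"] D(1,5,6,11) b p
    by (simp add: permutes_compose)
  show "card (darts (ins p b M)) = Suc (card (darts M))" using D(1) b by simp
qed

lemma rooted_add_leaf:
  assumes M: "premap M {arrow M, b} {arrow M}" and b: "b \<noteq> arrow M" and l: "l \<notin> darts M"
  shows "rooted_map (add_leaf b l M)"
  unfolding rooted_map_iff
proof (rule premapI)
  note D = premapD[OF M]
  note C = premap_conn[OF M]
  have bD: "b \<in> darts M" "opp M b = b" using D(4) D(9) by auto
  have bl: "b \<noteq> l" using bD l by auto
  have ol: "opp M l = l" using D(13) l by auto
  show "rot (add_leaf b l M) permutes darts (add_leaf b l M)" "opp (add_leaf b l M) permutes darts (add_leaf b l M)"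
    using D(5,6) bD by (simp_all add: permutes_insert_transpose permutes_imp_permutes_insert)
  have ox: "opp M x = b \<longleftrightarrow> x = b" "opp M x = l \<longleftrightarrow> x = l" for x using D(7)[of x] bD ol by auto
  show "opp (add_leaf b l M) (opp (add_leaf b l M) x) = x" for x
    using D(7) ol bD ox by (auto simp: transpose_def)
  show "opp (add_leaf b l M) x = x \<longleftrightarrow> x \<in> {arrow (add_leaf b l M)}" if "x \<in> darts (add_leaf b l M)" for x
    using that D(8)[of x] ol bD bl b D(2-4) l by (auto simp: transpose_def)
  fix S assume S: "S \<subseteq> darts (add_leaf b l M)" "{arrow (add_leaf b l M)} \<subseteq> S"
    "\<And>x. x \<in> S \<Longrightarrow> rot (add_leaf b l M) x \<in> S" "\<And>x. x \<in> S \<Longrightarrow> opp (add_leaf b l M) x \<in> S"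
  have "S - {l} = darts M"
  proof (rule C)
    show "{arrow M} \<subseteq> S - {l}" using S(2) D(2-4) l by auto
    fix x assume x: "x \<in> S - {l}"
    then have xD: "x \<in> darts M" using S(1) by auto
    show "rot M x \<in> S - {l}" using S(3)[of x] x D(10)[of x] xD l by auto
    show "opp M x \<in> S - {l}" using S(4)[of x] x D(11)[of x] xD l bD by (cases "x = b") auto
  qed (use S(1,2) in auto)
  moreover have "l \<in> S" using S(4)[of b] ol calculation bD by auto
  ultimately show "S = darts (add_leaf b l M)" by auto
qed (use premapD(1-4)[OF M] in auto)

lemma obtain_add_leaf:
  assumes M: "rooted_map M" and l: "l \<in> darts M" "rot M l = l" "l \<noteq> arrow M" and big: "opp M l \<noteq> arrow M"
  obtains N b where "premap N {arrow N, b} {arrow N}" "b \<noteq> arrow N" "l \<notin> darts N" "M = add_leaf b l N"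
proof -
  note D = rootedD[OF M]
  note C = rooted_conn[OF M]
  define b where "b = opp M l"
  have b: "opp M b = l" "opp M l = b" "b \<noteq> l" "b \<in> darts M" "b \<noteq> arrow M"
    using l D(7) D(8)[of l] D(11)[of l] big by (auto simp: b_def)
  define N where "N = M\<lparr>darts := darts M - {l}, opp := opp M \<circ> transpose b l\<rparr>"
  have N: "darts N = darts M - {l}" "rot N = rot M" "opp N = opp M \<circ> transpose b l" "arrow N = arrow M"
    by (simp_all add: N_def)
  have on: "opp N l = l" "opp N b = b" using b by (simp_all add: N)
  have ox: "opp M x = b \<longleftrightarrow> x = l" "opp M x = l \<longleftrightarrow> x = b" for x
    using D(7)[of x] b(1,2) by metis+
  have "premap N {arrow N, b} {arrow N}"
  proof (rule premapI)
    have "opp N permutes darts M" using N D(6) b l by (simp add: permutes_compose permutes_swap_id)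
    then show "opp N permutes darts N"
      by (rule permutes_superset) (use on in \<open>auto simp: N\<close>)
    have "rot M permutes darts M - {l}"
      by (rule permutes_superset[OF D(5)]) (use l in auto)
    then show "rot N permutes darts N" by (simp add: N)
    show "opp N (opp N x) = x" for x using D(7) b ox by (auto simp: N transpose_def)
    show "opp N x = x \<longleftrightarrow> x \<in> {arrow N, b}" if "x \<in> darts N" for x
      using that D(8)[of x] b by (auto simp: N transpose_def)
    fix S assume S: "S \<subseteq> darts N" "{arrow N} \<subseteq> S" "\<And>x. x \<in> S \<Longrightarrow> rot N x \<in> S" "\<And>x. x \<in> S \<Longrightarrow> opp N x \<in> S"
    let ?S = "if b \<in> S then insert l S else S"
    have nl: "l \<notin> S" using S(1) N by auto
    have "?S = darts M"
    proof (rule C)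
      fix x assume x: "x \<in> ?S"
      show "rot M x \<in> ?S" using x S(3)[of x] N l by (auto split: if_splits)
      show "opp M x \<in> ?S"
      proof (cases "x = l")
        case True
        then show ?thesis using x nl b by (auto split: if_splits)
      next
        case False
        then have "x \<in> S" using x by (auto split: if_splits)
        then show ?thesis using S(4)[of x] False N b by (cases "x = b") auto
      qed
    qed (use S(1,2) l N(1,4) in auto)
    then show "S = darts N" using nl N by (auto split: if_splits)
  qed (use D(1-4) b l N in auto)
  moreover have "M = add_leaf b l N"
  proof -
    have "insert l (darts M - {l}) = darts M" using l by auto
    then show ?thesis by (simp add: N_def add_leaf_def comp_assoc)
  qed
  moreover have "b \<noteq> arrow N" "l \<notin> darts N" using b by (simp_all only: N) auto
  ultimately show ?thesis by (intro that[of N b])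
qed

text \<open>The dart l is a cycle of \<open>rot\<close> by itself, hence a new vertex, whereas in
  the face permutation it is merged into the cycle of b.\<close>

lemma add_leaf_counts:
  assumes M: "premap M F R" and b: "b \<in> darts M" and l: "l \<notin> darts M"
  shows "nv (add_leaf b l M) = Suc (nv M)" "nf (add_leaf b l M) = nf M"
    "card (darts (add_leaf b l M)) = Suc (card (darts M))"
proof -
  note D = premapD[OF M]
  show "nv (add_leaf b l M) = Suc (nv M)" unfolding nv_def using ncyc_insert_fixed[OF D(5,1) l] by simp
  show "nf (add_leaf b l M) = nf M"
    unfolding nf_def using ncyc_insert_merge[of "rot M \<circ> opp M" "darts M" l b] D(1,5,6) b l
    by (simp add: permutes_compose comp_assoc)
  show "card (darts (add_leaf b l M)) = Suc (card (darts M))" using D(1) l by simp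
qed

text \<open>Each component of M contains one of the two arrows, and the new edge links them:
  \<open>rot\<close> leads from the arrow to d and \<open>opp\<close> from d to b.\<close>

lemma rooted_add_root:
  assumes M: "premap M {arrow M, b} {arrow M, b}" and b: "b \<noteq> arrow M" and d: "d \<notin> darts M"
  shows "rooted_map (add_root b d M)"
  unfolding rooted_map_iff
proof (rule premapI)
  note D = premapD[OF M]
  note C = premap_conn[OF M]
  let ?a = "arrow M" and ?N = "add_root b d M"
  have bD: "?a \<in> darts M" "b \<in> darts M" "opp M b = b" "opp M ?a = ?a" using D(4) D(9) by auto
  have ne: "b \<noteq> d" "?a \<noteq> d" using bD d by auto
  have od: "opp M d = d" "rot M d = d" using D(12,13) d by auto
  show "rot ?N permutes darts ?N" "opp ?N permutes darts ?N"
    using D(5,6) bD by (simp_all add: permutes_insert_transpose permutes_compose permutes_swap_id permutes_imp_permutes_insert)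
  have ox: "opp M x = b \<longleftrightarrow> x = b" "opp M x = d \<longleftrightarrow> x = d" for x using D(7)[of x] bD(3) od(1) by metis+
  have rot: "rot ?N ?a = d" "rot ?N d = rot M b" "rot ?N b = rot M ?a"
    "x \<noteq> ?a \<Longrightarrow> x \<noteq> b \<Longrightarrow> x \<noteq> d \<Longrightarrow> rot ?N x = rot M x" for x
    using ne b od by (auto simp: transpose_def)
  have opp: "opp ?N b = d" "opp ?N d = b" "x \<noteq> b \<Longrightarrow> x \<noteq> d \<Longrightarrow> opp ?N x = opp M x" for x
    using ne bD od by (auto simp: transpose_def)
  show "opp ?N (opp ?N x) = x" for x
    using opp D(7)[of x] ox[of x] by (cases "x = b \<or> x = d") auto
  show "opp ?N x = x \<longleftrightarrow> x \<in> {arrow ?N}" if "x \<in> darts ?N" for x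
  proof (cases "x = b \<or> x = d")
    case True then show ?thesis using opp ne b by auto
  next
    case False
    then have "opp ?N x = opp M x" using opp by simp
    then show ?thesis using D(8)[of x] that False by simp
  qed
  fix S assume S: "S \<subseteq> darts ?N" "{arrow ?N} \<subseteq> S"
    "\<And>x. x \<in> S \<Longrightarrow> rot ?N x \<in> S" "\<And>x. x \<in> S \<Longrightarrow> opp ?N x \<in> S"
  have aS: "?a \<in> S" using S(2) by simp
  have dS: "d \<in> S" using S(3)[OF aS] rot by simp
  have bS: "b \<in> S" using S(4)[OF dS] opp by simp
  have "S - {d} = darts M"
  proof (rule C)
    show "{?a, b} \<subseteq> S - {d}" using aS bS ne by auto
    show "S - {d} \<subseteq> darts M" using S(1) by auto
    fix x assume x: "x \<in> S - {d}"
    then have xD: "x \<in> darts M" using S(1) by auto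
    have "rot M x \<in> S"
      using S(3)[OF bS] S(3)[OF dS] S(3)[of x] x rot(2,3) rot(4)[of x] by (cases "x = ?a \<or> x = b") auto
    then show "rot M x \<in> S - {d}" using D(10)[of x] xD d by auto
    have "opp M x \<in> S" using S(4)[of x] x opp(3)[of x] bD bS by (cases "x = b") auto
    then show "opp M x \<in> S - {d}" using D(11)[of x] xD d by auto
  qed
  then show "S = darts ?N" using dS by auto
qed (use premapD(1-4)[OF M] in auto)

lemma obtain_add_root:
  assumes M: "rooted_map M" and big: "darts M \<noteq> {arrow M}"
  obtains N b d where "premap N {arrow N, b} {arrow N, b}" "b \<noteq> arrow N" "d \<notin> darts N"
    "M = add_root b d N" "arrow N = arrow M"
proof -
  note D = rootedD[OF M]
  note C = rooted_conn[OF M]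
  let ?a = "arrow M"
  have aD: "?a \<in> darts M" "opp M ?a = ?a" using D(4) D(9) by auto
  define d where "d = rot M ?a"
  define b where "b = opp M d"
  \<comment> \<open>An arrow alone at its vertex is closed under both permutations, so by
    connectedness it would be the whole map.\<close>
  have da: "d \<noteq> ?a"
  proof
    assume "d = ?a"
    then have "{?a} = darts M" using aD by (intro C) (auto simp: d_def)
    then show False using big by simp
  qed
  have dD: "d \<in> darts M" using aD D(10) by (simp add: d_def)
  have bD: "b \<in> darts M" using dD D(11) by (simp add: b_def)
  have bd: "b \<noteq> d" using D(8)[OF dD] da by (simp add: b_def)
  have ob: "opp M b = d" "opp M d = b" using D(7) by (simp_all add: b_def)
  have ba: "b \<noteq> ?a" using ob aD da by auto
  define N where "N = M\<lparr>darts := darts M - {d}, rot := rot M \<circ> transpose ?a d \<circ> transpose ?a b, opp := opp M \<circ> transpose b d\<rparr>"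
  have N: "darts N = darts M - {d}" "rot N = rot M \<circ> transpose ?a d \<circ> transpose ?a b"
    "opp N = opp M \<circ> transpose b d" "arrow N = ?a"
    by (simp_all add: N_def)
  have rot: "rot N d = d" "rot N ?a = rot M b" "rot N b = rot M d"
    "x \<noteq> ?a \<Longrightarrow> x \<noteq> b \<Longrightarrow> x \<noteq> d \<Longrightarrow> rot N x = rot M x" for x
    using da ba bd by (simp_all add: N transpose_def d_def)
  have opp: "opp N b = b" "opp N d = d" "x \<noteq> b \<Longrightarrow> x \<noteq> d \<Longrightarrow> opp N x = opp M x" for x
    using ob by (simp_all add: N transpose_def)
  have ox: "opp M x = b \<longleftrightarrow> x = d" "opp M x = d \<longleftrightarrow> x = b" for x using D(7)[of x] ob by metis+
  have pre: "premap N {?a, b} {?a, b}"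
  proof (rule premapI)
    have "rot N permutes darts M" unfolding N using D(5) aD bD dD by (intro permutes_compose permutes_swap_id)
    then show "rot N permutes darts N"
      by (rule permutes_superset) (use rot(1) in \<open>auto simp: N(1)\<close>)
    have "opp N permutes darts M" unfolding N using D(6) bD dD by (intro permutes_compose permutes_swap_id)
    then show "opp N permutes darts N"
      by (rule permutes_superset) (use opp(2) in \<open>auto simp: N(1)\<close>)
    show "opp N (opp N x) = x" for x
      using opp D(7)[of x] ox[of x] by (cases "x = b \<or> x = d") auto
    show "opp N x = x \<longleftrightarrow> x \<in> {?a, b}" if "x \<in> darts N" for x
    proof (cases "x = b")
      case False
      moreover have "x \<noteq> d" using that N by simp
      ultimately have "opp N x = opp M x" using opp by simp
      then show ?thesis using D(8)[of x] that False N by simp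
    qed (use opp in simp)
    fix S assume S: "S \<subseteq> darts N" "{?a, b} \<subseteq> S" "\<And>x. x \<in> S \<Longrightarrow> rot N x \<in> S" "\<And>x. x \<in> S \<Longrightarrow> opp N x \<in> S"
    have dS: "d \<notin> S" using S(1) N(1) by auto
    have "insert d S = darts M"
    proof (rule C)
      show "insert d S \<subseteq> darts M" using S(1) N(1) dD by auto
      fix x assume x: "x \<in> insert d S"
      show "rot M x \<in> insert d S"
      proof -
        consider "x = ?a" | "x = b" | "x = d" | "x \<noteq> ?a" "x \<noteq> b" "x \<noteq> d" by blast
        then show ?thesis
        proof cases
          case 1 then show ?thesis by (simp add: d_def)
        next
          case 2 then show ?thesis using S(3)[of ?a] S(2) rot(2) by simp
        next
          case 3 then show ?thesis using S(3)[of b] S(2) rot(3) by simp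
        next
          case 4 then show ?thesis using S(3)[of x] rot(4)[of x] x by simp
        qed
      qed
      show "opp M x \<in> insert d S"
        using S(4)[of x] S(2) x ob opp(3)[of x] by (cases "x = b \<or> x = d") auto
    qed (use S(2) in auto)
    then show "S = darts N" using dS N(1) by auto
    qed (use D(1) aD bD da bd N in auto)
  have "M = add_root b d N"
  proof -
    have "rot M \<circ> transpose ?a d \<circ> transpose ?a b \<circ> transpose ?a b \<circ> transpose ?a d = rot M"
      by (simp add: fun_eq_iff)
    moreover have "opp M \<circ> transpose b d \<circ> transpose b d = opp M" by (simp add: fun_eq_iff)
    moreover have "insert d (darts M - {d}) = darts M" using dD by auto
    ultimately show ?thesis by (simp add: N_def add_root_def)
  qed
  moreover have "d \<notin> darts N" "b \<noteq> arrow N" using ba by (simp_all add: N(1,4))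
  moreover have "premap N {arrow N, b} {arrow N, b}" unfolding N(4) by (rule pre)
  ultimately show ?thesis using N(4) by (intro that[of N b d])
qed

text \<open>For \<open>rot\<close>, the transposition of the arrow and b splits or merges a cycle
  according to whether they share a vertex, and d then joins an existing cycle. In the face
  permutation the three transpositions, all between fixed points of \<open>opp M\<close>, collapse
  to the one that inserts d after the arrow.\<close>

lemma add_root_counts:
  assumes M: "premap M {arrow M, b} {arrow M, b}" and b: "b \<noteq> arrow M" and d: "d \<notin> darts M"
  shows "nf (add_root b d M) = nf M" "card (darts (add_root b d M)) = Suc (card (darts M))"
    "b \<in> orbit (rot M) (arrow M) \<Longrightarrow> nv (add_root b d M) = Suc (nv M)"
    "b \<notin> orbit (rot M) (arrow M) \<Longrightarrow> Suc (nv (add_root b d M)) = nv M"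
proof -
  note D = premapD[OF M]
  let ?a = "arrow M" and ?N = "add_root b d M"
  have bD: "?a \<in> darts M" "b \<in> darts M" "opp M b = b" "opp M ?a = ?a" using D(4) D(9) by auto
  have ne: "b \<noteq> d" "?a \<noteq> d" using bD d by auto
  have od: "opp M d = d" "rot M d = d" using D(12,13) d by auto
  have ox: "opp M x = b \<longleftrightarrow> x = b" "opp M x = d \<longleftrightarrow> x = d" "opp M x = ?a \<longleftrightarrow> x = ?a" for x
    using D(7)[of x] bD od(1) by metis+
  have "rot ?N (opp ?N x) = (rot M \<circ> opp M \<circ> transpose ?a d) x" for x
  proof -
    consider "x = ?a" | "x = b" | "x = d" | "x \<noteq> ?a" "x \<noteq> b" "x \<noteq> d" by blast
    then show ?thesis using ne od bD b ox[of x] by cases (auto simp: transpose_def)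
  qed
  then have "rot ?N \<circ> opp ?N = rot M \<circ> opp M \<circ> transpose ?a d" by (simp add: fun_eq_iff)
  then show "nf ?N = nf M"
    unfolding nf_def using ncyc_insert_merge[of "rot M \<circ> opp M" "darts M" d ?a] D(1,5,6) bD d
    by (simp add: permutes_compose)
  show "card (darts ?N) = Suc (card (darts M))" using D(1) d by simp
  have p: "rot M \<circ> transpose ?a b permutes darts M" using D(5) bD by (intro permutes_compose permutes_swap_id)
  have nv: "nv ?N = ncyc (darts M) (rot M \<circ> transpose ?a b)"
    unfolding nv_def using ncyc_insert_merge[OF p D(1) d bD(1)] by simp
  show "b \<in> orbit (rot M) ?a \<Longrightarrow> nv ?N = Suc (nv M)"
    using ncyc_split[OF D(5,1) bD(1,2)] b nv by (auto simp: nv_def)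
  show "b \<notin> orbit (rot M) ?a \<Longrightarrow> Suc (nv ?N) = nv M"
    using ncyc_merge[OF D(5,1) bD(1,2)] nv by (auto simp: nv_def)
qed

lemma premap_join:
  assumes M: "rooted_map M" and N: "rooted_map N" and dis: "darts M \<inter> darts N = {}"
  shows "premap (join M N) {arrow M, arrow N} {arrow M, arrow N}" "arrow N \<noteq> arrow M"
proof -
  note D = rootedD[OF M] and E = rootedD[OF N]
  note C = rooted_conn[OF M] and C' = rooted_conn[OF N]
  have a: "arrow M \<in> darts M" "arrow N \<in> darts N" using D(4) E(4) by auto
  note r = comp_disjoint_apply[OF D(5) E(5) dis] and o = comp_disjoint_apply[OF D(6) E(6) dis]
  show "arrow N \<noteq> arrow M" using a dis by auto
  show "premap (join M N) {arrow M, arrow N} {arrow M, arrow N}"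
  proof (rule premapI)
    show "rot (join M N) permutes darts (join M N)" "opp (join M N) permutes darts (join M N)"
      using D(5,6) E(5,6) by (simp_all add: comp_disjoint_permutes)
    show "opp (join M N) (opp (join M N) x) = x" for x
    proof -
      consider "x \<in> darts M" | "x \<in> darts N" | "x \<notin> darts M" "x \<notin> darts N" by blast
      then show ?thesis
      proof cases
        case 1 then show ?thesis using o(1)[of x] o(1)[of "opp M x"] D(7,11) by simp
      next
        case 2 then show ?thesis using o(2)[of x] o(2)[of "opp N x"] E(7,11) by simp
      next
        case 3 then show ?thesis using D(13) E(13) by simp
      qed
    qed
    show "opp (join M N) x = x \<longleftrightarrow> x \<in> {arrow M, arrow N}" if "x \<in> darts (join M N)" for x
      using that o[of x] D(8)[of x] E(8)[of x] a dis by auto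
    fix S assume S: "S \<subseteq> darts (join M N)" "{arrow M, arrow N} \<subseteq> S"
      "\<And>x. x \<in> S \<Longrightarrow> rot (join M N) x \<in> S" "\<And>x. x \<in> S \<Longrightarrow> opp (join M N) x \<in> S"
    have "S \<inter> darts M = darts M"
    proof (rule C)
      fix x assume x: "x \<in> S \<inter> darts M"
      show "rot M x \<in> S \<inter> darts M" using S(3)[of x] x r(1)[of x] D(10) by simp
      show "opp M x \<in> S \<inter> darts M" using S(4)[of x] x o(1)[of x] D(11) by simp
    qed (use S(2) a in auto)
    moreover have "S \<inter> darts N = darts N"
    proof (rule C')
      fix x assume x: "x \<in> S \<inter> darts N"
      show "rot N x \<in> S \<inter> darts N" using S(3)[of x] x r(2)[of x] E(10) by simp
      show "opp N x \<in> S \<inter> darts N" using S(4)[of x] x o(2)[of x] E(11) by simp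
    qed (use S(2) a in auto)
    ultimately show "S = darts (join M N)" using S(1) by auto
  qed (use D(1) E(1) a in auto)
qed

text \<open>\<open>perm_restrict\<close> makes both permutations trivial outside S, as
  \<open>permutes\<close> demands.\<close>

definition submap :: "'d rmap \<Rightarrow> 'd set \<Rightarrow> 'd \<Rightarrow> 'd rmap" where
  "submap M S a = M\<lparr>darts := S, rot := perm_restrict (rot M) S, opp := perm_restrict (opp M) S, arrow := a\<rparr>"

lemma submap_simps [simp]:
  "darts (submap M S a) = S" "rot (submap M S a) = perm_restrict (rot M) S" "opp (submap M S a) = perm_restrict (opp M) S"
  "arrow (submap M S a) = a"
  by (simp_all add: submap_def)

text \<open>Failure of connectedness from the first arrow provides a proper closed set S with that
  arrow but without b, and its complement is closed as well. Each part is connected from its own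
  arrow: a smaller closed set with that arrow, united with the other part, would be closed and
  contain both arrows, yet be proper.\<close>

lemma obtain_join:
  assumes M: "premap M {arrow M, b} {arrow M, b}" and b: "b \<noteq> arrow M" and n: "\<not> premap M {arrow M, b} {arrow M}"
  obtains N P where "rooted_map N" "rooted_map P" "darts N \<inter> darts P = {}" "arrow P = b" "arrow N = arrow M" "M = join N P"
proof -
  note D = premapD[OF M]
  note C = premap_conn[OF M]
  let ?a = "arrow M"
  have ab: "?a \<in> darts M" "b \<in> darts M" using D(4) by auto
  from n obtain S where S: "S \<subseteq> darts M" "?a \<in> S" "rot M ` S \<subseteq> S" "opp M ` S \<subseteq> S" "S \<noteq> darts M"
    unfolding premap_def using D(1-9) by auto
  have bS: "b \<notin> S" using C[of S] S by auto
  define T where "T = darts M - S"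
  have T: "T \<subseteq> darts M" "b \<in> T" "rot M ` T \<subseteq> T" "opp M ` T \<subseteq> T" "S \<inter> T = {}" "S \<union> T = darts M"
    using perm_closed_complement[OF D(5,1) S(1,3)] perm_closed_complement[OF D(6,1) S(1,4)] ab bS S(1)
    by (auto simp: T_def)
  \<comment> \<open>X contains just one of the two arrows, so \<open>opp\<close> has a single fixed
    point on it.\<close>
  have sub: "rooted_map (submap M X c)" if X: "X \<subseteq> darts M" "rot M ` X \<subseteq> X" "opp M ` X \<subseteq> X" "c \<in> X" "X \<inter> {?a, b} = {c}"
    and con: "\<And>Y. Y \<subseteq> X \<Longrightarrow> c \<in> Y \<Longrightarrow> rot M ` Y \<subseteq> Y \<Longrightarrow> opp M ` Y \<subseteq> Y \<Longrightarrow> Y = X" for X c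
    unfolding rooted_map_iff
  proof (rule premapI)
    show "rot (submap M X c) permutes darts (submap M X c)" "opp (submap M X c) permutes darts (submap M X c)"
      using perm_restrict_permutes[OF D(5,1) X(1,2)] perm_restrict_permutes[OF D(6,1) X(1,3)] by simp_all
    show "opp (submap M X c) (opp (submap M X c) x) = x" for x
      using X(3) D(7)[of x] by (auto simp: perm_restrict_def)
    show "opp (submap M X c) x = x \<longleftrightarrow> x \<in> {arrow (submap M X c)}" if "x \<in> darts (submap M X c)" for x
      using that X D(8)[of x] by (auto simp: perm_restrict_def)
    fix Y assume Y: "Y \<subseteq> darts (submap M X c)" "{arrow (submap M X c)} \<subseteq> Y" "\<And>x. x \<in> Y \<Longrightarrow> rot (submap M X c) x \<in> Y"
      "\<And>x. x \<in> Y \<Longrightarrow> opp (submap M X c) x \<in> Y"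
    have "rot M x \<in> Y" "opp M x \<in> Y" if "x \<in> Y" for x
      using Y(1) Y(3,4)[of x] that by (auto simp: perm_restrict_def split: if_splits)
    then show "Y = darts (submap M X c)" using Y(1,2) by (simp add: con image_subset_iff)
  qed (use X(4) finite_subset[OF X(1) D(1)] in auto)
  have "rooted_map (submap M S ?a)"
  proof (rule sub)
    fix Y assume Y: "Y \<subseteq> S" "?a \<in> Y" "rot M ` Y \<subseteq> Y" "opp M ` Y \<subseteq> Y"
    have "Y \<union> T = darts M" using Y T S(1) by (intro C) auto
    then show "Y = S" using Y(1) T(5) S(1) by auto
  qed (use S bS in auto)
  moreover have "rooted_map (submap M T b)"
  proof (rule sub)
    fix Y assume Y: "Y \<subseteq> T" "b \<in> Y" "rot M ` Y \<subseteq> Y" "opp M ` Y \<subseteq> Y"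
    have "S \<union> Y = darts M" using Y T S by (intro C) auto
    then show "Y = T" using Y(1) T(1,5) by auto
  qed (use T S(2) in auto)
  moreover have "M = join (submap M S ?a) (submap M T b)"
  proof -
    have j: "perm_restrict s S \<circ> perm_restrict s T = s" if "s permutes darts M" "s ` S \<subseteq> S" "s ` T \<subseteq> T" for s
    proof (rule ext)
      fix x show "(perm_restrict s S \<circ> perm_restrict s T) x = s x"
        using that(2,3) T(5,6) permutes_not_in[OF that(1), of x] by (auto simp: perm_restrict_def image_subset_iff)
    qed
    show ?thesis using j[OF D(5) S(3) T(3)] j[OF D(6) S(4) T(4)] T(6) by (simp add: join_def submap_def)
  qed
  ultimately show ?thesis using T(5) by (intro that[of "submap M S ?a" "submap M T b"]) simp_all
qed

lemma join_counts:
  assumes M: "rooted_map M" and N: "rooted_map N" and dis: "darts M \<inter> darts N = {}"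
  shows "nv (join M N) = nv M + nv N" "nf (join M N) = nf M + nf N"
    "card (darts (join M N)) = card (darts M) + card (darts N)" "arrow N \<notin> orbit (rot (join M N)) (arrow M)"
proof -
  note D = rootedD[OF M] and E = rootedD[OF N]
  show "nv (join M N) = nv M + nv N"
    using ncyc_comp_disjoint[OF D(5) E(5) dis D(1) E(1)] by (simp add: nv_def)
  have "rot (join M N) \<circ> opp (join M N) = (rot M \<circ> opp M) \<circ> (rot N \<circ> opp N)"
  proof (rule ext)
    fix x
    \<comment> \<open>\<open>rot N\<close> and \<open>opp M\<close> act on disjoint sets of darts
      and hence commute.\<close>
    have "rot N (opp M y) = opp M (rot N y)" for y
    proof -
      have "y \<in> darts M \<or> y \<in> darts N \<or> y \<notin> darts M \<and> y \<notin> darts N" by blast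
      moreover have "rot N y \<in> darts N \<Longrightarrow> rot N y \<notin> darts M" using dis by auto
      ultimately show ?thesis
        using dis D(11)[of y] D(13)[of y] D(13)[of "rot N y"] E(10)[of y] E(12)[of y] E(12)[of "opp M y"]
        by (elim disjE) (auto simp: disjoint_iff)
    qed
    then show "(rot (join M N) \<circ> opp (join M N)) x = (rot M \<circ> opp M \<circ> (rot N \<circ> opp N)) x" by simp
  qed
  moreover have "rot M \<circ> opp M permutes darts M" "rot N \<circ> opp N permutes darts N"
    using D(5,6) E(5,6) by (simp_all add: permutes_compose)
  ultimately show "nf (join M N) = nf M + nf N"
    using ncyc_comp_disjoint[of "rot M \<circ> opp M" "darts M" "rot N \<circ> opp N" "darts N"] dis D(1) E(1) by (simp add: nf_def)
  show "card (darts (join M N)) = card (darts M) + card (darts N)" using D(1) E(1) dis by (simp add: card_Un_disjoint)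
  have a: "arrow M \<in> darts M" "arrow N \<in> darts N" using D(4) E(4) by auto
  have "orbit (rot (join M N)) (arrow M) \<subseteq> darts M"
    using orbit_comp_disjoint(1)[OF D(5) E(5) dis D(1) E(1) a(1)] permutes_orbit_subset[OF D(5) a(1)] by simp
  then show "arrow N \<notin> orbit (rot (join M N)) (arrow M)" using a dis by auto
qed

text \<open>Undoing \<open>add_root\<close> leaves a map with two arrows. If all of it is connected
  to the first arrow, the second one is erased and its predecessor p remembered
  (\<open>ext\<close>); otherwise it falls into two rooted maps (\<open>loop\<close>). Case
  \<open>ext\<close> still contains the root loops that do not disconnect, namely when p is not at
  the root vertex.\<close>

lemma rooted_cases:
  assumes "rooted_map M"
  obtains (point) "darts M = {arrow M}"
  | (ext) N p b d where "rooted_map N" "p \<in> darts N" "b \<notin> darts N" "d \<notin> insert b (darts N)"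
      "M = add_root b d (ins p b N)" "arrow N = arrow M"
  | (loop) N P d where "rooted_map N" "rooted_map P" "darts N \<inter> darts P = {}" "d \<notin> darts N \<union> darts P"
      "M = add_root (arrow P) d (join N P)" "arrow N = arrow M"
proof (cases "darts M = {arrow M}")
  case False
  then obtain K b d where K: "premap K {arrow K, b} {arrow K, b}" "b \<noteq> arrow K" "d \<notin> darts K"
    "M = add_root b d K" "arrow K = arrow M" using obtain_add_root[OF assms] by metis
  show ?thesis
  proof (cases "premap K {arrow K, b} {arrow K}")
    case True
    then obtain N p where "rooted_map N" "p \<in> darts N" "b \<notin> darts N" "K = ins p b N" "arrow N = arrow K"
      using premap_obtain_ins K(2) by metis
    then show ?thesis using K(3-5) by (intro ext[of N p b d]) simp_all
  next
    case F: False
    then obtain N P where "rooted_map N" "rooted_map P" "darts N \<inter> darts P = {}" "arrow P = b" "arrow N = arrow K" "K = join N P"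
      using obtain_join[OF K(1,2)] by metis
    then show ?thesis using K(3-5) by (intro loop[of N P d]) simp_all
  qed
qed

lemma ins_same_orbit:
  assumes "rooted_map N" "p \<in> darts N" "b \<notin> darts N"
  shows "b \<in> orbit (rot (ins p b N)) (arrow N) \<longleftrightarrow> p \<in> orbit (rot N) (arrow N)"
proof -
  note D = rootedD[OF assms(1)]
  have a: "arrow N \<in> darts N" using D(4) by auto
  have s: "rot N permutes insert b (darts N)" "finite (insert b (darts N))"
    using D(1,5) by (simp_all add: permutes_imp_permutes_insert)
  have b: "b \<notin> orbit (rot N) x" if "x \<in> darts N" for x using permutes_orbit_subset[OF D(5) that] assms(3) by auto
  note m = orbit_merge[OF s b[OF assms(2)]]
  have ob: "orbit (rot N) b = {b}" using D(12) assms(3) by (simp add: orbit_eq_singleton_iff)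
  show ?thesis
  proof (cases "arrow N \<in> orbit (rot N) p")
    case True
    have q: "rot N \<circ> transpose p b permutes insert b (darts N)" using D(5) assms(2) by (simp add: permutes_insert_transpose)
    have "arrow N \<in> orbit (rot N \<circ> transpose p b) b" using True m(2) by simp
    then have "orbit (rot N \<circ> transpose p b) (arrow N) = orbit (rot N \<circ> transpose p b) b"
      by (rule perm_orbit_eq[OF q s(2)])
    moreover have "b \<in> orbit (rot N \<circ> transpose p b) b" by (rule perm_self_in_orbit[OF q s(2)])
    moreover have "p \<in> orbit (rot N) (arrow N)" using True perm_orbit_eq[OF D(5,1)] perm_self_in_orbit[OF D(5,1)] by metis
    ultimately show ?thesis by simp
  next
    case False
    moreover have "arrow N \<noteq> b" using a assms(3) by auto
    ultimately have "orbit (rot N \<circ> transpose p b) (arrow N) = orbit (rot N) (arrow N)" using m(3) ob by simp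
    moreover have "p \<notin> orbit (rot N) (arrow N)" using False perm_orbit_eq[OF D(5,1)] perm_self_in_orbit[OF D(5,1)] by metis
    ultimately show ?thesis using b[OF a] by simp
  qed
qed

lemma ext_counts:
  assumes "rooted_map N" "p \<in> darts N" "b \<notin> darts N" "d \<notin> insert b (darts N)"
  defines "M \<equiv> add_root b d (ins p b N)"
  shows "rooted_map M" "nf M = nf N" "card (darts M) = card (darts N) + 2"
    "p \<in> orbit (rot N) (arrow N) \<Longrightarrow> nv M = Suc (nv N)"
    "p \<notin> orbit (rot N) (arrow N) \<Longrightarrow> Suc (nv M) = nv N"
proof -
  note i = premap_ins[OF assms(1-3)]
  have a: "arrow N \<in> darts N" using rootedD(4)[OF assms(1)] by auto
  then have ba: "b \<noteq> arrow N" using assms(3) by auto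
  have i2: "premap (ins p b N) {arrow (ins p b N), b} {arrow (ins p b N), b}" by (rule premap_mono[OF i[folded ins_simps(4)[of p b N]]]) auto
  have ba': "b \<noteq> arrow (ins p b N)" "d \<notin> darts (ins p b N)" using ba assms(4) by simp_all
  note c = add_root_counts[OF i2 ba', folded M_def] and c' = ins_counts[OF assms(1-3)]
  show "rooted_map M" unfolding M_def by (rule rooted_add_root[OF i2 ba'])
  show "nf M = nf N" "card (darts M) = card (darts N) + 2" using c(1,2) c' by auto
  show "p \<in> orbit (rot N) (arrow N) \<Longrightarrow> nv M = Suc (nv N)" "p \<notin> orbit (rot N) (arrow N) \<Longrightarrow> Suc (nv M) = nv N"
    using c(3,4) c'(1) ins_same_orbit[OF assms(1-3)] by auto
qed

lemma loop_counts:
  assumes "rooted_map N" "rooted_map P" "darts N \<inter> darts P = {}" "d \<notin> darts N \<union> darts P"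
  defines "M \<equiv> add_root (arrow P) d (join N P)"
  shows "rooted_map M" "nf M = nf N + nf P" "card (darts M) = card (darts N) + card (darts P) + 1"
    "Suc (nv M) = nv N + nv P"
proof -
  note i = premap_join[OF assms(1-3)]
  have i2: "premap (join N P) {arrow (join N P), arrow P} {arrow (join N P), arrow P}" "arrow P \<noteq> arrow (join N P)" "d \<notin> darts (join N P)"
    using i assms(4) by simp_all
  note c = add_root_counts[OF i2, folded M_def] and c' = join_counts[OF assms(1-3)]
  show "rooted_map M" unfolding M_def by (rule rooted_add_root[OF i2])
  show "nf M = nf N + nf P" "card (darts M) = card (darts N) + card (darts P) + 1" "Suc (nv M) = nv N + nv P"
    using c(1,2) c(4) c' by auto
qed

lemma point_counts:
  assumes "rooted_map M" "darts M = {arrow M}"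
  shows "nv M = 1" "nf M = 1" "card (darts M) = 1"
  using assms(2) by (simp_all add: nv_def nf_def ncyc_def)

text \<open>Deleting the root edge keeps the Euler characteristic, except that it grows by two for a loop that
  does not disconnect the map; the inequality follows, and such loops cannot occur in planar maps.\<close>

lemma euler_ineq: "rooted_map M \<Longrightarrow> 2 * (nv M + nf M) \<le> card (darts M) + 3"
proof (induction "card (darts M)" arbitrary: M rule: less_induct)
  case less
  from less.prems show ?case
  proof (cases rule: rooted_cases)
    case point
    then show ?thesis using point_counts[OF less.prems] by simp
  next
    case (ext N p b d)
    note c = ext_counts[OF ext(1-4), folded ext(5)]
    have "2 * (nv N + nf N) \<le> card (darts N) + 3" using c(3) ext(1) by (intro less.hyps) auto
    then show ?thesis using c by (cases "p \<in> orbit (rot N) (arrow N)") auto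
  next
    case (loop N P d)
    note c = loop_counts[OF loop(1-4), folded loop(5)]
    have "2 * (nv N + nf N) \<le> card (darts N) + 3" "2 * (nv P + nf P) \<le> card (darts P) + 3"
      using less.hyps[of N] less.hyps[of P] c(3) loop(1,2) by auto
    then show ?thesis using c by simp
  qed
qed

text \<open>If p were at another vertex, planarity of the larger map would give N Euler
  characteristic 4, against \<open>euler_ineq\<close>.\<close>

lemma planar_ext_iff:
  assumes "rooted_map N" "p \<in> darts N" "b \<notin> darts N" "d \<notin> insert b (darts N)"
  shows "planar_map (add_root b d (ins p b N)) \<longleftrightarrow> planar_map N \<and> p \<in> orbit (rot N) (arrow N)"
  using ext_counts[OF assms] euler_ineq[OF assms(1)] assms(1)
  by (cases "p \<in> orbit (rot N) (arrow N)") (auto simp: planar_map_iff)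

text \<open>The defects of the two parts in Euler's inequality add up to the defect of the whole;
  being nonnegative, they vanish together exactly when the sum does.\<close>

lemma planar_loop_iff:
  assumes "rooted_map N" "rooted_map P" "darts N \<inter> darts P = {}" "d \<notin> darts N \<union> darts P"
  shows "planar_map (add_root (arrow P) d (join N P)) \<longleftrightarrow> planar_map N \<and> planar_map P"
  using loop_counts[OF assms] euler_ineq[OF assms(1)] euler_ineq[OF assms(2)] assms(1,2)
  by (auto simp: planar_map_iff)

section \<open>Isomorphisms\<close>

text \<open>Equivariance is stated for one permutation at a time, because the constructions change
  \<open>rot\<close> and \<open>opp\<close> separately by composing with transpositions, which can
  then be attached and cancelled one by one.\<close>

definition intertwines :: "('d \<Rightarrow> 'e) \<Rightarrow> 'd set \<Rightarrow> ('d \<Rightarrow> 'd) \<Rightarrow> ('e \<Rightarrow> 'e) \<Rightarrow> bool" where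
  "intertwines h D s t \<longleftrightarrow> (\<forall>x\<in>D. h (s x) = t (h x))"

lemma intertwines_transpose:
  assumes "inj_on h D" "p \<in> D" "q \<in> D" "intertwines h D s t"
  shows "intertwines h D (s \<circ> transpose p q) (t \<circ> transpose (h p) (h q))"
  unfolding intertwines_def
proof
  fix x assume x: "x \<in> D"
  then have "transpose p q x \<in> D" "h (transpose p q x) = transpose (h p) (h q) (h x)"
    using assms(1-3) by (auto simp: transpose_def inj_on_def)
  then show "h ((s \<circ> transpose p q) x) = (t \<circ> transpose (h p) (h q)) (h x)"
    using assms(4) by (simp add: intertwines_def)
qed

lemma intertwines_cancel:
  assumes "inj_on h D" "p \<in> D" "q \<in> D" "h p = p'" "h q = q'" "intertwines h D (s \<circ> transpose p q) (t \<circ> transpose p' q')"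
  shows "intertwines h D s t"
  using intertwines_transpose[OF assms(1-3) assms(6)] by (simp add: comp_assoc assms(4,5))

lemma intertwines_mono: "intertwines h D s t \<Longrightarrow> E \<subseteq> D \<Longrightarrow> intertwines h E s t"
  by (auto simp: intertwines_def)

lemma intertwinesD: "intertwines h D s t \<Longrightarrow> x \<in> D \<Longrightarrow> h (s x) = t (h x)"
  by (simp add: intertwines_def)

lemma intertwines_insert:
  assumes "intertwines h D s t" "s permutes D" "d \<notin> D" "t d' = d'"
  shows "intertwines (h(d := d')) (insert d D) s t"
  using assms permutes_in_image[OF assms(2)] permutes_not_in[OF assms(2,3)] by (auto simp: intertwines_def)

lemma intertwines_inv:
  assumes "intertwines h D s t" "s permutes D" "t permutes E"
  shows "intertwines h D (inv s) (inv t)"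
  unfolding intertwines_def
proof
  fix x assume x: "x \<in> D"
  then have "inv s x \<in> D" using permutes_in_image[OF permutes_inv[OF assms(2)]] by simp
  then have "h x = t (h (inv s x))" using assms(1) permutes_inverses(1)[OF assms(2), of x] by (auto simp: intertwines_def)
  then show "h (inv s x) = inv t (h x)" using permutes_inverses(2)[OF assms(3)] by simp
qed

lemma intertwines_funpow:
  assumes "intertwines h D s t" "s permutes D" "x \<in> D"
  shows "h ((s ^^ n) x) = (t ^^ n) (h x)" "(s ^^ n) x \<in> D"
proof -
  have "h ((s ^^ n) x) = (t ^^ n) (h x) \<and> (s ^^ n) x \<in> D"
    using assms by (induction n) (auto simp: intertwines_def permutes_in_image)
  then show "h ((s ^^ n) x) = (t ^^ n) (h x)" "(s ^^ n) x \<in> D" by auto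
qed

lemma intertwines_orbit:
  assumes "intertwines h D s t" "s permutes D" "finite D" "x \<in> D"
  shows "h ` orbit s x = orbit t (h x)"
proof (rule orbit_inverse)
  show "x \<in> orbit s x" by (rule perm_self_in_orbit[OF assms(2,3)])
  show "t (h y) = h (s y)" if "y \<in> orbit s x" for y
    using that permutes_orbit_subset[OF assms(2,4)] assms(1) by (auto simp: intertwines_def)
qed

lemma intertwines_ncyc:
  assumes "intertwines h D s t" "s permutes D" "finite D" "bij_betw h D E"
  shows "ncyc E t = ncyc D s"
proof -
  have "orbit t ` E = (`) h ` (orbit s ` D)"
    using intertwines_orbit[OF assms(1-3)] assms(4) by (auto simp: bij_betw_def image_iff)
  moreover have "inj_on ((`) h) (orbit s ` D)"
  proof (rule inj_on_subset)
    show "inj_on ((`) h) (Pow D)" using assms(4) by (simp add: bij_betw_def inj_on_image_Pow)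
    show "orbit s ` D \<subseteq> Pow D" using permutes_orbit_subset[OF assms(2)] by auto
  qed
  ultimately show ?thesis by (simp add: ncyc_def card_image)
qed

lemma is_iso_iff:
  "is_iso h M N \<longleftrightarrow> bij_betw h (darts M) (darts N) \<and> h (arrow M) = arrow N \<and>
     intertwines h (darts M) (rot M) (rot N) \<and> intertwines h (darts M) (opp M) (opp N)"
  by (auto simp: is_iso_def intertwines_def)

lemma bij_betw_upd:
  assumes "bij_betw h D E" "d \<notin> D" "d' \<notin> E"
  shows "bij_betw (h(d := d')) (insert d D) (insert d' E)"
proof -
  have "bij_betw (h(d := d')) D E" using assms by (subst bij_betw_cong[of D _ h]) auto
  from notIn_Un_bij_betw[of d D "h(d := d')" E, OF assms(2) _ this] assms(3) show ?thesis by simp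
qed

lemma bij_betw_delete:
  assumes "bij_betw h (insert d D) (insert d' E)" "h d = d'" "d \<notin> D" "d' \<notin> E"
  shows "bij_betw h D E"
  using notIn_Un_bij_betw3[of d D h E] assms by simp

lemma is_iso_refl: "is_iso id M M"
  by (simp add: is_iso_def)

lemma is_iso_trans: "is_iso h M N \<Longrightarrow> is_iso g N P \<Longrightarrow> is_iso (g \<circ> h) M P"
  unfolding is_iso_def by (auto intro: bij_betw_trans dest: bij_betwE)

lemma is_iso_sym:
  assumes h: "is_iso h M N" and M: "premap M F R"
  shows "is_iso (inv_into (darts M) h) N M"
proof -
  let ?g = "inv_into (darts M) h"
  have b: "bij_betw h (darts M) (darts N)" and D: "arrow M \<in> darts M" "\<And>x. rot M x \<in> darts M \<longleftrightarrow> x \<in> darts M" "\<And>x. opp M x \<in> darts M \<longleftrightarrow> x \<in> darts M"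
    using h premapD[OF M] by (auto simp: is_iso_def)
  have l: "?g (h x) = x" if "x \<in> darts M" for x using b that by (simp add: bij_betw_inv_into_left)
  have "?g (arrow N) = arrow M" using l[OF D(1)] h by (simp add: is_iso_def)
  moreover have "?g (rot N y) = rot M (?g y)" "?g (opp N y) = opp M (?g y)" if y: "y \<in> darts N" for y
  proof -
    obtain x where x: "x \<in> darts M" "y = h x" using y bij_betw_imp_surj_on[OF b, symmetric] by auto
    then have "rot N y = h (rot M x)" "opp N y = h (opp M x)" using h by (auto simp: is_iso_def)
    then show "?g (rot N y) = rot M (?g y)" "?g (opp N y) = opp M (?g y)" using l D x by simp_all
  qed
  ultimately show ?thesis using bij_betw_inv_into[OF b] by (simp add: is_iso_def)
qed

text \<open>Two isomorphisms agree on the arrow, and agreement propagates along \<open>rot\<close>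
  and \<open>opp\<close>, so connectedness extends it to all darts. This rigidity is why marks can
  be counted as positions on one representative.\<close>

lemma is_iso_unique:
  assumes M: "rooted_map M" and h: "is_iso h M N" "is_iso g M N" and x: "x \<in> darts M"
  shows "h x = g x"
proof -
  note M' = M[unfolded rooted_map_iff]
  have "{x \<in> darts M. h x = g x} = darts M"
    using h premapD(2,4,10,11)[OF M'] by (intro premap_conn[OF M']) (auto simp: is_iso_def)
  then show ?thesis using x by auto
qed

lemma is_iso_counts:
  assumes h: "is_iso h M N" and M: "premap M F R"
  shows "nv N = nv M" "nf N = nf M" "card (darts N) = card (darts M)"
    "card (orbit (rot N) (arrow N)) = card (orbit (rot M) (arrow M))"
    "opp N (rot N (arrow N)) \<in> orbit (rot N) (arrow N) \<longleftrightarrow> opp M (rot M (arrow M)) \<in> orbit (rot M) (arrow M)"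
proof -
  note D = premapD[OF M] and h' = h[unfolded is_iso_iff]
  have a: "arrow M \<in> darts M" using D(2-4) by auto
  have inj: "inj_on h (darts M)" using h' by (simp add: bij_betw_def)
  show "nv N = nv M" unfolding nv_def using intertwines_ncyc[of h "darts M" "rot M" "rot N" "darts N"] h' D(1,5) by simp
  have "intertwines h (darts M) (rot M \<circ> opp M) (rot N \<circ> opp N)" using h' D(11) by (auto simp: intertwines_def)
  then show "nf N = nf M" unfolding nf_def 
    using intertwines_ncyc[of h "darts M" "rot M \<circ> opp M" "rot N \<circ> opp N" "darts N"] h' D(1,5,6) by (simp add: permutes_compose)
  show "card (darts N) = card (darts M)" using h' bij_betw_same_card by metis
  have o: "orbit (rot N) (arrow N) = h ` orbit (rot M) (arrow M)" using intertwines_orbit[of h "darts M" "rot M" "rot N" "arrow M"] h' D(1,5) a by simp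
  have sub: "orbit (rot M) (arrow M) \<subseteq> darts M" by (rule permutes_orbit_subset[OF D(5) a])
  show "card (orbit (rot N) (arrow N)) = card (orbit (rot M) (arrow M))"
    unfolding o by (rule card_image[OF inj_on_subset[OF inj sub]])
  have "opp N (rot N (arrow N)) = h (opp M (rot M (arrow M)))" using h' a D(10,11) by (auto simp: intertwines_def)
  moreover have "opp M (rot M (arrow M)) \<in> darts M" using a D(10,11) by simp
  ultimately show "opp N (rot N (arrow N)) \<in> orbit (rot N) (arrow N) \<longleftrightarrow> opp M (rot M (arrow M)) \<in> orbit (rot M) (arrow M)"
    unfolding o using inj_on_image_mem_iff[OF inj] sub by simp
qed

lemma is_iso_ins:
  assumes h: "is_iso h M N" and M: "premap M F R" and p: "p \<in> darts M" and b: "b \<notin> darts M" "b' \<notin> darts N" and N: "premap N F' R'"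
  shows "is_iso (h(b := b')) (ins p b M) (ins (h p) b' N)"
proof -
  note D = premapD[OF M] and E = premapD[OF N] and h' = h[unfolded is_iso_iff]
  let ?h = "h(b := b')"
  have a: "arrow M \<in> darts M" using D(2-4) by auto
  have bij: "bij_betw ?h (insert b (darts M)) (insert b' (darts N))" using h' b by (simp add: bij_betw_upd)
  have r: "intertwines ?h (insert b (darts M)) (rot M) (rot N)" "intertwines ?h (insert b (darts M)) (opp M) (opp N)"
    using h' D(5,6) E(12,13) b by (simp_all add: intertwines_insert)
  have "?h p = h p" "?h b = b'" "?h (arrow M) = arrow N" using p b a h' by auto
  then show ?thesis
    using bij r(2) intertwines_transpose[OF _ _ _ r(1), of p b] p by (simp add: is_iso_iff bij_betw_def)
qed

text \<open>In the enlarged map p is the only dart followed by b, so an isomorphism that matches the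
  second arrows also matches their predecessors.\<close>

lemma is_iso_ins_conv:
  assumes h: "is_iso h (ins p b M) (ins p' b' N)" "h b = b'"
    and M: "premap M F R" and p: "p \<in> darts M" and b: "b \<notin> darts M" "b' \<notin> darts N" and N: "premap N F' R'" and p': "p' \<in> darts N"
  shows "is_iso h M N" "h p = p'"
proof -
  note D = premapD[OF M] and E = premapD[OF N] and h' = h(1)[unfolded is_iso_iff ins_simps]
  note hR = h'[THEN conjunct2, THEN conjunct2, THEN conjunct1] and hO = h'[THEN conjunct2, THEN conjunct2, THEN conjunct2]
  have inj: "inj_on h (insert b (darts M))" using h' by (simp add: bij_betw_def)
  have bij: "bij_betw h (darts M) (darts N)" by (rule bij_betw_delete[OF conjunct1[OF h'] h(2) b])
  have "h ((rot M \<circ> transpose p b) p) = (rot N \<circ> transpose p' b') (h p)" by (rule intertwinesD[OF hR]) (use p in simp)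
  then have "b' = (rot N \<circ> transpose p' b') (h p)" using D(12)[OF b(1)] h(2) by simp
  moreover have "h p \<in> darts N" using bij_betwE[OF bij] p by blast
  ultimately show hp: "h p = p'"
    using E(10)[of "h p"] E(10)[of p'] b(2) p' by (cases "h p = p'") (auto simp: transpose_def split: if_splits)
  have r: "intertwines h (insert b (darts M)) (rot M) (rot N)"
    by (rule intertwines_cancel[OF inj _ _ hp h(2) hR]) (use p in simp_all)
  show "is_iso h M N" unfolding is_iso_iff
    by (intro conjI bij intertwines_mono[OF r] intertwines_mono[OF hO]) (use h' in auto)
qed

lemma is_iso_add_root:
  assumes h: "is_iso h M N" "h b = b'" and M: "premap M {arrow M, b} R" and N: "premap N F' R'"
    and d: "d \<notin> darts M" "d' \<notin> darts N"
  shows "is_iso (h(d := d')) (add_root b d M) (add_root b' d' N)"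
proof -
  note D = premapD[OF M] and E = premapD[OF N] and h' = h(1)[unfolded is_iso_iff]
  let ?h = "h(d := d')" and ?D = "insert d (darts M)"
  have a: "arrow M \<in> darts M" "b \<in> darts M" using D(2-4) by auto
  have bij: "bij_betw ?h ?D (insert d' (darts N))" using h' d by (simp add: bij_betw_upd)
  then have inj: "inj_on ?h ?D" by (simp add: bij_betw_def)
  have r: "intertwines ?h ?D (rot M) (rot N)" "intertwines ?h ?D (opp M) (opp N)"
    using h' D(5,6) E(12,13) d by (simp_all add: intertwines_insert)
  have v: "?h b = b'" "?h d = d'" "?h (arrow M) = arrow N" using a h' h(2) d by auto
  have "intertwines ?h ?D (rot M \<circ> transpose (arrow M) b \<circ> transpose (arrow M) d) (rot N \<circ> transpose (arrow N) b' \<circ> transpose (arrow N) d')"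
    using intertwines_transpose[OF inj _ _ intertwines_transpose[OF inj _ _ r(1), of "arrow M" b], of "arrow M" d] a unfolding v by simp
  moreover have "intertwines ?h ?D (opp M \<circ> transpose b d) (opp N \<circ> transpose b' d')"
    using intertwines_transpose[OF inj _ _ r(2), of b d] a unfolding v by simp
  ultimately show ?thesis using bij v by (simp add: is_iso_iff)
qed

text \<open>The structure itself singles out the added edge: d follows the arrow and b is opposite
  to d. Every isomorphism respects both, and the transpositions can be cancelled.\<close>

lemma is_iso_add_root_conv:
  assumes h: "is_iso h (add_root b d M) (add_root b' d' N)"
    and M: "premap M {arrow M, b} R" "b \<noteq> arrow M" and N: "premap N {arrow N, b'} R'" "b' \<noteq> arrow N"
    and d: "d \<notin> darts M" "d' \<notin> darts N"
  shows "is_iso h M N" "h b = b'" "h d = d'"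
proof -
  note D = premapD[OF M(1)] and E = premapD[OF N(1)] and h' = h[unfolded is_iso_iff add_root_simps]
  note hR = h'[THEN conjunct2, THEN conjunct2, THEN conjunct1] and hO = h'[THEN conjunct2, THEN conjunct2, THEN conjunct2]
  let ?D = "insert d (darts M)"
  have a: "arrow M \<in> darts M" "b \<in> darts M" "arrow N \<in> darts N" "b' \<in> darts N" using D(2-4) E(2-4) by auto
  have inj: "inj_on h ?D" using h' by (simp add: bij_betw_def)
  have ha: "h (arrow M) = arrow N" using h' by simp
  have ne: "d \<noteq> b" "d' \<noteq> b'" "d \<noteq> arrow M" "d' \<noteq> arrow N" using a d by auto
  have "h ((rot M \<circ> transpose (arrow M) b \<circ> transpose (arrow M) d) (arrow M)) = (rot N \<circ> transpose (arrow N) b' \<circ> transpose (arrow N) d') (h (arrow M))"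
    by (rule intertwinesD[OF hR]) (use a in simp)
  then show hd: "h d = d'" using D(12)[OF d(1)] E(12)[OF d(2)] ne ha by simp
  have "h ((opp M \<circ> transpose b d) d) = (opp N \<circ> transpose b' d') (h d)"
    by (rule intertwinesD[OF hO]) simp
  then show hb: "h b = b'" using hd D(9)[of b] E(9)[of b'] by simp
  have bij: "bij_betw h (darts M) (darts N)" by (rule bij_betw_delete[OF conjunct1[OF h'] hd d])
  have "intertwines h ?D (rot M \<circ> transpose (arrow M) b) (rot N \<circ> transpose (arrow N) b')"
    by (rule intertwines_cancel[OF inj _ _ ha hd hR]) (use a in simp_all)
  then have r: "intertwines h ?D (rot M) (rot N)"
    by (rule intertwines_cancel[OF inj _ _ ha hb, rotated 2]) (use a in simp_all)
  have o: "intertwines h ?D (opp M) (opp N)"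
    by (rule intertwines_cancel[OF inj _ _ hb hd hO]) (use a in simp_all)
  show "is_iso h M N" unfolding is_iso_iff
    by (intro conjI bij ha intertwines_mono[OF r] intertwines_mono[OF o]) auto
qed

lemma is_iso_add_leaf:
  assumes h: "is_iso h M N" "h b = b'" and M: "premap M F R" "b \<in> darts M" and N: "premap N F' R'"
    and d: "d \<notin> darts M" "d' \<notin> darts N"
  shows "is_iso (h(d := d')) (add_leaf b d M) (add_leaf b' d' N)"
proof -
  note D = premapD[OF M(1)] and E = premapD[OF N] and h' = h(1)[unfolded is_iso_iff]
  let ?h = "h(d := d')" and ?D = "insert d (darts M)"
  have a: "arrow M \<in> darts M" using D(2-4) by auto
  have bij: "bij_betw ?h ?D (insert d' (darts N))" using h' d by (simp add: bij_betw_upd)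
  then have inj: "inj_on ?h ?D" by (simp add: bij_betw_def)
  have r: "intertwines ?h ?D (rot M) (rot N)" "intertwines ?h ?D (opp M) (opp N)"
    using h' D(5,6) E(12,13) d by (simp_all add: intertwines_insert)
  have v: "?h b = b'" "?h d = d'" "?h (arrow M) = arrow N" using a M(2) h' h(2) d by auto
  have "intertwines ?h ?D (opp M \<circ> transpose b d) (opp N \<circ> transpose b' d')"
    using intertwines_transpose[OF inj _ _ r(2), of b d] M(2) unfolding v by simp
  then show ?thesis using bij v r(1) by (simp add: is_iso_iff)
qed

text \<open>Unlike the root edge, the added leaf cannot be located from the arrow. That h matches
  the two leaves is a hypothesis, which the mark will supply.\<close>

lemma is_iso_add_leaf_conv:
  assumes h: "is_iso h (add_leaf b d M) (add_leaf b' d' N)" "h d = d'"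
    and M: "premap M {arrow M, b} R" and N: "premap N {arrow N, b'} R'"
    and d: "d \<notin> darts M" "d' \<notin> darts N"
  shows "is_iso h M N" "h b = b'"
proof -
  note D = premapD[OF M(1)] and E = premapD[OF N(1)] and h' = h(1)[unfolded is_iso_iff add_leaf_simps]
  note hR = h'[THEN conjunct2, THEN conjunct2, THEN conjunct1] and hO = h'[THEN conjunct2, THEN conjunct2, THEN conjunct2]
  let ?D = "insert d (darts M)"
  have a: "b \<in> darts M" "b' \<in> darts N" using D(2-4) E(2-4) by auto
  have inj: "inj_on h ?D" using h' by (simp add: bij_betw_def)
  have "h ((opp M \<circ> transpose b d) d) = (opp N \<circ> transpose b' d') (h d)"
    by (rule intertwinesD[OF hO]) simp
  then show hb: "h b = b'" using h(2) D(9)[of b] E(9)[of b'] by simp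
  have bij: "bij_betw h (darts M) (darts N)" by (rule bij_betw_delete[OF conjunct1[OF h'] h(2) d])
  have o: "intertwines h ?D (opp M) (opp N)"
    by (rule intertwines_cancel[OF inj _ _ hb h(2) hO]) (use a in simp_all)
  show "is_iso h M N" unfolding is_iso_iff
    by (intro conjI bij intertwines_mono[OF hR] intertwines_mono[OF o]) (use h' in auto)
qed

lemma is_iso_join:
  assumes h: "is_iso h M N" "is_iso g P T" and M: "rooted_map M" "rooted_map N" "rooted_map P" "rooted_map T"
    and dis: "darts M \<inter> darts P = {}" "darts N \<inter> darts T = {}"
  defines "k \<equiv> \<lambda>x. if x \<in> darts M then h x else g x"
  shows "is_iso k (join M P) (join N T)" "k (arrow P) = arrow T"
proof -
  note D = rootedD[OF M(1)] and E = rootedD[OF M(2)]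
    and D' = rootedD[OF M(3)] and E' = rootedD[OF M(4)]
  note r = comp_disjoint_apply[OF D(5) D'(5) dis(1)] and o = comp_disjoint_apply[OF D(6) D'(6) dis(1)]
  note r' = comp_disjoint_apply[OF E(5) E'(5) dis(2)] and o' = comp_disjoint_apply[OF E(6) E'(6) dis(2)]
  have a: "arrow M \<in> darts M" "arrow P \<in> darts P" using D(4) D'(4) by auto
  have hM: "h x \<in> darts N" if "x \<in> darts M" for x using h(1) that by (auto simp: is_iso_def bij_betw_def)
  have gP: "g x \<in> darts T" if "x \<in> darts P" for x using h(2) that by (auto simp: is_iso_def bij_betw_def)
  have kM: "k x = h x" if "x \<in> darts M" for x using that by (simp add: k_def)
  have kP: "k x = g x" if "x \<in> darts P" for x using that dis by (auto simp: k_def)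
  have "bij_betw k (darts M) (darts N)" using h(1) kM by (subst bij_betw_cong[of _ _ h]) (auto simp: is_iso_def)
  moreover have "bij_betw k (darts P) (darts T)" using h(2) kP by (subst bij_betw_cong[of _ _ g]) (auto simp: is_iso_def)
  ultimately have bij: "bij_betw k (darts M \<union> darts P) (darts N \<union> darts T)" by (rule bij_betw_combine) (rule dis(2))
  have "k ((rot M \<circ> rot P) x) = (rot N \<circ> rot T) (k x) \<and> k ((opp M \<circ> opp P) x) = (opp N \<circ> opp T) (k x)" if x: "x \<in> darts M \<union> darts P" for x
  proof (cases "x \<in> darts M")
    case True
    then show ?thesis using r(1)[of x] o(1)[of x] r'(1)[of "h x"] o'(1)[of "h x"] h(1) hM kM D(10,11)
      by (simp add: is_iso_def)
  next
    case False
    then show ?thesis using x r(2)[of x] o(2)[of x] r'(2)[of "g x"] o'(2)[of "g x"] h(2) gP kP D'(10,11)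
      by (simp add: is_iso_def)
  qed
  then show "is_iso k (join M P) (join N T)" using bij kM a h(1) by (simp add: is_iso_def)
  show "k (arrow P) = arrow T" using kP a h(2) by (simp add: is_iso_def)
qed

lemma is_iso_join_conv:
  assumes k: "is_iso k (join M P) (join N T)" "k (arrow P) = arrow T"
    and M: "rooted_map M" "rooted_map N" "rooted_map P" "rooted_map T"
    and dis: "darts M \<inter> darts P = {}" "darts N \<inter> darts T = {}"
  shows "is_iso k M N" "is_iso k P T"
proof -
  note D = rootedD[OF M(1)] and E = rootedD[OF M(2)]
    and D' = rootedD[OF M(3)] and E' = rootedD[OF M(4)]
  note r = comp_disjoint_apply[OF D(5) D'(5) dis(1)] and o = comp_disjoint_apply[OF D(6) D'(6) dis(1)]
  note r' = comp_disjoint_apply[OF E(5) E'(5) dis(2)] and o' = comp_disjoint_apply[OF E(6) E'(6) dis(2)]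
  have a: "arrow M \<in> darts M" "arrow P \<in> darts P" "arrow N \<in> darts N" "arrow T \<in> darts T" using D(4) D'(4) E(4) E'(4) by auto
  have bij: "bij_betw k (darts M \<union> darts P) (darts N \<union> darts T)" and kr: "k (arrow M) = arrow N"
    using k(1) by (simp_all add: is_iso_def)
  have kk: "\<forall>d\<in>darts M \<union> darts P. k ((rot M \<circ> rot P) d) = (rot N \<circ> rot T) (k d) \<and> k ((opp M \<circ> opp P) d) = (opp N \<circ> opp T) (k d)"
    using k(1) by (simp add: is_iso_def)
  have kM: "k (rot M x) = (rot N \<circ> rot T) (k x)" "k (opp M x) = (opp N \<circ> opp T) (k x)" if "x \<in> darts M" for x
    using bspec[OF kk, of x] that r(1)[OF that] o(1)[OF that] by simp_all
  have kP: "k (rot P x) = (rot N \<circ> rot T) (k x)" "k (opp P x) = (opp N \<circ> opp T) (k x)" if "x \<in> darts P" for x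
    using bspec[OF kk, of x] that r(2)[OF that] o(2)[OF that] by simp_all
  \<comment> \<open>The part of \<open>darts N\<close> covered by the image of
    \<open>darts M\<close> is closed and contains the arrow, hence is all of it. The same holds for
    P and T, and as the two images are disjoint with union \<open>darts N\<close> and
    \<open>darts T\<close>, each inclusion is an equality.\<close>
  have "k ` darts M \<inter> darts N = darts N"
  proof (rule rooted_conn[OF M(2)])
    fix y assume y: "y \<in> k ` darts M \<inter> darts N"
    then obtain x where x: "x \<in> darts M" "y = k x" by auto
    have "rot N y = k (rot M x)" "opp N y = k (opp M x)" using kM[OF x(1)] x(2) y r'(1)[of y] o'(1)[of y] by auto
    then have "rot N y \<in> k ` darts M" "opp N y \<in> k ` darts M" using D(10,11)[of x] x(1) by auto
    then show "rot N y \<in> k ` darts M \<inter> darts N" "opp N y \<in> k ` darts M \<inter> darts N"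
      using y E(10,11)[of y] by auto
  qed (use a kr[symmetric] in auto)
  moreover have "k ` darts P \<inter> darts T = darts T"
  proof (rule rooted_conn[OF M(4)])
    fix y assume y: "y \<in> k ` darts P \<inter> darts T"
    then obtain x where x: "x \<in> darts P" "y = k x" by auto
    have "rot T y = k (rot P x)" "opp T y = k (opp P x)" using kP[OF x(1)] x(2) y r'(2)[of y] o'(2)[of y] by auto
    then have "rot T y \<in> k ` darts P" "opp T y \<in> k ` darts P" using D'(10,11)[of x] x(1) by auto
    then show "rot T y \<in> k ` darts P \<inter> darts T" "opp T y \<in> k ` darts P \<inter> darts T"
      using y E'(10,11)[of y] by auto
  qed (use a k(2)[symmetric] in auto)
  moreover have "k ` darts M \<inter> k ` darts P = {}" using bij dis(1)
    by (metis Un_upper1 Un_upper2 bij_betw_imp_inj_on image_empty inj_on_image_Int)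
  moreover have "k ` darts M \<union> k ` darts P = darts N \<union> darts T" using bij by (simp add: bij_betw_def image_Un)
  moreover have "A = N" "B = T" if "A \<inter> N = N" "B \<inter> T = T" "A \<inter> B = {}" "A \<union> B = N \<union> T" for A B N T :: "'b set"
    using that by fast+
  ultimately have im: "k ` darts M = darts N" "k ` darts P = darts T" by metis+
  have "inj_on k (darts M)" "inj_on k (darts P)" using bij by (auto simp: bij_betw_def inj_on_Un)
  then have b: "bij_betw k (darts M) (darts N)" "bij_betw k (darts P) (darts T)" using im by (simp_all add: bij_betw_def)
  have kN: "k x \<in> darts N" if "x \<in> darts M" for x using im(1) that by blast
  have kT: "k x \<in> darts T" if "x \<in> darts P" for x using im(2) that by blast
  have "k (rot M x) = rot N (k x)" "k (opp M x) = opp N (k x)" if "x \<in> darts M" for x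
    using kM[OF that] r'(1)[OF kN[OF that]] o'(1)[OF kN[OF that]] by simp_all
  then show "is_iso k M N" unfolding is_iso_def using b(1) kr by blast
  have "k (rot P x) = rot T (k x)" "k (opp P x) = opp T (k x)" if "x \<in> darts P" for x
    using kP[OF that] r'(2)[OF kT[OF that]] o'(2)[OF kT[OF that]] by simp_all
  then show "is_iso k P T" unfolding is_iso_def using b(2) k(2) by blast
qed

text \<open>B consists of construction data with arbitrary fresh dart names, G builds the object,
  and K forgets the names. If K separates data exactly as isomorphism separates the results, then
  the classes of results can be counted by the values of K.\<close>

lemma quotient_bij:
  assumes r: "equiv U r" and G: "\<And>b. b \<in> B \<Longrightarrow> G b \<in> U"
    and K: "\<And>b b'. b \<in> B \<Longrightarrow> b' \<in> B \<Longrightarrow> K b = K b' \<longleftrightarrow> (G b, G b') \<in> r"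
  obtains \<phi> where "bij_betw \<phi> (K ` B) ((G ` B) // r)" "\<And>b. b \<in> B \<Longrightarrow> \<phi> (K b) = r `` {G b}"
proof
  define \<phi> where "\<phi> z = r `` {G (SOME b. b \<in> B \<and> K b = z)}" for z
  have cl: "r `` {G b} = r `` {G b'} \<longleftrightarrow> K b = K b'" if "b \<in> B" "b' \<in> B" for b b'
    using K[OF that] eq_equiv_class_iff[OF r G[OF that(1)] G[OF that(2)]] by simp
  show \<phi>: "\<phi> (K b) = r `` {G b}" if "b \<in> B" for b
  proof -
    have "\<exists>b'. b' \<in> B \<and> K b' = K b" using that by blast
    from someI_ex[OF this] show ?thesis unfolding \<phi>_def using cl that by blast
  qed
  show "bij_betw \<phi> (K ` B) ((G ` B) // r)"
  proof (rule bij_betw_imageI)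
    show "inj_on \<phi> (K ` B)" using \<phi> cl by (auto simp: inj_on_def)
    have "\<phi> ` K ` B = (\<lambda>b. r `` {G b}) ` B" unfolding image_image using \<phi> by (intro image_cong) auto
    then show "\<phi> ` K ` B = (G ` B) // r" by (auto simp: quotient_def)
  qed
qed

text \<open>The arrow is counted, so this is one more than the degree of the root vertex.\<close>

definition rdeg :: "'d rmap \<Rightarrow> nat" where
  "rdeg M = card (orbit (rot M) (arrow M))"

definition root_loop :: "'d rmap \<Rightarrow> bool" where
  "root_loop M \<longleftrightarrow> opp M (rot M (arrow M)) \<in> orbit (rot M) (arrow M)"

lemma root_dart:
  assumes "rooted_map M"
  shows "arrow M \<in> darts M" "finite (darts M)" "rot M permutes darts M"
  using rootedD[OF assms] by auto

lemma rdeg_inv: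
  assumes "rooted_map M"
  shows "card (orbit (inv (rot M)) (arrow M)) = rdeg M"
  using orbit_inv_eq[of "rot M" "arrow M"] root_dart[OF assms] permutation_permutes by (metis rdeg_def)

text \<open>Number the darts of the root vertex backwards from the arrow, the arrow being step 0 and
  p step j. The new root cycle is arrow, d, then steps j - 1 down to 1. The root degree of the
  result is thus j, and every value from 1 to \<open>rdeg N\<close> arises from exactly one j. The
  choice p = arrow is the full turn j = \<open>rdeg N\<close>, not j = 0.\<close>

lemma ext_root:
  fixes N :: "'d rmap"
  assumes N: "rooted_map N" and j: "1 \<le> j" "j \<le> rdeg N" and b: "b \<notin> darts N" "d \<notin> insert b (darts N)"
  defines "p \<equiv> (inv (rot N) ^^ j) (arrow N)"
  defines "M \<equiv> add_root b d (ins p b N)"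
  shows "p \<in> darts N" "p \<in> orbit (rot N) (arrow N)" "rdeg M = Suc j" "\<not> root_loop M"
proof -
  let ?a = "arrow N" and ?q = "inv (rot N)"
  define \<pi> where "\<pi> i = (?q ^^ i) ?a" for i
  note R = root_dart[OF N] and D = rootedD[OF N]
  have q: "?q permutes darts N" using R(3) by (rule permutes_inv)
  note f = funpow_orbit_card[OF q R(2), of ?a, unfolded rdeg_inv[OF N], folded \<pi>_def]
  have \<pi>D: "\<pi> i \<in> darts N" for i
    unfolding \<pi>_def using R(1) permutes_in_image[OF q] by (induction i) auto
  have \<pi>S: "rot N (\<pi> (Suc i)) = \<pi> i" for i using permutes_inverses(1)[OF R(3)] by (simp add: \<pi>_def)
  have \<pi>0: "\<pi> 0 = ?a" by (simp add: \<pi>_def)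
  have p: "p = \<pi> j" by (simp add: p_def \<pi>_def)
  show pD: "p \<in> darts N" using p \<pi>D by simp
  have "\<pi> j \<in> orbit ?q ?a" unfolding \<pi>_def
    by (rule funpow_in_orbit[OF perm_self_in_orbit[OF q R(2)]])
  then show "p \<in> orbit (rot N) ?a"
    using orbit_inv_eq[of "rot N" ?a] R(2,3) permutation_permutes p by metis
  have ne: "\<pi> i \<noteq> ?a" "\<pi> i \<noteq> p" if "0 < i" "i < j" for i
  proof -
    show 1: "\<pi> i \<noteq> ?a" using inj_onD[OF f(2), of i 0] that j \<pi>0 by auto
    show "\<pi> i \<noteq> p"
    proof (cases "j = rdeg N")
      \<comment> \<open>After a full turn p is the arrow itself, which has just been
        excluded.\<close>
      case True then show ?thesis using 1 f(1) p by simp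
    next
      case False then show ?thesis using inj_onD[OF f(2), of i j] that j p by auto
    qed
  qed
  have nb: "\<pi> i \<noteq> b" "\<pi> i \<noteq> d" for i using \<pi>D[of i] b by auto
  have aM: "arrow M = ?a" by (simp add: M_def)
  have ab: "?a \<noteq> b" "?a \<noteq> d" "b \<noteq> d" "p \<noteq> b" "p \<noteq> d" using R(1) b pD by auto
  have rot: "rot M ?a = d" "rot M d = rot N p" "\<And>x. x \<noteq> ?a \<Longrightarrow> x \<noteq> p \<Longrightarrow> x \<noteq> b \<Longrightarrow> x \<noteq> d \<Longrightarrow> rot M x = rot N x"
    using ab D(12)[of d] b by (simp_all add: M_def transpose_def)
  have opp: "opp M d = b" using ab D(13)[of b] b by (simp add: M_def)
  obtain k where k: "j = Suc k" using j by (cases j) auto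
  have rp: "rot N p = \<pi> k" using p k \<pi>S by simp
  have "orbit (rot M) ?a \<subseteq> insert d (\<pi> ` {..<j})"
  proof (rule orbit_subset_closed)
    show "?a \<in> insert d (\<pi> ` {..<j})" using \<pi>0 k by (auto intro!: image_eqI[of _ _ 0])
    fix y assume "y \<in> insert d (\<pi> ` {..<j})"
    then consider "y = d" | "y = ?a" | i where "y = \<pi> (Suc i)" "Suc i < j"
      using \<pi>0 by (auto simp: image_iff) (metis not0_implies_Suc)
    then show "rot M y \<in> insert d (\<pi> ` {..<j})"
    proof cases
      case 1 then show ?thesis using rot(2) rp k by auto
    next
      case 2 then show ?thesis using rot(1) by simp
    next
      case 3
      then have "rot M y = \<pi> i" using rot(3)[of y] ne[of "Suc i"] nb \<pi>S by simp
      then show ?thesis using 3 by simp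
    qed
  qed
  moreover have "\<pi> (k - i) \<in> orbit (rot M) ?a" if "i \<le> k" for i
    using that
  proof (induction i)
    case 0
    have "d \<in> orbit (rot M) ?a" using rot(1) orbit.base by metis
    then have "rot M d \<in> orbit (rot M) ?a" by (rule orbit.step)
    then show ?case using rot(2) rp by simp
  next
    case (Suc i)
    then have "k - i = Suc (k - Suc i)" by simp
    then have "rot M (\<pi> (k - i)) = \<pi> (k - Suc i)"
      using rot(3)[of "\<pi> (k - i)"] ne[of "k - i"] nb \<pi>S k by simp
    moreover have "rot M (\<pi> (k - i)) \<in> orbit (rot M) ?a" using Suc by (intro orbit.step) simp
    ultimately show ?case by simp
  qed
  then have "\<pi> ` {..<j} \<subseteq> orbit (rot M) ?a"
    using k by (auto simp: less_Suc_eq_le) (metis diff_diff_cancel diff_le_self)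
  moreover have "d \<in> orbit (rot M) ?a" using rot(1) orbit.base by metis
  ultimately have o: "orbit (rot M) ?a = insert d (\<pi> ` {..<j})" by blast
  have "card (\<pi> ` {..<j}) = j" using inj_on_subset[OF f(2), of "{..<j}"] j by (simp add: card_image)
  moreover have "d \<notin> \<pi> ` {..<j}" using nb(2) by auto
  ultimately show "rdeg M = Suc j" unfolding rdeg_def aM o by simp
  show "\<not> root_loop M"
    unfolding root_loop_def aM o rot(1) opp using nb(1) ab by auto
qed

text \<open>The two root cycles are concatenated. The arrow of P turns into a half-edge, so d is the
  only additional dart, and both ends of the new edge lie at the common vertex.\<close>

lemma loop_root:
  assumes N: "rooted_map N" "rooted_map P" "darts N \<inter> darts P = {}" "d \<notin> darts N \<union> darts P"
  defines "M \<equiv> add_root (arrow P) d (join N P)"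
  shows "rdeg M = rdeg N + rdeg P + 1" "root_loop M"
proof -
  let ?a = "arrow N" and ?b = "arrow P" and ?s = "rot N \<circ> rot P" and ?D = "darts N \<union> darts P"
  note R = root_dart[OF N(1)] and R' = root_dart[OF N(2)]
  note D = rootedD[OF N(1)] and D' = rootedD[OF N(2)]
  have s: "?s permutes ?D" "finite ?D" using R R' by (auto intro: comp_disjoint_permutes)
  note od = orbit_comp_disjoint[OF R(3) R'(3) N(3) R(2) R'(2)]
  have oa: "orbit ?s ?a = orbit (rot N) ?a" and ob: "orbit ?s ?b = orbit (rot P) ?b"
    using od(1)[OF R(1)] od(2)[OF R'(1)] by auto
  have sub: "orbit (rot N) ?a \<subseteq> darts N" "orbit (rot P) ?b \<subseteq> darts P"
    by (rule permutes_orbit_subset[OF R(3,1)], rule permutes_orbit_subset[OF R'(3,1)])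
  have nb: "?b \<notin> orbit ?s ?a" using oa sub R'(1) N(3) by auto
  let ?s1 = "?s \<circ> transpose ?a ?b"
  have o1: "orbit ?s1 ?a = orbit (rot N) ?a \<union> orbit (rot P) ?b" using orbit_merge(1)[OF s nb] oa ob by simp
  have s1: "?s1 permutes insert d ?D" "finite (insert d ?D)"
    using s R(1) R'(1) by (simp_all add: permutes_insert_transpose)
  have d1: "d \<notin> orbit ?s1 ?a" using o1 sub N(4) by auto
  have ad: "?a \<noteq> d" "?b \<noteq> d" "?a \<noteq> ?b" using R(1) R'(1) N(3,4) by auto
  have sd: "?s d = d" using D(12)[of d] D'(12)[of d] N(4) by simp
  then have "?s1 d = d" using ad by simp
  then have od: "orbit ?s1 d = {d}" by (simp add: orbit_eq_singleton_iff)
  have rM: "rot M = ?s1 \<circ> transpose ?a d" "arrow M = ?a" by (simp_all add: M_def)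
  have o: "orbit (rot M) (arrow M) = orbit (rot N) ?a \<union> orbit (rot P) ?b \<union> {d}"
    unfolding rM using orbit_merge(1)[OF s1 d1] o1 od by simp
  have fin: "finite (orbit (rot N) ?a)" "finite (orbit (rot P) ?b)" using sub R(2) R'(2) finite_subset by blast+
  have "orbit (rot N) ?a \<inter> orbit (rot P) ?b = {}" "d \<notin> orbit (rot N) ?a \<union> orbit (rot P) ?b" using sub N(3,4) by auto
  then show "rdeg M = rdeg N + rdeg P + 1" unfolding rdeg_def o using fin by (simp add: card_Un_disjoint)
  have "rot M ?a = d" using ad sd unfolding rM by simp
  moreover have "opp M d = ?b"
    using ad D(13)[of ?b] D'(9)[of ?b] R'(1) N(3) by (auto simp: M_def)
  moreover have "?b \<in> orbit (rot M) (arrow M)"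
    unfolding o using perm_self_in_orbit[OF R'(3,2)] by simp
  ultimately show "root_loop M" by (simp only: root_loop_def rM(2))
qed

section \<open>Isomorphism of maps built from smaller ones\<close>

definition iso :: "'d rmap \<Rightarrow> 'e rmap \<Rightarrow> bool" where
  "iso M N \<longleftrightarrow> (\<exists>h. is_iso h M N)"

lemma rdeg_iso:
  assumes "rooted_map M" "is_iso h M N"
  shows "rdeg N = rdeg M"
  using is_iso_counts(4)[OF assms(2) assms(1)[unfolded rooted_map_iff]] by (simp add: rdeg_def)

lemma back_funpow_iso:
  assumes "rooted_map M" "rooted_map N" "is_iso h M N"
  shows "h ((inv (rot M) ^^ j) (arrow M)) = (inv (rot N) ^^ j) (arrow N)"
proof -
  note R = root_dart[OF assms(1)] and R' = root_dart[OF assms(2)]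
  have "intertwines h (darts M) (inv (rot M)) (inv (rot N))" using assms(3) R(3) R'(3) by (intro intertwines_inv) (auto simp: is_iso_iff)
  from intertwines_funpow(1)[OF this permutes_inv[OF R(3)] R(1)] assms(3) show ?thesis by (simp add: is_iso_def)
qed

lemma back_funpow_inj:
  assumes M: "rooted_map M" and j: "1 \<le> i" "i \<le> rdeg M" "1 \<le> j" "j \<le> rdeg M"
    and eq: "(inv (rot M) ^^ i) (arrow M) = (inv (rot M) ^^ j) (arrow M)"
  shows "i = j"
proof -
  note R = root_dart[OF M]
  obtain i' j' where ij: "i = Suc i'" "j = Suc j'" using j by (metis Suc_le_D One_nat_def)
  have "(inv (rot M) ^^ i') (arrow M) = (inv (rot M) ^^ j') (arrow M)"
    using eq unfolding ij using injD[OF permutes_inj[OF permutes_inv[OF R(3)]]] by simp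
  then have "i' = j'"
    using inj_onD[OF funpow_orbit_card(2)[OF permutes_inv[OF R(3)] R(2), of "arrow M", unfolded rdeg_inv[OF M]], of i' j'] j ij by simp
  then show ?thesis using ij by simp
qed

text \<open>An isomorphism of the large maps restricts to N, where p is a number of steps from the
  arrow and therefore preserved. The fresh names b and d drop out.\<close>

lemma ext_iso_iff:
  assumes N: "rooted_map N" "1 \<le> j" "j \<le> rdeg N" "b \<notin> darts N" "d \<notin> insert b (darts N)"
    and N': "rooted_map N'" "1 \<le> j'" "j' \<le> rdeg N'" "b' \<notin> darts N'" "d' \<notin> insert b' (darts N')"
  shows "iso (add_root b d (ins ((inv (rot N) ^^ j) (arrow N)) b N)) (add_root b' d' (ins ((inv (rot N') ^^ j') (arrow N')) b' N'))
    \<longleftrightarrow> iso N N' \<and> j = j'" (is "iso (add_root b d ?K) (add_root b' d' ?K') \<longleftrightarrow> _")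
proof -
  let ?p = "(inv (rot N) ^^ j) (arrow N)" and ?p' = "(inv (rot N') ^^ j') (arrow N')"
  note e = ext_root[OF N] and e' = ext_root[OF N']
  have K: "premap ?K {arrow ?K, b} {arrow ?K}" "b \<noteq> arrow ?K" "d \<notin> darts ?K"
    using premap_ins[OF N(1) e(1) N(4)] root_dart[OF N(1)] N(4,5) by auto
  have K': "premap ?K' {arrow ?K', b'} {arrow ?K'}" "b' \<noteq> arrow ?K'" "d' \<notin> darts ?K'"
    using premap_ins[OF N'(1) e'(1) N'(4)] root_dart[OF N'(1)] N'(4,5) by auto
  note M = N(1)[unfolded rooted_map_iff] and M' = N'(1)[unfolded rooted_map_iff]
  show ?thesis
  proof
    assume "iso (add_root b d ?K) (add_root b' d' ?K')"
    then obtain h where h: "is_iso h (add_root b d ?K) (add_root b' d' ?K')" by (auto simp: iso_def)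
    note c = is_iso_add_root_conv[OF h K(1,2) K'(1,2) K(3) K'(3)]
    note c' = is_iso_ins_conv[OF c(1,2) M e(1) N(4) N'(4) M' e'(1)]
    have "j = j'"
      using back_funpow_iso[OF N(1) N'(1) c'(1)] c'(2) rdeg_iso[OF N(1) c'(1)] N(2,3) N'(2,3)
      by (intro back_funpow_inj[OF N'(1)]) auto
    then show "iso N N' \<and> j = j'" using c'(1) by (auto simp: iso_def)
  next
    assume "iso N N' \<and> j = j'"
    then obtain h where h: "is_iso h N N'" and j: "j = j'" by (auto simp: iso_def)
    have hp: "h ?p = ?p'" using back_funpow_iso[OF N(1) N'(1) h] j by simp
    have "is_iso (h(b := b')) ?K ?K'" using is_iso_ins[OF h M e(1) N(4) N'(4) M'] hp by simp
    from is_iso_add_root[OF this _ K(1) K'(1) K(3) K'(3)]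
    show "iso (add_root b d ?K) (add_root b' d' ?K')" by (auto simp: iso_def)
  qed
qed

lemma loop_iso_iff:
  assumes N: "rooted_map N" "rooted_map P" "darts N \<inter> darts P = {}" "d \<notin> darts N \<union> darts P"
    and N': "rooted_map N'" "rooted_map P'" "darts N' \<inter> darts P' = {}" "d' \<notin> darts N' \<union> darts P'"
  shows "iso (add_root (arrow P) d (join N P)) (add_root (arrow P') d' (join N' P')) \<longleftrightarrow> iso N N' \<and> iso P P'"
    (is "iso (add_root _ d ?K) (add_root _ d' ?K') \<longleftrightarrow> _")
proof -
  have K: "premap ?K {arrow ?K, arrow P} {arrow ?K, arrow P}" "arrow P \<noteq> arrow ?K" "d \<notin> darts ?K"
    using premap_join[OF N(1-3)] N(4) by auto
  have K': "premap ?K' {arrow ?K', arrow P'} {arrow ?K', arrow P'}" "arrow P' \<noteq> arrow ?K'" "d' \<notin> darts ?K'"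
    using premap_join[OF N'(1-3)] N'(4) by auto
  show ?thesis
  proof
    assume "iso (add_root (arrow P) d ?K) (add_root (arrow P') d' ?K')"
    then obtain h where h: "is_iso h (add_root (arrow P) d ?K) (add_root (arrow P') d' ?K')" by (auto simp: iso_def)
    note c = is_iso_add_root_conv[OF h K(1,2) K'(1,2) K(3) K'(3)]
    show "iso N N' \<and> iso P P'"
      using is_iso_join_conv[OF c(1,2) N(1) N'(1) N(2) N'(2) N(3) N'(3)] by (auto simp: iso_def)
  next
    assume "iso N N' \<and> iso P P'"
    then obtain h g where h: "is_iso h N N'" "is_iso g P P'" by (auto simp: iso_def)
    note j = is_iso_join[OF h N(1) N'(1) N(2) N'(2) N(3) N'(3)]
    from is_iso_add_root[OF j K(1) K'(1) K(3) K'(3)]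
    show "iso (add_root (arrow P) d ?K) (add_root (arrow P') d' ?K')" by (auto simp: iso_def)
  qed
qed

lemma leaf_iso_iff:
  assumes N: "rooted_map N" "p \<in> darts N" "b \<notin> darts N" "l \<notin> insert b (darts N)"
    and N': "rooted_map N'" "p' \<in> darts N'" "b' \<notin> darts N'" "l' \<notin> insert b' (darts N')"
  shows "(\<exists>h. is_iso h (add_leaf b l (ins p b N)) (add_leaf b' l' (ins p' b' N')) \<and> h l = l') \<longleftrightarrow>
    (\<exists>h. is_iso h N N' \<and> h p = p')" (is "(\<exists>h. is_iso h (add_leaf b l ?K) (add_leaf b' l' ?K') \<and> _) \<longleftrightarrow> _")
proof -
  have K: "premap ?K {arrow ?K, b} {arrow ?K}" "b \<in> darts ?K" "l \<notin> darts ?K"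
    using premap_ins[OF N(1-3)] N(4) by auto
  have K': "premap ?K' {arrow ?K', b'} {arrow ?K'}" "b' \<in> darts ?K'" "l' \<notin> darts ?K'"
    using premap_ins[OF N'(1-3)] N'(4) by auto
  note M = N(1)[unfolded rooted_map_iff] and M' = N'(1)[unfolded rooted_map_iff]
  show ?thesis
  proof
    assume "\<exists>h. is_iso h (add_leaf b l ?K) (add_leaf b' l' ?K') \<and> h l = l'"
    then obtain h where h: "is_iso h (add_leaf b l ?K) (add_leaf b' l' ?K')" "h l = l'" by auto
    note c = is_iso_add_leaf_conv[OF h K(1) K'(1) K(3) K'(3)]
    show "\<exists>h. is_iso h N N' \<and> h p = p'" using is_iso_ins_conv[OF c M N(2,3) N'(3) M' N'(2)] by blast
  next
    assume "\<exists>h. is_iso h N N' \<and> h p = p'"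
    then obtain h where h: "is_iso h N N'" "h p = p'" by auto
    have "is_iso (h(b := b')) ?K ?K'" using is_iso_ins[OF h(1) M N(2,3) N'(3) M'] h(2) by simp
    from is_iso_add_leaf[OF this _ K(1,2) K'(1) K(3) K'(3)]
    have "is_iso (h(b := b', l := l')) (add_leaf b l ?K) (add_leaf b' l' ?K')" by simp
    then show "\<exists>h. is_iso h (add_leaf b l ?K) (add_leaf b' l' ?K') \<and> h l = l'" by fastforce
  qed
qed

lemma relabel:
  assumes M: "rooted_map M" and f: "inj_on f (darts M)"
  obtains N where "rooted_map N" "is_iso f M N" "darts N = f ` darts M"
proof -
  note D = rootedD[OF M]
  define N where "N = \<lparr>darts = f ` darts M, rot = map_permutation (darts M) f (rot M),
    opp = map_permutation (darts M) f (opp M), arrow = f (arrow M)\<rparr>"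
  have N: "darts N = f ` darts M" "arrow N = f (arrow M)" by (simp_all add: N_def)
  have r: "rot N (f x) = f (rot M x)" "opp N (f x) = f (opp M x)" if "x \<in> darts M" for x
    using map_permutation_apply[OF f that] by (simp_all add: N_def)
  have b: "bij_betw f (darts M) (f ` darts M)" using f by (simp add: bij_betw_def)
  have P: "rot N permutes f ` darts M" "opp N permutes f ` darts M"
    using map_permutation_permutes[OF b D(5)] map_permutation_permutes[OF b D(6)] by (simp_all add: N_def)
  have a: "arrow M \<in> darts M" using D(4) by simp
  have "rooted_map N"
    unfolding rooted_map_iff
  proof (rule premapI)
    show "opp N (opp N y) = y" for y
    proof (cases "y \<in> f ` darts M")
      case True
      then obtain x where x: "x \<in> darts M" "y = f x" by auto
      then show ?thesis using r(2)[of x] r(2)[of "opp M x"] D(7,11) by simp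
    qed (use permutes_not_in[OF P(2)] in simp)
    show "opp N y = y \<longleftrightarrow> y \<in> {arrow N}" if y: "y \<in> darts N" for y
    proof -
      obtain x where x: "x \<in> darts M" "y = f x" using y N by auto
      then have "opp N y = y \<longleftrightarrow> opp M x = x" using r(2)[of x] inj_on_eq_iff[OF f, of "opp M x" x] D(11)[of x] by simp
      moreover have "y = arrow N \<longleftrightarrow> x = arrow M" using x N inj_on_eq_iff[OF f] a by simp
      ultimately show ?thesis using D(8)[of x] x by simp
    qed
    fix S assume S: "S \<subseteq> darts N" "{arrow N} \<subseteq> S" "\<And>x. x \<in> S \<Longrightarrow> rot N x \<in> S" "\<And>x. x \<in> S \<Longrightarrow> opp N x \<in> S"
    have "{x \<in> darts M. f x \<in> S} = darts M"
    proof (rule rooted_conn[OF M])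
      fix x assume "x \<in> {x \<in> darts M. f x \<in> S}"
      then show "rot M x \<in> {x \<in> darts M. f x \<in> S}" "opp M x \<in> {x \<in> darts M. f x \<in> S}"
        using S(3,4)[of "f x"] r[of x] D(10,11)[of x] by simp_all
    qed (use S(2) a N in auto)
    then show "S = darts N" using S(1) N by auto
  qed (use D(1) a P N in auto)
  moreover have "is_iso f M N" using b N r by (simp add: is_iso_def)
  ultimately show ?thesis using that N(1) by blast
qed

section \<open>Isomorphism classes of planar maps\<close>

lemma iso_refl: "iso M M" unfolding iso_def using is_iso_refl by blast

lemma iso_trans: "iso M N \<Longrightarrow> iso N P \<Longrightarrow> iso M P"
  unfolding iso_def using is_iso_trans by blast

lemma iso_sym: "rooted_map M \<Longrightarrow> iso M N \<Longrightarrow> iso N M"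
  unfolding iso_def rooted_map_iff using is_iso_sym by blast

lemma iso_counts:
  assumes "rooted_map M" "iso M N"
  shows "nv N = nv M" "nf N = nf M" "card (darts N) = card (darts M)" "rdeg N = rdeg M"
    "root_loop N \<longleftrightarrow> root_loop M"
proof -
  obtain h where "is_iso h M N" using assms(2) by (auto simp: iso_def)
  note c = is_iso_counts[OF this assms(1)[unfolded rooted_map_iff]]
  show "nv N = nv M" "nf N = nf M" "card (darts N) = card (darts M)" "rdeg N = rdeg M"
    "root_loop N \<longleftrightarrow> root_loop M"
    using c by (simp_all add: rdeg_def root_loop_def)
qed

lemma map_iso_iff: "(M, N) \<in> map_iso \<longleftrightarrow> rooted_map M \<and> rooted_map N \<and> iso M N"
  by (simp add: map_iso_def iso_def)

lemma equiv_map_iso: "equiv {M. rooted_map M} map_iso"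
proof (rule equivI)
  show "map_iso \<subseteq> {M. rooted_map M} \<times> {M. rooted_map M}" by (auto simp: map_iso_def)
  show "refl_on {M. rooted_map M} map_iso" by (auto simp: refl_on_def map_iso_iff iso_refl)
  show "sym map_iso" by (auto simp: sym_def map_iso_iff iso_sym)
  show "trans map_iso" unfolding trans_def map_iso_iff using iso_trans by blast
qed

definition iso_class :: "nat rmap \<Rightarrow> nat rmap set" where "iso_class M = map_iso `` {M}"
definition repr :: "nat rmap set \<Rightarrow> nat rmap" where "repr C = (SOME M. M \<in> C)"

lemma iso_class_eq_iff: "rooted_map M \<Longrightarrow> rooted_map N \<Longrightarrow> iso_class M = iso_class N \<longleftrightarrow> iso M N"
  unfolding iso_class_def using eq_equiv_class_iff[OF equiv_map_iso, of M N] by (simp add: map_iso_iff)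

lemma repr_iso_class:
  assumes "rooted_map M"
  shows "rooted_map (repr (iso_class M))" "iso M (repr (iso_class M))"
proof -
  have "M \<in> iso_class M" using assms by (simp add: iso_class_def map_iso_iff iso_refl)
  then have "repr (iso_class M) \<in> iso_class M" unfolding repr_def by (rule someI)
  then show "rooted_map (repr (iso_class M))" "iso M (repr (iso_class M))" by (simp_all add: iso_class_def map_iso_iff)
qed

lemma repr_counts:
  assumes "rooted_map M"
  shows "nv (repr (iso_class M)) = nv M" "nf (repr (iso_class M)) = nf M" "card (darts (repr (iso_class M))) = card (darts M)"
    "rdeg (repr (iso_class M)) = rdeg M"
  using iso_counts[OF assms repr_iso_class(2)[OF assms]] by simp_all

definition pmaps :: "nat \<Rightarrow> nat rmap set" where
  "pmaps n = {M. planar_map M \<and> card (darts M) = 2 * n + 1}"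

definition pclasses :: "nat \<Rightarrow> nat rmap set set" where "pclasses n = pmaps n // map_iso"

lemma pmaps_rooted: "M \<in> pmaps n \<Longrightarrow> rooted_map M"
  by (simp add: pmaps_def planar_map_iff)

lemma pmaps_euler: "M \<in> pmaps n \<Longrightarrow> nv M + nf M = n + 2"
  by (simp add: pmaps_def planar_map_iff)

lemma pclasses_eq: "pclasses n = iso_class ` pmaps n"
  by (auto simp: pclasses_def quotient_def iso_class_def)

lemma pmaps_iff: "M \<in> pmaps n \<longleftrightarrow> planar_map M \<and> card (edges M) = n"
  using card_darts[of M] by (auto simp: pmaps_def planar_map_iff)

lemma planar_map_iso: "planar_map M \<Longrightarrow> rooted_map N \<Longrightarrow> iso M N \<Longrightarrow> planar_map N"
  using iso_counts[of M N] by (auto simp: planar_map_iff)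

lemma pmaps_repr: "M \<in> pmaps n \<Longrightarrow> repr (iso_class M) \<in> pmaps n"
  using repr_counts[of M] repr_iso_class[of M] planar_map_iso[of M] by (auto simp: pmaps_def planar_map_iff)

lemma repr_pclasses: "C \<in> pclasses n \<Longrightarrow> repr C \<in> pmaps n"
  using pmaps_repr by (auto simp: pclasses_eq)

lemma pclasses_inj: "C \<in> pclasses i \<Longrightarrow> C \<in> pclasses j \<Longrightarrow> i = j"
  using repr_pclasses[of C i] repr_pclasses[of C j] by (simp add: pmaps_def)

section \<open>Root edge decomposition of isomorphism classes\<close>

definition link_data :: "nat \<Rightarrow> (nat rmap \<times> nat \<times> nat \<times> nat) set" where
  "link_data n = {(N, j, b, d). N \<in> pmaps n \<and> 1 \<le> j \<and> j \<le> rdeg N \<and> b \<notin> darts N \<and> d \<notin> insert b (darts N)}"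

definition link_map :: "nat rmap \<times> nat \<times> nat \<times> nat \<Rightarrow> nat rmap" where
  "link_map = (\<lambda>(N, j, b, d). add_root b d (ins ((inv (rot N) ^^ j) (arrow N)) b N))"

definition loop_data :: "nat \<Rightarrow> (nat rmap \<times> nat rmap \<times> nat) set" where
  "loop_data n = {(N, P, d). (\<exists>i\<le>n. N \<in> pmaps i \<and> P \<in> pmaps (n - i)) \<and> darts N \<inter> darts P = {} \<and> d \<notin> darts N \<union> darts P}"

definition loop_map :: "nat rmap \<times> nat rmap \<times> nat \<Rightarrow> nat rmap" where
  "loop_map = (\<lambda>(N, P, d). add_root (arrow P) d (join N P))"

lemma rdeg_pos: "rooted_map M \<Longrightarrow> 1 \<le> rdeg M"
  using root_dart[of M] perm_self_in_orbit[of "rot M" "darts M" "arrow M"] finite_orbit[of "arrow M" "rot M"]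
  by (auto simp: rdeg_def Suc_le_eq card_gt_0_iff)

lemma orbit_back_funpow:
  assumes N: "rooted_map N" and p: "p \<in> orbit (rot N) (arrow N)"
  obtains j where "1 \<le> j" "j \<le> rdeg N" "p = (inv (rot N) ^^ j) (arrow N)"
proof -
  note R = root_dart[OF N]
  note f = funpow_orbit_card[OF permutes_inv[OF R(3)] R(2), of "arrow N", unfolded rdeg_inv[OF N]]
  have "p \<in> orbit (inv (rot N)) (arrow N)"
    using p orbit_inv_eq[of "rot N" "arrow N"] R(2,3) permutation_permutes by metis
  then obtain i where i: "i < rdeg N" "p = (inv (rot N) ^^ i) (arrow N)" using f(3) by auto
  show ?thesis
  proof (cases "i = 0")
    case True
    then show ?thesis using that[of "rdeg N"] f(1) i rdeg_pos[OF N] by simp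
  next
    case False
    then show ?thesis using that[of i] i by simp
  qed
qed

lemma link_map_props:
  assumes "(N, j, b, d) \<in> link_data n"
  shows "link_map (N, j, b, d) \<in> pmaps (Suc n)" "nf (link_map (N, j, b, d)) = nf N" "rdeg (link_map (N, j, b, d)) = Suc j"
    "\<not> root_loop (link_map (N, j, b, d))"
proof -
  have N: "N \<in> pmaps n" "rooted_map N" "1 \<le> j" "j \<le> rdeg N" "b \<notin> darts N" "d \<notin> insert b (darts N)"
    using assms pmaps_rooted by (auto simp: link_data_def)
  note e = ext_root[OF N(2-6)] and c = ext_counts[OF N(2) ext_root(1)[OF N(2-6)] N(5,6)]
    and p = planar_ext_iff[OF N(2) ext_root(1)[OF N(2-6)] N(5,6)]
  show "link_map (N, j, b, d) \<in> pmaps (Suc n)" using p e(2) c(3) N(1) by (simp add: pmaps_def link_map_def)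
  show "nf (link_map (N, j, b, d)) = nf N" using c(2) by (simp add: link_map_def)
  show "rdeg (link_map (N, j, b, d)) = Suc j" using e(3) by (simp add: link_map_def)
  show "\<not> root_loop (link_map (N, j, b, d))"
    unfolding link_map_def prod.case by (rule e(4))
qed

lemma loop_map_props:
  assumes "(N, P, d) \<in> loop_data n"
  shows "loop_map (N, P, d) \<in> pmaps (Suc n)" "nf (loop_map (N, P, d)) = nf N + nf P" "rdeg (loop_map (N, P, d)) = rdeg N + rdeg P + 1"
    "root_loop (loop_map (N, P, d))"
proof -
  obtain i where i: "i \<le> n" "N \<in> pmaps i" "P \<in> pmaps (n - i)" using assms by (auto simp: loop_data_def)
  have N: "rooted_map N" "rooted_map P" "darts N \<inter> darts P = {}" "d \<notin> darts N \<union> darts P"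
    using assms i pmaps_rooted by (auto simp: loop_data_def)
  note e = loop_root[OF N] and c = loop_counts[OF N] and p = planar_loop_iff[OF N]
  show "loop_map (N, P, d) \<in> pmaps (Suc n)" using p c(3) i by (simp add: pmaps_def loop_map_def)
  show "nf (loop_map (N, P, d)) = nf N + nf P" using c(2) by (simp add: loop_map_def)
  show "rdeg (loop_map (N, P, d)) = rdeg N + rdeg P + 1" using e(1) by (simp add: loop_map_def)
  show "root_loop (loop_map (N, P, d))"
    unfolding loop_map_def prod.case by (rule e(2))
qed

text \<open>Planarity confines p to the root vertex, which is why it can be recorded as a number of
  backward steps from the arrow.\<close>

lemma pmaps_Suc: "pmaps (Suc n) = link_map ` link_data n \<union> loop_map ` loop_data n"
proof (rule equalityI; rule subsetI)
  fix M assume M: "M \<in> pmaps (Suc n)"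
  then have c: "planar_map M" "card (darts M) = 2 * n + 3" by (auto simp: pmaps_def)
  from pmaps_rooted[OF M] show "M \<in> link_map ` link_data n \<union> loop_map ` loop_data n"
  proof (cases rule: rooted_cases)
    case point then show ?thesis using c by simp
  next
    case (ext N p b d)
    have p: "planar_map N" "p \<in> orbit (rot N) (arrow N)" using planar_ext_iff[OF ext(1-4)] c(1) ext(5) by auto
    obtain j where j: "1 \<le> j" "j \<le> rdeg N" "p = (inv (rot N) ^^ j) (arrow N)" using orbit_back_funpow[OF ext(1) p(2)] .
    have "card (darts N) = 2 * n + 1" using ext_counts(3)[OF ext(1-4)] c(2) ext(5) by simp
    then have "(N, j, b, d) \<in> link_data n" using j ext(3,4) p by (simp add: link_data_def pmaps_def)
    moreover have "M = link_map (N, j, b, d)" using ext(5) j(3) by (simp add: link_map_def)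
    ultimately show ?thesis by blast
  next
    case (loop N P d)
    have p: "planar_map N" "planar_map P" using planar_loop_iff[OF loop(1-4)] c(1) loop(5) by auto
    have l: "card (darts N) + card (darts P) + 1 = 2 * n + 3" using loop_counts(3)[OF loop(1-4)] c(2) loop(5) by simp
    have e: "card (darts N) = 2 * card (edges N) + 1" "card (darts P) = 2 * card (edges P) + 1"
      using card_darts loop(1,2) by blast+
    have "N \<in> pmaps (card (edges N))" "P \<in> pmaps (n - card (edges N))" "card (edges N) \<le> n" using p l e by (auto simp: pmaps_def)
    then have "(N, P, d) \<in> loop_data n" using loop(3,4) by (auto simp: loop_data_def)
    moreover have "M = loop_map (N, P, d)" using loop(5) by (simp add: loop_map_def)
    ultimately show ?thesis by blast
  qed
next
  fix M assume "M \<in> link_map ` link_data n \<union> loop_map ` loop_data n"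
  then show "M \<in> pmaps (Suc n)" using link_map_props(1) loop_map_props(1) by fastforce
qed

lemma fresh_darts:
  assumes "finite (D :: nat set)"
  obtains b d where "b \<notin> D" "d \<notin> insert b D"
  using ex_new_if_finite[of D] ex_new_if_finite[of "insert _ D"] assms infinite_UNIV_nat by (metis finite_insert)

lemma link_key_image: "(\<lambda>(N, j, b, d). (iso_class N, j)) ` link_data n = Sigma (pclasses n) (\<lambda>C. {1..rdeg (repr C)})"
proof (rule equalityI; rule subsetI)
  fix z assume "z \<in> (\<lambda>(N, j, b, d). (iso_class N, j)) ` link_data n"
  then obtain N j b d where "(N, j, b, d) \<in> link_data n" "z = (iso_class N, j)" by auto
  then show "z \<in> Sigma (pclasses n) (\<lambda>C. {1..rdeg (repr C)})"
    using repr_counts(4)[of N] pmaps_rooted[of N n] by (auto simp: link_data_def pclasses_eq)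
next
  fix z assume "z \<in> Sigma (pclasses n) (\<lambda>C. {1..rdeg (repr C)})"
  then obtain N j where N: "N \<in> pmaps n" "z = (iso_class N, j)" "1 \<le> j" "j \<le> rdeg (repr (iso_class N))" by (auto simp: pclasses_eq)
  obtain b d where "b \<notin> darts N" "d \<notin> insert b (darts N)" using fresh_darts root_dart(2)[OF pmaps_rooted[OF N(1)]] by metis
  then have "(N, j, b, d) \<in> link_data n" using N repr_counts(4)[OF pmaps_rooted[OF N(1)]] by (simp add: link_data_def)
  then show "z \<in> (\<lambda>(N, j, b, d). (iso_class N, j)) ` link_data n" using N(2) by force
qed

lemma disjoint_copy:
  assumes "rooted_map (P :: nat rmap)" "finite (D :: nat set)"
  obtains P' where "rooted_map P'" "iso P P'" "D \<inter> darts P' = {}"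
proof -
  have inj: "inj_on (\<lambda>x. x + Suc (Max (insert 0 D))) (darts P)" by (auto simp: inj_on_def)
  obtain P' where P': "rooted_map P'" "is_iso (\<lambda>x. x + Suc (Max (insert 0 D))) P P'" "darts P' = (\<lambda>x. x + Suc (Max (insert 0 D))) ` darts P"
    using relabel[OF assms(1) inj] .
  have "x \<le> Max (insert 0 D)" if "x \<in> D" for x using that assms(2) by (intro Max_ge) auto
  then have "D \<inter> darts P' = {}" using P'(3) by fastforce
  then show ?thesis using that P'(1,2) by (auto simp: iso_def)
qed

lemma loop_key_image: "(\<lambda>(N, P, d). (iso_class N, iso_class P)) ` loop_data n = (\<Union>i\<le>n. pclasses i \<times> pclasses (n - i))"
proof (rule equalityI; rule subsetI)
  fix z assume "z \<in> (\<lambda>(N, P, d). (iso_class N, iso_class P)) ` loop_data n"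
  then show "z \<in> (\<Union>i\<le>n. pclasses i \<times> pclasses (n - i))" by (auto simp: loop_data_def pclasses_eq)
next
  fix z assume "z \<in> (\<Union>i\<le>n. pclasses i \<times> pclasses (n - i))"
  then obtain i N P where z: "i \<le> n" "N \<in> pmaps i" "P \<in> pmaps (n - i)" "z = (iso_class N, iso_class P)" by (auto simp: pclasses_eq)
  note r = pmaps_rooted[OF z(2)] pmaps_rooted[OF z(3)]
  obtain P' where P': "rooted_map P'" "iso P P'" "darts N \<inter> darts P' = {}"
    using disjoint_copy[OF r(2) root_dart(2)[OF r(1)]] .
  have "P' \<in> pmaps (n - i)" using z(3) P' planar_map_iso[of P P'] iso_counts(3)[OF r(2) P'(2)] by (simp add: pmaps_def)
  moreover obtain d where "d \<notin> darts N \<union> darts P'"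
    using fresh_darts[of "darts N \<union> darts P'"] root_dart(2)[OF r(1)] root_dart(2)[OF P'(1)] by blast
  ultimately have "(N, P', d) \<in> loop_data n" using z P'(3) by (auto simp: loop_data_def)
  moreover have "z = (iso_class N, iso_class P')" using z(4) iso_class_eq_iff[OF r(2) P'(1)] P'(2) by simp
  ultimately show "z \<in> (\<lambda>(N, P, d). (iso_class N, iso_class P)) ` loop_data n" by force
qed

lemma link_classes_bij:
  obtains \<phi> where "bij_betw \<phi> (Sigma (pclasses n) (\<lambda>C. {1..rdeg (repr C)})) ((link_map ` link_data n) // map_iso)"
    "\<And>N j b d. (N, j, b, d) \<in> link_data n \<Longrightarrow> \<phi> (iso_class N, j) = iso_class (link_map (N, j, b, d))"
proof -
  have G: "link_map x \<in> {M. rooted_map M}" if "x \<in> link_data n" for x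
    using that link_map_props(1) pmaps_rooted by (cases x) blast
  have K: "(\<lambda>(N, j, b, d). (iso_class N, j)) x = (\<lambda>(N, j, b, d). (iso_class N, j)) y \<longleftrightarrow> (link_map x, link_map y) \<in> map_iso"
    if xy: "x \<in> link_data n" "y \<in> link_data n" for x y
  proof -
    obtain N j b d where x: "x = (N, j, b, d)" by (cases x)
    obtain N' j' b' d' where y: "y = (N', j', b', d')" by (cases y)
    have N: "rooted_map N" "1 \<le> j" "j \<le> rdeg N" "b \<notin> darts N" "d \<notin> insert b (darts N)"
      and N': "rooted_map N'" "1 \<le> j'" "j' \<le> rdeg N'" "b' \<notin> darts N'" "d' \<notin> insert b' (darts N')"
      using xy pmaps_rooted unfolding x y link_data_def by auto
    have "(link_map x, link_map y) \<in> map_iso \<longleftrightarrow> iso (link_map x) (link_map y)" using G[OF xy(1)] G[OF xy(2)] by (simp add: map_iso_iff)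
    also have "\<dots> \<longleftrightarrow> iso N N' \<and> j = j'" unfolding x y link_map_def prod.case by (rule ext_iso_iff[OF N N'])
    finally show ?thesis using iso_class_eq_iff[OF N(1) N'(1)] by (simp add: x y)
  qed
  obtain \<phi> where \<phi>: "bij_betw \<phi> ((\<lambda>(N, j, b, d). (iso_class N, j)) ` link_data n) ((link_map ` link_data n) // map_iso)"
    "\<And>x. x \<in> link_data n \<Longrightarrow> \<phi> ((\<lambda>(N, j, b, d). (iso_class N, j)) x) = map_iso `` {link_map x}"
    using quotient_bij[where U = "{M. rooted_map M}" and r = map_iso and B = "link_data n" and G = link_map and K = "\<lambda>(N, j, b, d). (iso_class N, j)",
        OF equiv_map_iso G K] by metis
  show ?thesis
  proof (rule that)
    show "bij_betw \<phi> (Sigma (pclasses n) (\<lambda>C. {1..rdeg (repr C)})) ((link_map ` link_data n) // map_iso)" using \<phi>(1) unfolding link_key_image .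
    show "\<phi> (iso_class N, j) = iso_class (link_map (N, j, b, d))" if "(N, j, b, d) \<in> link_data n" for N j b d
      using \<phi>(2)[OF that] by (simp add: iso_class_def)
  qed
qed

lemma loop_classes_bij:
  obtains \<phi> where "bij_betw \<phi> (\<Union>i\<le>n. pclasses i \<times> pclasses (n - i)) ((loop_map ` loop_data n) // map_iso)"
    "\<And>N P d. (N, P, d) \<in> loop_data n \<Longrightarrow> \<phi> (iso_class N, iso_class P) = iso_class (loop_map (N, P, d))"
proof -
  have G: "loop_map x \<in> {M. rooted_map M}" if "x \<in> loop_data n" for x
    using that loop_map_props(1) pmaps_rooted by (cases x) blast
  have K: "(\<lambda>(N, P, d). (iso_class N, iso_class P)) x = (\<lambda>(N, P, d). (iso_class N, iso_class P)) y \<longleftrightarrow> (loop_map x, loop_map y) \<in> map_iso"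
    if xy: "x \<in> loop_data n" "y \<in> loop_data n" for x y
  proof -
    obtain N P d where x: "x = (N, P, d)" by (cases x)
    obtain N' P' d' where y: "y = (N', P', d')" by (cases y)
    have N: "rooted_map N" "rooted_map P" "darts N \<inter> darts P = {}" "d \<notin> darts N \<union> darts P"
      and N': "rooted_map N'" "rooted_map P'" "darts N' \<inter> darts P' = {}" "d' \<notin> darts N' \<union> darts P'"
      using xy pmaps_rooted unfolding x y loop_data_def by auto
    have "(loop_map x, loop_map y) \<in> map_iso \<longleftrightarrow> iso (loop_map x) (loop_map y)" using G[OF xy(1)] G[OF xy(2)] by (simp add: map_iso_iff)
    also have "\<dots> \<longleftrightarrow> iso N N' \<and> iso P P'" unfolding x y loop_map_def prod.case by (rule loop_iso_iff[OF N N'])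
    finally show ?thesis using iso_class_eq_iff[OF N(1) N'(1)] iso_class_eq_iff[OF N(2) N'(2)] by (simp add: x y)
  qed
  obtain \<phi> where \<phi>: "bij_betw \<phi> ((\<lambda>(N, P, d). (iso_class N, iso_class P)) ` loop_data n) ((loop_map ` loop_data n) // map_iso)"
    "\<And>x. x \<in> loop_data n \<Longrightarrow> \<phi> ((\<lambda>(N, P, d). (iso_class N, iso_class P)) x) = map_iso `` {loop_map x}"
    using quotient_bij[where U = "{M. rooted_map M}" and r = map_iso and B = "loop_data n" and G = loop_map and K = "\<lambda>(N, P, d). (iso_class N, iso_class P)",
        OF equiv_map_iso G K] by metis
  show ?thesis
  proof (rule that)
    show "bij_betw \<phi> (\<Union>i\<le>n. pclasses i \<times> pclasses (n - i)) ((loop_map ` loop_data n) // map_iso)" using \<phi>(1) unfolding loop_key_image .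
    show "\<phi> (iso_class N, iso_class P) = iso_class (loop_map (N, P, d))" if "(N, P, d) \<in> loop_data n" for N P d
      using \<phi>(2)[OF that] by (simp add: iso_class_def)
  qed
qed

text \<open>Whether the root edge is a loop is invariant under isomorphism, so the two kinds of
  classes do not overlap.\<close>

lemma pclasses_Suc:
  "pclasses (Suc n) = (link_map ` link_data n) // map_iso \<union> (loop_map ` loop_data n) // map_iso"
  "(link_map ` link_data n) // map_iso \<inter> (loop_map ` loop_data n) // map_iso = {}"
proof -
  show "pclasses (Suc n) = (link_map ` link_data n) // map_iso \<union> (loop_map ` loop_data n) // map_iso"
    unfolding pclasses_def pmaps_Suc by (auto simp: quotient_def)
  have "iso_class (link_map x) \<noteq> iso_class (loop_map y)" if "x \<in> link_data n" "y \<in> loop_data n" for x y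
  proof
    assume eq: "iso_class (link_map x) = iso_class (loop_map y)"
    obtain N j b d where x: "x = (N, j, b, d)" by (cases x)
    obtain N' P' d' where y: "y = (N', P', d')" by (cases y)
    have r: "rooted_map (link_map x)" "rooted_map (loop_map y)" using link_map_props(1) loop_map_props(1) that pmaps_rooted unfolding x y by blast+
    then have "iso (link_map x) (loop_map y)" using eq iso_class_eq_iff by blast
    from iso_counts(5)[OF r(1) this] show False using link_map_props(4) loop_map_props(4) that unfolding x y by blast
  qed
  then show "(link_map ` link_data n) // map_iso \<inter> (loop_map ` loop_data n) // map_iso = {}"
    by (auto simp: quotient_def iso_class_def)
qed

lemma pmaps_0:
  assumes "M \<in> pmaps 0"
  shows "darts M = {arrow M}"
proof -
  have "card (darts M) = 1" using assms by (simp add: pmaps_def)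
  then show ?thesis using root_dart(1)[OF pmaps_rooted[OF assms]] by (auto simp: card_1_singleton_iff)
qed

lemma pclasses_0: "\<exists>M. M \<in> pmaps 0 \<and> pclasses 0 = {iso_class M}"
proof -
  define M where "M = \<lparr>darts = {0::nat}, rot = id, opp = id, arrow = 0\<rparr>"
  have "rooted_map M" unfolding rooted_map_def by (simp add: M_def)
  then have M: "M \<in> pmaps 0" using point_counts[of M] by (simp add: pmaps_def planar_map_iff M_def)
  have c: "iso_class N = iso_class M" if N: "N \<in> pmaps 0" for N
  proof -
    have "is_iso (\<lambda>_. 0) N M" using pmaps_0[OF N] by (auto simp: is_iso_def M_def bij_betw_def)
    then show ?thesis using iso_class_eq_iff[OF pmaps_rooted[OF N] pmaps_rooted[OF M]] by (auto simp: iso_def)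
  qed
  have "iso_class ` pmaps 0 = (\<lambda>_. iso_class M) ` pmaps 0" by (rule image_cong[OF refl c])
  also have "\<dots> = {iso_class M}" using M by (simp add: image_constant_conv) blast
  finally have "pclasses 0 = {iso_class M}" unfolding pclasses_eq .
  then show ?thesis using M by blast
qed

text \<open>Each class is infinite, since dart names are arbitrary numbers. That there are finitely
  many classes is drawn from the decomposition by induction on the number of edges.\<close>

lemma finite_pclasses: "finite (pclasses n)"
proof (induction n rule: less_induct)
  case (less n)
  show ?case
  proof (cases n)
    case 0 then show ?thesis using pclasses_0 by auto
  next
    case (Suc m)
    obtain \<phi> where \<phi>: "bij_betw \<phi> (Sigma (pclasses m) (\<lambda>C. {1..rdeg (repr C)})) ((link_map ` link_data m) // map_iso)" by (rule link_classes_bij[of m], rule that, assumption)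
    obtain \<psi> where \<psi>: "bij_betw \<psi> (\<Union>i\<le>m. pclasses i \<times> pclasses (m - i)) ((loop_map ` loop_data m) // map_iso)" by (rule loop_classes_bij[of m], rule that, assumption)
    have fm: "finite (pclasses i)" if "i \<le> m" for i using less[of i] that Suc by simp
    have "finite (Sigma (pclasses m) (\<lambda>C. {1..rdeg (repr C)}))" using fm[of m] by (intro finite_SigmaI) simp_all
    moreover have "finite (\<Union>i\<le>m. pclasses i \<times> pclasses (m - i))" by (intro finite_UN_I finite_cartesian_product fm) simp_all
    ultimately show ?thesis unfolding Suc pclasses_Suc using bij_betw_finite[OF \<phi>] bij_betw_finite[OF \<psi>] by simp
  qed
qed

section \<open>Generating polynomials by root degree and faces\<close>

definition map_weight :: "nat rmap \<Rightarrow> real poly poly" where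
  "map_weight M = monom (monom 1 (nf M)) (rdeg M - 1)"

definition root_poly :: "nat \<Rightarrow> real poly poly" where
  "root_poly n = (\<Sum>C\<in>pclasses n. map_weight (repr C))"

lemma map_weight_repr: "rooted_map M \<Longrightarrow> map_weight (repr (iso_class M)) = map_weight M"
  by (simp add: map_weight_def repr_counts)

text \<open>If the root edge is not a loop, the new root degree takes each value from 1 to
  \<open>rdeg\<close> of the smaller map once. For a loop the root degrees of the two parts add up,
  and x^2 accounts for its two ends.\<close>

lemma root_poly_Suc:
  "root_poly (Suc n) = (\<Sum>C\<in>pclasses n. \<Sum>j\<in>{1..rdeg (repr C)}. monom (monom 1 (nf (repr C))) j)
     + [:0, 1:]^2 * (\<Sum>i\<le>n. root_poly i * root_poly (n - i))"
proof -
  obtain \<phi> where \<phi>: "bij_betw \<phi> (Sigma (pclasses n) (\<lambda>C. {1..rdeg (repr C)})) ((link_map ` link_data n) // map_iso)"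
    "\<And>N j b d. (N, j, b, d) \<in> link_data n \<Longrightarrow> \<phi> (iso_class N, j) = iso_class (link_map (N, j, b, d))" using link_classes_bij by blast
  obtain \<psi> where \<psi>: "bij_betw \<psi> (\<Union>i\<le>n. pclasses i \<times> pclasses (n - i)) ((loop_map ` loop_data n) // map_iso)"
    "\<And>N P d. (N, P, d) \<in> loop_data n \<Longrightarrow> \<psi> (iso_class N, iso_class P) = iso_class (loop_map (N, P, d))" using loop_classes_bij by blast
  have E: "(\<Sum>C\<in>(link_map ` link_data n) // map_iso. map_weight (repr C)) = (\<Sum>C\<in>pclasses n. \<Sum>j\<in>{1..rdeg (repr C)}. monom (monom 1 (nf (repr C))) j)"
  proof -
    have "(\<Sum>C\<in>(link_map ` link_data n) // map_iso. map_weight (repr C)) = (\<Sum>z\<in>Sigma (pclasses n) (\<lambda>C. {1..rdeg (repr C)}). map_weight (repr (\<phi> z)))"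
      by (rule sum.reindex_bij_betw[OF \<phi>(1), symmetric])
    also have "\<dots> = (\<Sum>(C, j)\<in>Sigma (pclasses n) (\<lambda>C. {1..rdeg (repr C)}). monom (monom 1 (nf (repr C))) j)"
    proof (rule sum.cong[OF refl])
      fix z assume "z \<in> Sigma (pclasses n) (\<lambda>C. {1..rdeg (repr C)})"
      then obtain N j b d where z: "(N, j, b, d) \<in> link_data n" "z = (iso_class N, j)" unfolding link_key_image[symmetric] by auto
      note g = link_map_props[OF z(1)]
      have "map_weight (repr (\<phi> z)) = map_weight (link_map (N, j, b, d))" using \<phi>(2)[OF z(1)] z(2) map_weight_repr[OF pmaps_rooted[OF g(1)]] by simp
      also have "\<dots> = monom (monom 1 (nf N)) j" by (simp add: map_weight_def g)
      also have "nf N = nf (repr (iso_class N))" using z(1) repr_counts(2) pmaps_rooted by (auto simp: link_data_def)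
      finally show "map_weight (repr (\<phi> z)) = (case z of (C, j) \<Rightarrow> monom (monom 1 (nf (repr C))) j)" using z(2) by simp
    qed
    also have "\<dots> = (\<Sum>C\<in>pclasses n. \<Sum>j\<in>{1..rdeg (repr C)}. monom (monom 1 (nf (repr C))) j)"
      by (rule sum.Sigma[symmetric]) (auto simp: finite_pclasses)
    finally show ?thesis .
  qed
  have L: "(\<Sum>C\<in>(loop_map ` loop_data n) // map_iso. map_weight (repr C)) = [:0, 1:]^2 * (\<Sum>i\<le>n. root_poly i * root_poly (n - i))"
  proof -
    have "(\<Sum>C\<in>(loop_map ` loop_data n) // map_iso. map_weight (repr C)) = (\<Sum>z\<in>(\<Union>i\<le>n. pclasses i \<times> pclasses (n - i)). map_weight (repr (\<psi> z)))"
      by (rule sum.reindex_bij_betw[OF \<psi>(1), symmetric])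
    also have "\<dots> = (\<Sum>(C, C')\<in>(\<Union>i\<le>n. pclasses i \<times> pclasses (n - i)). [:0, 1:]^2 * (map_weight (repr C) * map_weight (repr C')))"
    proof (rule sum.cong[OF refl])
      fix z assume "z \<in> (\<Union>i\<le>n. pclasses i \<times> pclasses (n - i))"
      then obtain N P d where z: "(N, P, d) \<in> loop_data n" "z = (iso_class N, iso_class P)" unfolding loop_key_image[symmetric] by auto
      note g = loop_map_props[OF z(1)]
      have r: "rooted_map N" "rooted_map P" using z(1) pmaps_rooted by (auto simp: loop_data_def)
      have "map_weight (repr (\<psi> z)) = map_weight (loop_map (N, P, d))" using \<psi>(2)[OF z(1)] z(2) map_weight_repr[OF pmaps_rooted[OF g(1)]] by simp
      also have "\<dots> = [:0, 1:]^2 * (map_weight N * map_weight P)"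
      proof -
        have x: "[:0, 1:]^2 = monom (1 :: real poly) 2" by (simp add: monom_altdef)
        have e: "rdeg N + rdeg P + 1 - 1 = 2 + (rdeg N - 1 + (rdeg P - 1))" using rdeg_pos[OF r(1)] rdeg_pos[OF r(2)] by simp
        show ?thesis by (simp only: map_weight_def g x mult_monom e mult_1_left)
      qed
      finally show "map_weight (repr (\<psi> z)) = (case z of (C, C') \<Rightarrow> [:0, 1:]^2 * (map_weight (repr C) * map_weight (repr C')))"
        using z(2) map_weight_repr r by simp
    qed
    also have "\<dots> = (\<Sum>i\<le>n. \<Sum>(C, C')\<in>pclasses i \<times> pclasses (n - i). [:0, 1:]^2 * (map_weight (repr C) * map_weight (repr C')))"
    proof (rule sum.UNION_disjoint)
      show "\<forall>i\<in>{..n}. finite (pclasses i \<times> pclasses (n - i))" by (simp add: finite_pclasses)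
      show "\<forall>i\<in>{..n}. \<forall>j\<in>{..n}. i \<noteq> j \<longrightarrow> (pclasses i \<times> pclasses (n - i)) \<inter> (pclasses j \<times> pclasses (n - j)) = {}"
        using pclasses_inj by blast
    qed simp
    also have "\<dots> = (\<Sum>i\<le>n. [:0, 1:]^2 * (root_poly i * root_poly (n - i)))"
    proof (rule sum.cong[OF refl])
      fix i
      show "(\<Sum>(C, C')\<in>pclasses i \<times> pclasses (n - i). [:0, 1:]^2 * (map_weight (repr C) * map_weight (repr C'))) = [:0, 1:]^2 * (root_poly i * root_poly (n - i))"
        unfolding root_poly_def sum_product unfolding sum.cartesian_product unfolding sum_distrib_left by (simp add: case_prod_unfold)
    qed
    finally show ?thesis by (simp add: sum_distrib_left)
  qed
  have fin: "finite ((link_map ` link_data n) // map_iso)" "finite ((loop_map ` loop_data n) // map_iso)"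
    using finite_pclasses[of "Suc n"] unfolding pclasses_Suc by simp_all
  show ?thesis unfolding root_poly_def[of "Suc n"] pclasses_Suc(1) sum.union_disjoint[OF fin pclasses_Suc(2)] E L ..
qed

lemma root_poly_0: "root_poly 0 = [:[:0, 1:]:]"
proof -
  obtain M where M: "M \<in> pmaps 0" "pclasses 0 = {iso_class M}" using pclasses_0 by blast
  note r = pmaps_rooted[OF M(1)]
  have "rot M permutes {arrow M}" using root_dart(3)[OF r] pmaps_0[OF M(1)] by simp
  then have "orbit (rot M) (arrow M) = {arrow M}" by (simp add: orbit_eq_singleton_iff)
  then have "rdeg M = 1" unfolding rdeg_def by simp
  then show ?thesis using M map_weight_repr[OF r] point_counts[OF r pmaps_0[OF M(1)]]
    by (simp add: root_poly_def map_weight_def monom_0 monom_altdef)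
qed

text \<open>The geometric sum, arranged so that the right-hand side involves only x^(k - 1), the
  monomial of a map of root degree k - 1.\<close>

lemma geometric_monom:
  fixes c :: "'a::comm_ring_1"
  assumes "k \<ge> 1"
  shows "([:0, 1:] - 1) * (\<Sum>j\<in>{1..k}. monom c j) = [:0, 1:] * ([:0, 1:] * monom c (k - 1) - [:poly (monom c (k - 1)) 1:])"
  using assms
proof (induction k rule: dec_induct)
  case base
  show ?case by (simp add: monom_altdef algebra_simps)
next
  case (step k)
  have alg: "(x - 1) * (s + x * m) = x * (x * m - c)" if "(x - 1) * s = x * (m - c)" for x s m c :: "'a poly"
    using that by (simp add: algebra_simps)
  have m: "monom c (Suc i) = [:0, 1:] * monom c i" for i by (simp add: monom_Suc)
  obtain l where l: "k = Suc l" using step by (cases k) auto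
  have "{1..Suc k} = insert (Suc k) {1..k}" by auto
  then have "(\<Sum>j\<in>{1..Suc k}. monom c j) = (\<Sum>j\<in>{1..k}. monom c j) + [:0, 1:] * monom c k"
    by (simp add: m add.commute)
  moreover have "([:0, 1:] - 1) * (\<Sum>j\<in>{1..k}. monom c j) = [:0, 1:] * (monom c k - [:c:])"
    using step.IH by (simp only: l m diff_Suc_1 poly_monom power_one mult_1_right)
  ultimately show ?case using alg by (simp only: diff_Suc_1 poly_monom power_one mult_1_right)
qed

lemma root_poly_tutte:
  "([:0,1:] - 1) * root_poly n =
      (if n = 0 then ([:0,1:] - 1) * [:[:0,1:]:]
       else [:0,1:] * ([:0,1:] * root_poly (n - 1) - [:poly (root_poly (n - 1)) 1:])
         + ([:0,1:] - 1) * [:0,1:]^2 * (\<Sum>i<n. root_poly i * root_poly (n - 1 - i)))"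
proof (cases n)
  case 0
  then show ?thesis by (simp add: root_poly_0)
next
  case (Suc m)
  have "([:0,1:] - 1) * (\<Sum>C\<in>pclasses m. \<Sum>j\<in>{1..rdeg (repr C)}. monom (monom 1 (nf (repr C))) j)
    = (\<Sum>C\<in>pclasses m. [:0, 1:] * ([:0, 1:] * map_weight (repr C) - [:poly (map_weight (repr C)) 1:]))"
  proof (subst sum_distrib_left, rule sum.cong[OF refl])
    fix C assume "C \<in> pclasses m"
    then have "rdeg (repr C) \<ge> 1" using rdeg_pos[OF pmaps_rooted[OF repr_pclasses]] by blast
    then show "([:0,1:] - 1) * (\<Sum>j\<in>{1..rdeg (repr C)}. monom (monom (1::real) (nf (repr C))) j) = [:0, 1:] * ([:0, 1:] * map_weight (repr C) - [:poly (map_weight (repr C)) 1:])"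
      unfolding map_weight_def by (rule geometric_monom)
  qed
  also have "\<dots> = [:0, 1:] * ([:0, 1:] * root_poly m - [:poly (root_poly m) 1:])"
  proof -
    have "(\<Sum>C\<in>A. [:poly (map_weight (repr C)) 1:]) = [:poly (\<Sum>C\<in>A. map_weight (repr C)) 1:]" for A
      by (induction A rule: infinite_finite_induct) auto
    then show ?thesis unfolding root_poly_def by (simp only: sum_distrib_left[symmetric] sum_subtractf)
  qed
  finally show ?thesis unfolding Suc root_poly_Suc by (simp add: distrib_left mult.assoc lessThan_Suc_atMost)
qed

lemma Q_eq: "Q n f = card {C \<in> pclasses n. nf (repr C) = f}"
proof -
  have "{M. planar_map M \<and> card (edges M) = n \<and> card (faces M) = f} = {M \<in> pmaps n. nf M = f}"
    by (auto simp: pmaps_iff card_faces)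
  moreover have "{M \<in> pmaps n. nf M = f} // map_iso = {C \<in> pclasses n. nf (repr C) = f}"
    using repr_counts(2)[OF pmaps_rooted] by (auto simp: quotient_def pclasses_eq iso_class_def)
  ultimately show ?thesis by (simp add: Q_def)
qed

lemma root_poly_coeff: "coeff (poly (root_poly n) 1) f = real (Q n f)"
proof -
  have "coeff (poly (root_poly n) 1) f = (\<Sum>C\<in>pclasses n. if nf (repr C) = f then 1 else 0)"
    by (simp add: root_poly_def poly_sum coeff_sum map_weight_def poly_monom if_distrib cong: if_cong)
  also have "\<dots> = real (card {C \<in> pclasses n. nf (repr C) = f})"
    using finite_pclasses by (simp add: sum.If_cases Collect_conj_eq Int_commute)
  finally show ?thesis by (simp add: Q_eq)
qed

lemma nv_nf_pos: "rooted_map M \<Longrightarrow> nv M \<ge> 1 \<and> nf M \<ge> 1"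
  using root_dart(1,2)[of M] ncyc_pos[of "darts M"] by (auto simp: nv_def nf_def Suc_le_eq)

lemma Q_zero: "f = 0 \<or> f > n + 1 \<Longrightarrow> Q n f = 0"
proof -
  assume f: "f = 0 \<or> f > n + 1"
  have "nf (repr C) \<noteq> f" if "C \<in> pclasses n" for C
    using f nv_nf_pos[OF pmaps_rooted[OF repr_pclasses[OF that]]] pmaps_euler[OF repr_pclasses[OF that]] by auto
  then have "{C \<in> pclasses n. nf (repr C) = f} = {}" by blast
  then show ?thesis unfolding Q_eq by (simp only: card.empty)
qed

section \<open>Duality\<close>

definition dual :: "'d rmap \<Rightarrow> 'd rmap" where
  "dual M = M\<lparr>rot := rot M \<circ> opp M\<rparr>"

lemma dual_simps [simp]:
  "darts (dual M) = darts M" "rot (dual M) = rot M \<circ> opp M" "opp (dual M) = opp M" "arrow (dual M) = arrow M"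
  by (simp_all add: dual_def)

text \<open>Composing with the involution twice restores \<open>rot\<close>, so the cycles of
  \<open>rot\<close> and of the face permutation change places. The arrow is fixed by
  \<open>opp\<close> and keeps its role, and the sets closed under both permutations are the same
  for the map and its dual.\<close>

lemma dual_rooted:
  assumes "rooted_map M"
  shows "rooted_map (dual M)" "dual (dual M) = M" "nv (dual M) = nf M" "nf (dual M) = nv M"
proof -
  note D = rootedD[OF assms]
  have o: "opp M \<circ> opp M = id" using D(7) by (simp add: fun_eq_iff)
  show "rooted_map (dual M)" unfolding rooted_map_iff
  proof (rule premapI)
    show "rot (dual M) permutes darts (dual M)" using D(5,6) by (simp add: permutes_compose)
    fix S assume S: "S \<subseteq> darts (dual M)" "{arrow (dual M)} \<subseteq> S" "\<And>x. x \<in> S \<Longrightarrow> rot (dual M) x \<in> S" "\<And>x. x \<in> S \<Longrightarrow> opp (dual M) x \<in> S"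
    have "S = darts M"
    proof (rule rooted_conn[OF assms])
      fix x assume x: "x \<in> S"
      show "opp M x \<in> S" using S(4)[OF x] by simp
      show "rot M x \<in> S" using S(3)[OF S(4)[OF x]] D(7)[of x] by simp
    qed (use S(1,2) in auto)
    then show "S = darts (dual M)" by simp
  qed (use D(1-4,6-8) in auto)
  show "dual (dual M) = M" by (simp add: dual_def comp_assoc o)
  show "nv (dual M) = nf M" "nf (dual M) = nv M" by (simp_all add: nv_def nf_def comp_assoc o)
qed

lemma dual_iso:
  assumes "rooted_map M" "iso M N"
  shows "iso (dual M) (dual N)"
  using assms rootedD(11)[OF assms(1)] by (auto simp: iso_def is_iso_def)

lemma dual_iso_iff:
  assumes "rooted_map M" "rooted_map N"
  shows "iso (dual M) (dual N) \<longleftrightarrow> iso M N"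
  using dual_iso[of M N] dual_iso[of "dual M" "dual N"] dual_rooted[OF assms(1)] dual_rooted[OF assms(2)] assms by auto

text \<open>Since v = n + 2 - f, exchanging vertices and faces is a reflection of the face
  number.\<close>

lemma Q_dual: "f \<le> n + 2 \<Longrightarrow> Q n (n + 2 - f) = Q n f"
proof -
  assume f: "f \<le> n + 2"
  have q: "{M \<in> pmaps n. nf M = f} // map_iso = {C \<in> pclasses n. nf (repr C) = f}" for f
    using repr_counts(2)[OF pmaps_rooted] by (auto simp: quotient_def pclasses_eq iso_class_def)
  let ?B = "{M \<in> pmaps n. nf M = f}"
  have dpm: "dual M \<in> pmaps n" if "M \<in> pmaps n" for M
    using that dual_rooted[OF pmaps_rooted[OF that]] by (simp add: pmaps_def planar_map_iff add.commute)
  have d: "dual ` ?B = {M \<in> pmaps n. nf M = n + 2 - f}"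
  proof (rule equalityI; rule subsetI)
    fix M assume "M \<in> dual ` ?B"
    then obtain N where N: "N \<in> pmaps n" "nf N = f" "M = dual N" by auto
    then show "M \<in> {M \<in> pmaps n. nf M = n + 2 - f}"
      using dpm[OF N(1)] dual_rooted[OF pmaps_rooted[OF N(1)]] pmaps_euler[OF N(1)] by simp
  next
    fix M assume M: "M \<in> {M \<in> pmaps n. nf M = n + 2 - f}"
    then have "M = dual (dual M)" "dual M \<in> ?B"
      using dpm[of M] dual_rooted[OF pmaps_rooted[of M n]] pmaps_euler[of M n] f by auto
    then show "M \<in> dual ` ?B" by blast
  qed
  obtain \<phi> where \<phi>: "bij_betw \<phi> (iso_class ` ?B) ((dual ` ?B) // map_iso)"
  proof (rule quotient_bij[OF equiv_map_iso, of ?B dual iso_class])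
    fix M N assume "M \<in> ?B" "N \<in> ?B"
    then have r: "rooted_map M" "rooted_map N" using pmaps_rooted by auto
    show "iso_class M = iso_class N \<longleftrightarrow> (dual M, dual N) \<in> map_iso"
      using iso_class_eq_iff[OF r] dual_iso_iff[OF r] dual_rooted(1)[OF r(1)] dual_rooted(1)[OF r(2)] by (simp add: map_iso_iff)
  qed (use pmaps_rooted dual_rooted(1) in auto)
  have c: "iso_class ` ?B = {C \<in> pclasses n. nf (repr C) = f}" using q[of f] by (auto simp: quotient_def iso_class_def)
  show ?thesis unfolding Q_eq using bij_betw_same_card[OF \<phi>] unfolding c d q by simp
qed

section \<open>Marked maps\<close>

text \<open>For a rooted map \<open>is_iso_unique\<close> makes the choice unique on darts, so
  positions on the representative are canonical.\<close>

definition canon :: "nat rmap \<Rightarrow> nat \<Rightarrow> nat" where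
  "canon M = (SOME h. is_iso h M (repr (iso_class M)))"

lemma canon_iso: "rooted_map M \<Longrightarrow> is_iso (canon M) M (repr (iso_class M))"
  unfolding canon_def using repr_iso_class(2)[of M] unfolding iso_def by (rule someI_ex)

text \<open>A mark of kind \<open>mk\<close> is transported along isomorphisms by \<open>act\<close>.
  Rooted maps have no automorphisms, so a marked map is determined by its class and the position of
  the mark on the representative.\<close>

locale marking =
  fixes act :: "(nat \<Rightarrow> nat) \<Rightarrow> 'm \<Rightarrow> 'm" and mk :: "nat rmap \<Rightarrow> 'm set"
  assumes act_comp: "act (g \<circ> h) m = act g (act h m)"
    and act_cong: "rooted_map M \<Longrightarrow> m \<in> mk M \<Longrightarrow> (\<And>x. x \<in> darts M \<Longrightarrow> h x = g x) \<Longrightarrow> act h m = act g m"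
    and act_id: "act id m = m"
    and act_mk: "rooted_map M \<Longrightarrow> rooted_map N \<Longrightarrow> is_iso h M N \<Longrightarrow> m \<in> mk M \<Longrightarrow> act h m \<in> mk N"
begin

definition key :: "nat rmap \<times> 'm \<Rightarrow> nat rmap set \<times> 'm" where
  "key = (\<lambda>(M, m). (iso_class M, act (canon M) m))"

definition miso :: "((nat rmap \<times> 'm) \<times> (nat rmap \<times> 'm)) set" where
  "miso = {((M, m), (N, k)). rooted_map M \<and> rooted_map N \<and> m \<in> mk M \<and> k \<in> mk N \<and> (\<exists>h. is_iso h M N \<and> act h m = k)}"

definition marked :: "nat \<Rightarrow> nat \<Rightarrow> (nat rmap \<times> 'm) set" where
  "marked n f = {(M, m). M \<in> pmaps n \<and> nf M = f \<and> m \<in> mk M}"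

lemma act_inv:
  assumes "rooted_map M" "is_iso h M N" "m \<in> mk M"
  shows "act (inv_into (darts M) h) (act h m) = m"
proof -
  have "act (inv_into (darts M) h \<circ> h) m = act id m"
    using assms(2) bij_betw_inv_into_left[of h "darts M" "darts N"] by (intro act_cong[OF assms(1,3)]) (simp add: is_iso_def)
  then show ?thesis by (simp add: act_comp act_id)
qed

text \<open>Equal keys give an isomorphism through the common representative. In the other direction
  \<open>canon N\<close> after h is an isomorphism onto the representative, so it agrees with
  \<open>canon M\<close> on all darts by rigidity.\<close>

lemma key_eq_iff:
  assumes M: "rooted_map M" "m \<in> mk M" and N: "rooted_map N" "k \<in> mk N"
  shows "key (M, m) = key (N, k) \<longleftrightarrow> (\<exists>h. is_iso h M N \<and> act h m = k)"
proof
  assume eq: "key (M, m) = key (N, k)"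
  then have c: "iso_class M = iso_class N" "act (canon M) m = act (canon N) k" by (simp_all add: key_def)
  let ?g = "inv_into (darts N) (canon N)"
  have g: "is_iso ?g (repr (iso_class N)) N" using canon_iso[OF N(1)] is_iso_sym N(1)[unfolded rooted_map_iff] by blast
  have "is_iso (?g \<circ> canon M) M N" using is_iso_trans[OF _ g] canon_iso[OF M(1)] c(1) by simp
  moreover have "act (?g \<circ> canon M) m = k"
    unfolding act_comp c(2) by (rule act_inv[OF N(1) canon_iso[OF N(1)] N(2)])
  ultimately show "\<exists>h. is_iso h M N \<and> act h m = k" by blast
next
  assume "\<exists>h. is_iso h M N \<and> act h m = k"
  then obtain h where h: "is_iso h M N" "act h m = k" by blast
  have c: "iso_class M = iso_class N" using iso_class_eq_iff[OF M(1) N(1)] h(1) by (auto simp: iso_def)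
  have "is_iso (canon N \<circ> h) M (repr (iso_class M))" using is_iso_trans[OF h(1) canon_iso[OF N(1)]] c by simp
  then have "act (canon M) m = act (canon N \<circ> h) m"
    using is_iso_unique[OF M(1) canon_iso[OF M(1)]] by (intro act_cong[OF M]) auto
  then show "key (M, m) = key (N, k)" using c h(2) by (simp add: key_def act_comp)
qed

lemma equiv_miso: "equiv {(M, m). rooted_map M \<and> m \<in> mk M} miso"
proof -
  have "miso = {(x, y). x \<in> {(M, m). rooted_map M \<and> m \<in> mk M} \<and> y \<in> {(M, m). rooted_map M \<and> m \<in> mk M} \<and> key x = key y}"
    using key_eq_iff by (auto simp: miso_def)
  then show ?thesis by (auto intro!: equivI refl_onI symI transI)
qed

lemma key_image: "key ` marked n f = Sigma {C \<in> pclasses n. nf (repr C) = f} (\<lambda>C. mk (repr C))"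
proof (rule equalityI; rule subsetI)
  fix z assume "z \<in> key ` marked n f"
  then obtain M m where M: "M \<in> pmaps n" "nf M = f" "m \<in> mk M" "z = key (M, m)" by (auto simp: marked_def)
  note r = pmaps_rooted[OF M(1)]
  show "z \<in> Sigma {C \<in> pclasses n. nf (repr C) = f} (\<lambda>C. mk (repr C))"
    using M repr_counts(2)[OF r] act_mk[OF r repr_iso_class(1)[OF r] canon_iso[OF r] M(3)] by (auto simp: key_def pclasses_eq)
next
  fix z assume "z \<in> Sigma {C \<in> pclasses n. nf (repr C) = f} (\<lambda>C. mk (repr C))"
  then obtain M m where M: "M \<in> pmaps n" "nf (repr (iso_class M)) = f" "m \<in> mk (repr (iso_class M))" "z = (iso_class M, m)" by (auto simp: pclasses_eq)
  note r = pmaps_rooted[OF M(1)]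
  let ?g = "inv_into (darts M) (canon M)" and ?N = "repr (iso_class M)"
  have g: "is_iso ?g ?N M" using canon_iso[OF r] is_iso_sym r[unfolded rooted_map_iff] by blast
  have gm: "act ?g m \<in> mk M" by (rule act_mk[OF repr_iso_class(1)[OF r] r g M(3)])
  \<comment> \<open>This composite is an automorphism of the representative, hence the identity on
    its darts; so every mark there is reached.\<close>
  have "is_iso (canon M \<circ> ?g) ?N ?N" by (rule is_iso_trans[OF g canon_iso[OF r]])
  note u = is_iso_unique[OF repr_iso_class(1)[OF r] this is_iso_refl]
  have "act (canon M \<circ> ?g) m = act id m" by (rule act_cong[OF repr_iso_class(1)[OF r] M(3) u])
  then have "key (M, act ?g m) = z" using M(4) by (simp add: key_def act_comp act_id)
  moreover have "(M, act ?g m) \<in> marked n f" using M(1,2) gm repr_counts(2)[OF r] by (simp add: marked_def)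
  ultimately show "z \<in> key ` marked n f" by force
qed

text \<open>Each class contributes all marks of its representative, with none identified by
  automorphisms.\<close>

lemma card_key_image:
  assumes "\<And>M. M \<in> pmaps n \<Longrightarrow> nf M = f \<Longrightarrow> finite (mk M) \<and> card (mk M) = c"
  shows "card (key ` marked n f) = Q n f * c" "finite (key ` marked n f)"
proof -
  have 1: "finite (mk (repr C)) \<and> card (mk (repr C)) = c" if "C \<in> {C \<in> pclasses n. nf (repr C) = f}" for C
    using assms[OF repr_pclasses] that by blast
  show "card (key ` marked n f) = Q n f * c" unfolding key_image Q_eq
    using 1 by (subst card_SigmaI) (auto simp: finite_pclasses)
  show "finite (key ` marked n f)" unfolding key_image using 1 by (intro finite_SigmaI) (auto simp: finite_pclasses)
qed

lemma card_marked:
  assumes "\<And>M. M \<in> pmaps n \<Longrightarrow> nf M = f \<Longrightarrow> finite (mk M) \<and> card (mk M) = c"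
  shows "card (marked n f // miso) = Q n f * c" "finite (marked n f // miso)"
proof -
  obtain \<phi> where \<phi>: "bij_betw \<phi> (key ` marked n f) (((\<lambda>x. x) ` marked n f) // miso)"
  proof (rule quotient_bij[OF equiv_miso, of "marked n f" "\<lambda>x. x" key])
    fix x assume "x \<in> marked n f"
    then show "x \<in> {(M, m). rooted_map M \<and> m \<in> mk M}" using pmaps_rooted by (auto simp: marked_def)
  next
    fix x y assume "x \<in> marked n f" "y \<in> marked n f"
    then show "key x = key y \<longleftrightarrow> (x, y) \<in> miso"
      using key_eq_iff pmaps_rooted by (cases x; cases y) (auto simp: marked_def miso_def)
  qed
  show "card (marked n f // miso) = Q n f * c" "finite (marked n f // miso)"
    using bij_betw_same_card[OF \<phi>] bij_betw_finite[OF \<phi>] card_key_image[OF assms] by simp_all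
qed

end

lemma iso_orbit:
  assumes "rooted_map M" "is_iso h M N" "x \<in> darts M"
  shows "h ` orbit (rot M) x = orbit (rot N) (h x)"
  using assms intertwines_orbit[of h "darts M" "rot M" "rot N" x] root_dart[OF assms(1)] by (simp add: is_iso_iff)

lemma vertex_subset: "rooted_map M \<Longrightarrow> v \<in> vertices M \<Longrightarrow> v \<subseteq> darts M"
  using root_dart[of M] permutes_orbit_subset[of "rot M" "darts M"] by (auto simp: vertices_def)

interpretation vm: marking "(`)" vertices
proof
  show "(g \<circ> h) ` m = g ` h ` m" for g h :: "nat \<Rightarrow> nat" and m by (rule image_comp[symmetric])
  show "h ` m = g ` m" if "rooted_map M" "m \<in> vertices M" "\<And>x. x \<in> darts M \<Longrightarrow> h x = g x" for M m and h g :: "nat \<Rightarrow> nat"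
    using vertex_subset[OF that(1,2)] that(3) by (intro image_cong) auto
  show "id ` m = m" for m :: "nat set" by simp
  show "h ` m \<in> vertices N" if "rooted_map M" "rooted_map N" "is_iso h M N" "m \<in> vertices M" for M N :: "nat rmap" and h m
  proof -
    note i = that
    obtain x where "x \<in> darts M" "m = orbit (rot M) x" using i(4) by (auto simp: vertices_def)
    then show ?thesis using iso_orbit[OF i(1,3)] bij_betwE[of h "darts M" "darts N"] i(3)
      by (auto simp: vertices_def is_iso_def)
  qed
qed

text \<open>Marked darts replace marked corners in the count of leaves: the corner in which a leaf
  is planted is given by its first dart.\<close>

interpretation dm: marking "\<lambda>h x. h x" darts
  by standard (auto simp: is_iso_def bij_betw_def)

interpretation cm: marking "\<lambda>h. map_prod h h" corners
proof
  show "map_prod h h m = map_prod g g m" if "rooted_map M" "m \<in> corners M" "\<And>x. x \<in> darts M \<Longrightarrow> h x = g x" for M m and h g :: "nat \<Rightarrow> nat"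
    using that rootedD(10)[OF that(1)] by (auto simp: corners_def)
  show "map_prod h h m \<in> corners N" if "rooted_map M" "rooted_map N" "is_iso h M N" "m \<in> corners M" for M N :: "nat rmap" and h m
    using that bij_betwE[of h "darts M" "darts N"] by (auto simp: corners_def is_iso_def)
qed (auto simp: map_prod_def split: prod.splits)

lemma vm_miso: "vm.miso = vertex_marked_iso"
  by (auto simp: vm.miso_def vertex_marked_iso_def)

lemma cm_miso: "cm.miso = corner_marked_iso"
  by (auto simp: cm.miso_def corner_marked_iso_def)

lemma card_vm: "card (vm.marked n f // vertex_marked_iso) = Q n f * (n + 2 - f)" "finite (vm.marked n f // vertex_marked_iso)"
proof -
  have "finite (vertices M) \<and> card (vertices M) = n + 2 - f" if "M \<in> pmaps n" "nf M = f" for M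
    using that pmaps_euler[OF that(1)] root_dart(2)[OF pmaps_rooted[OF that(1)]] by (simp add: card_vertices) (simp add: vertices_def)
  from vm.card_marked[OF this] show "card (vm.marked n f // vertex_marked_iso) = Q n f * (n + 2 - f)" "finite (vm.marked n f // vertex_marked_iso)"
    by (simp_all add: vm_miso)
qed

lemma card_dm: "card (dm.key ` dm.marked n f) = Q n f * (2 * n + 1)" "finite (dm.key ` dm.marked n f)"
proof -
  have "finite (darts M) \<and> card (darts M) = 2 * n + 1" if "M \<in> pmaps n" "nf M = f" for M
    using that root_dart(2)[OF pmaps_rooted[OF that(1)]] by (simp add: pmaps_def)
  from dm.card_key_image[OF this] show "card (dm.key ` dm.marked n f) = Q n f * (2 * n + 1)" "finite (dm.key ` dm.marked n f)" by blast+
qed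

lemma card_cm: "card (cm.marked n f // corner_marked_iso) = Q n f * (2 * n + 1)" "finite (cm.marked n f // corner_marked_iso)"
proof -
  have "finite (corners M) \<and> card (corners M) = 2 * n + 1" if "M \<in> pmaps n" "nf M = f" for M
  proof -
    have "card (corners M) = card (darts M)" unfolding corners_def by (rule card_image) (auto simp: inj_on_def)
    then show ?thesis using that root_dart(2)[OF pmaps_rooted[OF that(1)]] by (simp add: pmaps_def) (simp add: corners_def)
  qed
  from cm.card_marked[OF this] show "card (cm.marked n f // corner_marked_iso) = Q n f * (2 * n + 1)" "finite (cm.marked n f // corner_marked_iso)"
    by (simp_all add: cm_miso)
qed

section \<open>Maps with a marked leaf or node\<close>

definition leaf_marked :: "nat \<Rightarrow> nat \<Rightarrow> (nat rmap \<times> nat set) set" where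
  "leaf_marked n f = {(M, v). M \<in> pmaps n \<and> nf M = f \<and> v \<in> leaves M}"

definition node_marked :: "nat \<Rightarrow> nat \<Rightarrow> (nat rmap \<times> nat set) set" where
  "node_marked n f = {(M, v). M \<in> pmaps n \<and> nf M = f \<and> v \<in> nodes M}"

definition leaf_data :: "nat \<Rightarrow> nat \<Rightarrow> (nat rmap \<times> nat \<times> nat \<times> nat) set" where
  "leaf_data n f = {(N, p, b, l). N \<in> pmaps n \<and> nf N = f \<and> p \<in> darts N \<and> b \<notin> darts N \<and> l \<notin> insert b (darts N)}"

definition leaf_map :: "nat rmap \<times> nat \<times> nat \<times> nat \<Rightarrow> nat rmap \<times> nat set" where
  "leaf_map = (\<lambda>(N, p, b, l). (add_leaf b l (ins p b N), {l}))"

text \<open>A vertex other than the root vertex does not contain the arrow, so its degree is its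
  full number of darts, and degree 1 means a fixed point of \<open>rot\<close>.\<close>

lemma leaf_iff:
  assumes M: "rooted_map M"
  shows "v \<in> leaves M \<longleftrightarrow> (\<exists>l\<in>darts M. v = {l} \<and> rot M l = l \<and> l \<noteq> arrow M)"
proof
  note R = root_dart[OF M]
  assume v: "v \<in> leaves M"
  then obtain x where x: "x \<in> darts M" "v = orbit (rot M) x" "card (v - {arrow M}) = 1" "v \<noteq> orbit (rot M) (arrow M)"
    by (auto simp: leaves_def vertices_def vertex_degree_def root_vertex_def)
  have "arrow M \<notin> v" using x(2,4) perm_orbit_eq[OF R(3,2)] by metis
  then have "card v = 1" using x(3) by simp
  then have "v = {x}" using perm_self_in_orbit[OF R(3,2), of x] x(2) by (auto simp: card_1_singleton_iff)
  then show "\<exists>l\<in>darts M. v = {l} \<and> rot M l = l \<and> l \<noteq> arrow M"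
    using x(1,2) \<open>arrow M \<notin> v\<close> orbit_eq_singleton_iff[of "rot M" x] by auto
next
  assume "\<exists>l\<in>darts M. v = {l} \<and> rot M l = l \<and> l \<noteq> arrow M"
  then obtain l where l: "l \<in> darts M" "v = {l}" "rot M l = l" "l \<noteq> arrow M" by auto
  then have "orbit (rot M) l = {l}" by (simp add: orbit_eq_singleton_iff)
  moreover have "{l} \<noteq> orbit (rot M) (arrow M)"
    using perm_self_in_orbit[OF root_dart(3,2)[OF M], of "arrow M"] l(4) by auto
  ultimately show "v \<in> leaves M" using l by (auto simp: leaves_def vertices_def vertex_degree_def root_vertex_def)
qed

text \<open>Planting an edge adds two darts and one vertex and keeps the faces, so Euler's relation
  passes in both directions.\<close>

lemma leaf_planar:
  assumes N: "rooted_map N" "p \<in> darts N" "b \<notin> darts N" "l \<notin> insert b (darts N)"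
  defines "M \<equiv> add_leaf b l (ins p b N)"
  shows "rooted_map M" "nf M = nf N" "M \<in> pmaps (Suc n) \<longleftrightarrow> N \<in> pmaps n" "{l} \<in> leaves M"
proof -
  have K: "premap (ins p b N) {arrow (ins p b N), b} {arrow (ins p b N)}" "b \<noteq> arrow (ins p b N)" "l \<notin> darts (ins p b N)" "b \<in> darts (ins p b N)"
    using premap_ins[OF N(1-3)] root_dart(1)[OF N(1)] N(3,4) by auto
  show r: "rooted_map M" unfolding M_def by (rule rooted_add_leaf[OF K(1-3)])
  note c = add_leaf_counts[OF K(1,4,3), folded M_def] and c' = ins_counts[OF N(1-3)]
  show "nf M = nf N" using c c' by simp
  show "M \<in> pmaps (Suc n) \<longleftrightarrow> N \<in> pmaps n" using c c' r N(1) by (auto simp: pmaps_def planar_map_iff)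
  have "l \<noteq> p" "l \<noteq> b" using N(2,4) by auto
  then have "rot M l = l" using N(4) rootedD(12)[OF N(1), of l] by (simp add: M_def)
  moreover have "l \<in> darts M" "l \<noteq> arrow M" using N(4) root_dart(1)[OF N(1)] by (auto simp: M_def)
  ultimately show "{l} \<in> leaves M" using leaf_iff[OF r] by blast
qed

text \<open>For the inclusion from right to left, deleting the leaf dart l leaves its partner b as a
  second arrow, and erasing b leaves the dart p that preceded it.\<close>

lemma leaf_map_image: "leaf_map ` leaf_data n f = leaf_marked (Suc n) f"
proof (rule equalityI; rule subsetI)
  fix z assume "z \<in> leaf_map ` leaf_data n f"
  then obtain N p b l where "(N, p, b, l) \<in> leaf_data n f" "z = leaf_map (N, p, b, l)" by auto
  then show "z \<in> leaf_marked (Suc n) f"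
    using leaf_planar[OF pmaps_rooted[of N n], of p b l] by (auto simp: leaf_data_def leaf_map_def leaf_marked_def)
next
  fix z assume "z \<in> leaf_marked (Suc n) f"
  then obtain M v where z: "z = (M, v)" "M \<in> pmaps (Suc n)" "nf M = f" "v \<in> leaves M" by (auto simp: leaf_marked_def)
  note r = pmaps_rooted[OF z(2)]
  note D = rootedD[OF r]
  obtain l where l: "l \<in> darts M" "v = {l}" "rot M l = l" "l \<noteq> arrow M" using z(4) leaf_iff[OF r] by blast
  have "opp M l \<noteq> arrow M" using l(4) D(7)[of l] D(9)[of "arrow M"] by auto
  then obtain K b where K: "premap K {arrow K, b} {arrow K}" "b \<noteq> arrow K" "l \<notin> darts K" "M = add_leaf b l K"
    using obtain_add_leaf[OF r l(1,3,4)] by blast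
  obtain N p where N: "rooted_map N" "p \<in> darts N" "b \<notin> darts N" "K = ins p b N" "arrow N = arrow K"
    using premap_obtain_ins[OF K(1,2)] by blast
  have l': "l \<notin> insert b (darts N)" using K(3) unfolding N(4) by simp
  note p = leaf_planar[OF N(1-3) l', folded N(4), folded K(4)]
  have "(N, p, b, l) \<in> leaf_data n f" using p(2) p(3)[of n] z(2,3) N(2,3) l' by (simp add: leaf_data_def)
  moreover have "z = leaf_map (N, p, b, l)" unfolding z(1) l(2) leaf_map_def prod.case N(4)[symmetric] K(4)[symmetric] ..
  ultimately show "z \<in> leaf_map ` leaf_data n f" by blast
qed

text \<open>Up to isomorphism the data amount to a rooted map with a marked dart p, and rigidity
  gives 2 n + 1 of these for every class with n edges.\<close>

lemma card_leaf_marked: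
  "card (leaf_marked (Suc n) f // vertex_marked_iso) = Q n f * (2 * n + 1)" "finite (leaf_marked (Suc n) f // vertex_marked_iso)"
proof -
  let ?K = "\<lambda>(N, p, b, l). dm.key (N, p)"
  obtain \<phi> where \<phi>: "bij_betw \<phi> (?K ` leaf_data n f) ((leaf_map ` leaf_data n f) // vertex_marked_iso)"
  proof (rule quotient_bij[OF vm.equiv_miso[unfolded vm_miso], of "leaf_data n f" leaf_map ?K])
    fix x assume "x \<in> leaf_data n f"
    then have "leaf_map x \<in> leaf_marked (Suc n) f" using leaf_map_image by blast
    then show "leaf_map x \<in> {(M, m). rooted_map M \<and> m \<in> vertices M}"
      using pmaps_rooted by (auto simp: leaf_marked_def leaves_def)
  next
    fix x y assume xy: "x \<in> leaf_data n f" "y \<in> leaf_data n f"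
    obtain N p b l where x: "x = (N, p, b, l)" by (cases x)
    obtain N' p' b' l' where y: "y = (N', p', b', l')" by (cases y)
    have N: "rooted_map N" "p \<in> darts N" "b \<notin> darts N" "l \<notin> insert b (darts N)"
      and N': "rooted_map N'" "p' \<in> darts N'" "b' \<notin> darts N'" "l' \<notin> insert b' (darts N')"
      using xy pmaps_rooted unfolding x y leaf_data_def by auto
    have "?K x = ?K y \<longleftrightarrow> (\<exists>h. is_iso h N N' \<and> h p = p')" using dm.key_eq_iff[OF N(1,2) N'(1,2)] by (simp add: x y)
    also have "\<dots> \<longleftrightarrow> (\<exists>h. is_iso h (add_leaf b l (ins p b N)) (add_leaf b' l' (ins p' b' N')) \<and> h ` {l} = {l'})"
      using leaf_iso_iff[OF N N'] by simp
    also have "\<dots> \<longleftrightarrow> (leaf_map x, leaf_map y) \<in> vertex_marked_iso"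
      using leaf_planar(1,4)[OF N] leaf_planar(1,4)[OF N'] by (auto simp: x y leaf_map_def vertex_marked_iso_def leaves_def)
    finally show "?K x = ?K y \<longleftrightarrow> (leaf_map x, leaf_map y) \<in> vertex_marked_iso" .
  qed
  have "?K ` leaf_data n f = dm.key ` dm.marked n f"
  proof (rule equalityI; rule subsetI)
    fix z assume "z \<in> ?K ` leaf_data n f"
    then show "z \<in> dm.key ` dm.marked n f" by (force simp: leaf_data_def dm.marked_def)
  next
    fix z assume "z \<in> dm.key ` dm.marked n f"
    then obtain N p where N: "N \<in> pmaps n" "nf N = f" "p \<in> darts N" "z = dm.key (N, p)" by (auto simp: dm.marked_def)
    obtain b l where "b \<notin> darts N" "l \<notin> insert b (darts N)" using fresh_darts root_dart(2)[OF pmaps_rooted[OF N(1)]] by metis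
    then have "(N, p, b, l) \<in> leaf_data n f" using N by (simp add: leaf_data_def)
    then show "z \<in> ?K ` leaf_data n f" using N(4) by force
  qed
  then show "card (leaf_marked (Suc n) f // vertex_marked_iso) = Q n f * (2 * n + 1)" "finite (leaf_marked (Suc n) f // vertex_marked_iso)"
    using bij_betw_same_card[OF \<phi>] bij_betw_finite[OF \<phi>] card_dm[of n f] unfolding leaf_map_image by simp_all
qed

lemma leaves_iso:
  assumes "rooted_map M" "rooted_map N" "is_iso h M N" "v \<in> leaves M"
  shows "h ` v \<in> leaves N"
proof -
  obtain l where l: "l \<in> darts M" "v = {l}" "rot M l = l" "l \<noteq> arrow M" using assms(4) leaf_iff[OF assms(1)] by blast
  have "h l \<in> darts N" "rot N (h l) = h l" using assms(3) l by (auto simp: is_iso_def bij_betw_def dest: bspec[of _ _ l])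
  moreover have "h l \<noteq> arrow N"
    using assms(3) l root_dart(1)[OF assms(1)] by (metis bij_betw_inv_into_left is_iso_def)
  ultimately show ?thesis using leaf_iff[OF assms(2)] l(2) by auto
qed

lemma vm_split:
  "vm.marked n f // vertex_marked_iso = node_marked n f // vertex_marked_iso \<union> leaf_marked n f // vertex_marked_iso"
  "node_marked n f // vertex_marked_iso \<inter> leaf_marked n f // vertex_marked_iso = {}"
proof -
  have s: "vm.marked n f = node_marked n f \<union> leaf_marked n f"
    by (auto simp: vm.marked_def node_marked_def leaf_marked_def nodes_def leaves_def)
  show "vm.marked n f // vertex_marked_iso = node_marked n f // vertex_marked_iso \<union> leaf_marked n f // vertex_marked_iso"
    unfolding s by (auto simp: quotient_def)
  have "vertex_marked_iso `` {x} \<noteq> vertex_marked_iso `` {y}" if "x \<in> node_marked n f" "y \<in> leaf_marked n f" for x y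
  proof
    assume eq: "vertex_marked_iso `` {x} = vertex_marked_iso `` {y}"
    obtain M v where x: "x = (M, v)" by (cases x)
    obtain N w where y: "y = (N, w)" by (cases y)
    have M: "rooted_map M" "v \<in> nodes M" "v \<in> vertices M" and N: "rooted_map N" "w \<in> leaves N" "w \<in> vertices N"
      using that pmaps_rooted unfolding x y by (auto simp: node_marked_def leaf_marked_def nodes_def leaves_def)
    have "(y, x) \<in> vertex_marked_iso"
      using eq_equiv_class_iff[OF vm.equiv_miso[unfolded vm_miso], of y x] eq M N unfolding x y by auto
    then obtain h where "is_iso h N M" "h ` w = v" unfolding x y by (auto simp: vertex_marked_iso_def)
    then have "v \<in> leaves M" using leaves_iso[OF N(1) M(1)] N(2) by auto
    then show False using M(2) by (simp add: nodes_def)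
  qed
  then show "node_marked n f // vertex_marked_iso \<inter> leaf_marked n f // vertex_marked_iso = {}"
    by (fastforce simp: quotient_def)
qed

lemma card_node_marked:
  "card (node_marked n f // vertex_marked_iso) + card (leaf_marked n f // vertex_marked_iso) = Q n f * (n + 2 - f)"
  "finite (node_marked n f // vertex_marked_iso)"
proof -
  have "finite (vm.marked n f // vertex_marked_iso)" by (rule card_vm(2))
  then have fin: "finite (node_marked n f // vertex_marked_iso)" "finite (leaf_marked n f // vertex_marked_iso)"
    unfolding vm_split(1) by simp_all
  show "finite (node_marked n f // vertex_marked_iso)" by (rule fin(1))
  show "card (node_marked n f // vertex_marked_iso) + card (leaf_marked n f // vertex_marked_iso) = Q n f * (n + 2 - f)"
    using card_Un_disjoint[OF fin vm_split(2)] card_vm(1)[of n f] unfolding vm_split(1) by simp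
qed

lemma node_marked_count_eq: "node_marked_count n f = card (node_marked n f // vertex_marked_iso)"
  and leaf_marked_count_eq: "leaf_marked_count n f = card (leaf_marked n f // vertex_marked_iso)"
  unfolding node_marked_count_def leaf_marked_count_def node_marked_def leaf_marked_def
  by (simp_all add: pmaps_iff card_faces conj_assoc)

section \<open>The counting formulas over the integers\<close>

definition pointed :: "nat \<Rightarrow> nat \<Rightarrow> int" where
  "pointed n f = (2 + int n - int f) * int (Q n f)"

lemma pointed_zero: "f = 0 \<Longrightarrow> pointed n f = 0"
  by (simp add: pointed_def Q_zero)

lemma planar_identity:
  assumes "n \<ge> 1"
  shows "pointed n f = 2 * (2 * int n - 1) * int (Q (n - 1) f) + (\<Sum>i\<le>n - 1. \<Sum>g\<le>f. pointed i g * pointed (n - 1 - i) (f - g))"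
  unfolding pointed_def by (rule counting_identity[OF root_poly_tutte root_poly_coeff Q_zero Q_dual assms])

lemma pair_sum_eq:
  fixes f m :: nat
  shows "(\<Sum>(i, j)\<in>{(i :: nat, j :: nat). i + j = m}. \<Sum>(f1, f2)\<in>{(f1 :: nat, f2 :: nat). f1 + f2 = f \<and> f1 \<ge> 1 \<and> f2 \<ge> 1}.
     pointed i f1 * pointed j f2) = (\<Sum>i\<le>m. \<Sum>g\<le>f. pointed i g * pointed (m - i) (f - g))"
proof -
  have inner: "(\<Sum>(f1, f2)\<in>{(f1 :: nat, f2 :: nat). f1 + f2 = f \<and> f1 \<ge> 1 \<and> f2 \<ge> 1}. pointed i f1 * pointed j f2)
    = (\<Sum>g\<le>f. pointed i g * pointed j (f - g))" for i j
  proof -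
    \<comment> \<open>The terms with g = 0 or g = f contain a factor that counts maps without
      faces.\<close>
    have "(\<Sum>g\<le>f. pointed i g * pointed j (f - g)) = (\<Sum>g\<in>{1..<f}. pointed i g * pointed j (f - g))"
    proof (rule sum.mono_neutral_right)
      show "\<forall>g\<in>{..f} - {1..<f}. pointed i g * pointed j (f - g) = 0"
      proof
        fix g assume "g \<in> {..f} - {1..<f}"
        then have "g = 0 \<or> f - g = 0" by auto
        then show "pointed i g * pointed j (f - g) = 0" using pointed_zero by auto
      qed
    qed auto
    also have "\<dots> = (\<Sum>(f1, f2)\<in>{(f1 :: nat, f2 :: nat). f1 + f2 = f \<and> f1 \<ge> 1 \<and> f2 \<ge> 1}. pointed i f1 * pointed j f2)"
      by (rule sum.reindex_bij_witness[of _ fst "\<lambda>g. (g, f - g)"]) auto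
    finally show ?thesis by simp
  qed
  have "(\<Sum>(i, j)\<in>{(i :: nat, j :: nat). i + j = m}. \<Sum>g\<le>f. pointed i g * pointed j (f - g))
     = (\<Sum>i\<le>m. \<Sum>g\<le>f. pointed i g * pointed (m - i) (f - g))"
    by (rule sum.reindex_bij_witness[of _ "\<lambda>i. (i, m - i)" fst]) auto
  then show ?thesis unfolding inner .
qed

text \<open>Truncated and integer subtraction differ only for f > n + 2, where Q vanishes.\<close>

lemma card_vm_int: "int (card (vm.marked n f // vertex_marked_iso)) = pointed n f"
proof (cases "f \<le> n + 2")
  case True
  then have "int (n + 2 - f) = 2 + int n - int f" by (simp add: of_nat_diff)
  then show ?thesis by (simp only: card_vm pointed_def of_nat_mult mult.commute)
next
  case False
  then show ?thesis by (simp add: card_vm pointed_def Q_zero)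
qed

lemma leaf_count:
  assumes "n \<ge> 1"
  shows "int (leaf_marked_count n f) = (2 * int n - 1) * int (Q (n - 1) f)"
proof -
  obtain m where "n = Suc m" using assms by (cases n) auto
  then show ?thesis using card_leaf_marked(1)[of m f] by (simp add: leaf_marked_count_eq algebra_simps)
qed

text \<open>Nodes are the vertices that are not leaves, and the leaves use up exactly half of the
  term 2 (2 n - 1) Q.\<close>

lemma node_count:
  assumes "n \<ge> 1"
  shows "int (node_marked_count n f) = (2 * int n - 1) * int (Q (n - 1) f) + (\<Sum>i\<le>n - 1. \<Sum>g\<le>f. pointed i g * pointed (n - 1 - i) (f - g))"
proof -
  have "int (node_marked_count n f) + int (leaf_marked_count n f) = pointed n f"
    using card_node_marked(1)[of n f] card_vm(1)[of n f] card_vm_int[of n f]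
    unfolding node_marked_count_eq leaf_marked_count_eq by linarith
  then show ?thesis using leaf_count[OF assms, of f] planar_identity[OF assms, of f] by linarith
qed

section \<open>Grading by edges and faces, and the bijection\<close>

lemma graded_bij:
  assumes fin: "\<And>i. finite {a \<in> A. g a = i}" "\<And>i. finite {b \<in> B. k b = i}"
    and card: "\<And>i. card {a \<in> A. g a = i} = card {b \<in> B. k b = i}"
  shows "\<exists>\<Phi>. bij_betw \<Phi> A B \<and> (\<forall>a\<in>A. k (\<Phi> a) = g a)"
proof -
  have "\<forall>i. \<exists>h. bij_betw h {a \<in> A. g a = i} {b \<in> B. k b = i}"
    using finite_same_card_bij[OF fin card] by blast
  then obtain h where h: "\<And>i. bij_betw (h i) {a \<in> A. g a = i} {b \<in> B. k b = i}" by metis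
  define \<Phi> where "\<Phi> a = h (g a) a" for a
  have m: "\<Phi> a \<in> B \<and> k (\<Phi> a) = g a" if "a \<in> A" for a
    using bij_betwE[OF h[of "g a"]] that by (simp add: \<Phi>_def)
  have "bij_betw \<Phi> A B"
  proof (rule bij_betw_imageI)
    show "inj_on \<Phi> A"
    proof (rule inj_onI)
      fix a b assume ab: "a \<in> A" "b \<in> A" "\<Phi> a = \<Phi> b"
      then have "g a = g b" using m by metis
      then show "a = b" using ab bij_betw_imp_inj_on[OF h[of "g a"]] by (auto simp: \<Phi>_def inj_on_def)
    qed
    show "\<Phi> ` A = B"
    proof (rule equalityI; rule subsetI)
      fix b assume b: "b \<in> B"
      then obtain a where "a \<in> A" "g a = k b" "b = h (k b) a" using bij_betw_imp_surj_on[OF h[of "k b"]] by auto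
      then have "a \<in> A" "b = \<Phi> a" by (metis \<Phi>_def)+
      then show "b \<in> \<Phi> ` A" by blast
    qed (use m in auto)
  qed
  then show ?thesis using m by blast
qed

lemma iso_edges_faces:
  assumes "rooted_map M" "rooted_map N" "is_iso h M N"
  shows "card (edges N) = card (edges M)" "card (faces N) = card (faces M)"
  using iso_counts(2,3)[OF assms(1), of N] assms card_darts[OF assms(1)] card_darts[OF assms(2)]
  by (auto simp: iso_def card_faces)

text \<open>The chosen element is immaterial on classes of marked maps, as both numbers are
  isomorphism invariants (\<open>grade_marked\<close>).\<close>

definition grade :: "(nat rmap \<times> 'm) set \<Rightarrow> nat \<times> nat" where
  "grade C = (let M = fst (SOME x. x \<in> C) in (card (edges M), card (faces M)))"

lemma (in marking) grade_marked:
  assumes "C \<in> marked n f // miso"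
  shows "(M, m) \<in> C \<Longrightarrow> card (edges M) = n \<and> card (faces M) = f" "grade C = (n, f)"
proof -
  obtain N k where N: "(N, k) \<in> marked n f" "C = miso `` {(N, k)}" using assms by (auto simp: quotient_def)
  have r: "rooted_map N" "N \<in> pmaps n" "k \<in> mk N" "nf N = f" using N(1) pmaps_rooted by (auto simp: marked_def)
  have e: "card (edges M) = n \<and> card (faces M) = f" if MC: "(M, m) \<in> C" for M m
  proof -
    obtain h where M: "rooted_map M" "is_iso h N M" using MC N(2) by (auto simp: miso_def)
    show ?thesis using iso_edges_faces[OF r(1) M] r(2,4) by (simp add: pmaps_iff card_faces)
  qed
  then show "(M, m) \<in> C \<Longrightarrow> card (edges M) = n \<and> card (faces M) = f" by blast
  have "(N, k) \<in> C" using equiv_class_self[OF equiv_miso, of "(N, k)"] r(1,3) N(2) by simp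
  then have "(SOME x. x \<in> C) \<in> C" by (rule someI)
  then show "grade C = (n, f)" using e by (cases "SOME x. x \<in> C") (simp add: grade_def)
qed

abbreviation "V n f \<equiv> vm.marked n f // vertex_marked_iso"

lemma vertex_marked_maps_eq: "vertex_marked_maps = (\<Union>n. \<Union>f. V n f)"
proof -
  have "{(M, v). planar_map M \<and> v \<in> vertices M} = (\<Union>n. \<Union>f. vm.marked n f)" by (auto simp: vm.marked_def pmaps_iff)
  then show ?thesis by (auto simp: vertex_marked_maps_def quotient_def)
qed

lemma corner_marked_maps_eq: "corner_marked_maps = (\<Union>n. \<Union>f. cm.marked n f // corner_marked_iso)"
proof -
  have "{(M, c). planar_map M \<and> c \<in> corners M} = (\<Union>n. \<Union>f. cm.marked n f)" by (auto simp: cm.marked_def pmaps_iff)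
  then show ?thesis by (auto simp: corner_marked_maps_def quotient_def)
qed

lemma node_marked_maps_eq: "node_marked_maps = (\<Union>n\<in>{1..}. \<Union>f. node_marked n f // vertex_marked_iso)"
proof -
  have "{(M, v). planar_map M \<and> card (edges M) \<ge> 1 \<and> v \<in> nodes M} = (\<Union>n\<in>{1..}. \<Union>f. node_marked n f)"
    by (auto simp: node_marked_def pmaps_iff)
  then show ?thesis by (auto simp: node_marked_maps_def quotient_def)
qed

lemmas grade_V = vm.grade_marked[unfolded vm_miso] and grade_C = cm.grade_marked[unfolded cm_miso]

lemma grade_node: "C \<in> node_marked n f // vertex_marked_iso \<Longrightarrow> C \<in> V n f"
  using vm_split(1) by blast

lemma node_fibre: "{C \<in> node_marked_maps. grade C = (n, f)} = (if n = 0 then {} else node_marked n f // vertex_marked_iso)"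
proof (rule equalityI; rule subsetI)
  fix C assume "C \<in> {C \<in> node_marked_maps. grade C = (n, f)}"
  then obtain n' f' where "n' \<ge> 1" "C \<in> node_marked n' f' // vertex_marked_iso" "grade C = (n, f)"
    by (auto simp: node_marked_maps_eq)
  then show "C \<in> (if n = 0 then {} else node_marked n f // vertex_marked_iso)"
    using grade_V(2)[OF grade_node] by simp
next
  fix C assume C: "C \<in> (if n = 0 then {} else node_marked n f // vertex_marked_iso)"
  then have "n \<ge> 1" "C \<in> node_marked n f // vertex_marked_iso" by (auto split: if_splits)
  then show "C \<in> {C \<in> node_marked_maps. grade C = (n, f)}"
    using grade_V(2)[OF grade_node] by (auto simp: node_marked_maps_eq)
qed

text \<open>The grade is shifted so that matching grades means: same faces, one edge less.\<close>

definition target_grade ::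
  "(nat rmap \<times> (nat \<times> nat)) set + (nat rmap \<times> nat set) set \<times> (nat rmap \<times> nat set) set \<Rightarrow> nat \<times> nat" where
  "target_grade x = (case x of Inl C \<Rightarrow> (Suc (fst (grade C)), snd (grade C))
     | Inr (C1, C2) \<Rightarrow> (Suc (fst (grade C1) + fst (grade C2)), snd (grade C1) + snd (grade C2)))"

lemma target_fibre:
  "{x \<in> corner_marked_maps <+> (vertex_marked_maps \<times> vertex_marked_maps). target_grade x = (Suc n, f)} =
     Inl ` (cm.marked n f // corner_marked_iso) \<union> Inr ` (\<Union>(i, g)\<in>{..n} \<times> {..f}. V i g \<times> V (n - i) (f - g))" (is "?L = ?R")
proof (rule equalityI; rule subsetI)
  fix x assume x: "x \<in> ?L"
  then consider C where "x = Inl C" "C \<in> corner_marked_maps" | C1 C2 where "x = Inr (C1, C2)" "C1 \<in> vertex_marked_maps" "C2 \<in> vertex_marked_maps"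
    by auto
  then show "x \<in> ?R"
  proof cases
    case 1
    then obtain n' f' where C: "C \<in> cm.marked n' f' // corner_marked_iso" by (auto simp: corner_marked_maps_eq)
    then have "n' = n" "f' = f" using x 1 grade_C(2)[OF C] by (auto simp: target_grade_def)
    then show ?thesis using C 1 by auto
  next
    case 2
    obtain i g where C1: "C1 \<in> V i g" using 2 by (auto simp: vertex_marked_maps_eq)
    obtain j g' where C2: "C2 \<in> V j g'" using 2 by (auto simp: vertex_marked_maps_eq)
    have "i + j = n" "g + g' = f" using x 2 grade_V(2)[OF C1] grade_V(2)[OF C2] by (auto simp: target_grade_def)
    then have "j = n - i" "g' = f - g" "(i, g) \<in> {..n} \<times> {..f}" by auto
    then have "(C1, C2) \<in> (\<Union>(i, g)\<in>{..n} \<times> {..f}. V i g \<times> V (n - i) (f - g))" using C1 C2 by blast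
    then show ?thesis using 2 by blast
  qed
next
  fix x assume "x \<in> ?R"
  then consider C where "x = Inl C" "C \<in> cm.marked n f // corner_marked_iso"
    | C1 C2 i g where "x = Inr (C1, C2)" "C1 \<in> V i g" "C2 \<in> V (n - i) (f - g)" "i \<le> n" "g \<le> f"
    by auto
  then show "x \<in> ?L"
  proof cases
    case 1
    then show ?thesis using grade_C(2)[OF 1(2)] by (auto simp: corner_marked_maps_eq target_grade_def)
  next
    case 2
    then show ?thesis using grade_V(2)[OF 2(2)] grade_V(2)[OF 2(3)] by (auto simp: vertex_marked_maps_eq target_grade_def)
  qed
qed

lemma card_target_fibre:
  "int (card {x \<in> corner_marked_maps <+> (vertex_marked_maps \<times> vertex_marked_maps). target_grade x = (Suc n, f)}) =
     (2 * int (Suc n) - 1) * int (Q n f) + (\<Sum>i\<le>n. \<Sum>g\<le>f. pointed i g * pointed (n - i) (f - g))"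
  "finite {x \<in> corner_marked_maps <+> (vertex_marked_maps \<times> vertex_marked_maps). target_grade x = (Suc n, f)}"
proof -
  let ?I = "{..n} \<times> {..f}" and ?P = "\<lambda>p. V (fst p) (snd p) \<times> V (n - fst p) (f - snd p)"
  have U: "(\<Union>(i, g)\<in>?I. V i g \<times> V (n - i) (f - g)) = (\<Union>p\<in>?I. ?P p)" by (simp add: case_prod_unfold)
  have finP: "finite (?P p)" for p using card_vm(2) by simp
  \<comment> \<open>The grade of the first component recovers the index pair, so the pieces are
    disjoint.\<close>
  have "p = q" if "z \<in> ?P p" "z \<in> ?P q" for p q z
  proof -
    have "fst z \<in> V (fst p) (snd p)" "fst z \<in> V (fst q) (snd q)" using that by auto
    then have "(fst p, snd p) = (fst q, snd q)" using grade_V(2) by metis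
    then show ?thesis by simp
  qed
  then have dis: "\<forall>p\<in>?I. \<forall>q\<in>?I. p \<noteq> q \<longrightarrow> ?P p \<inter> ?P q = {}" by blast
  have "card (\<Union>p\<in>?I. ?P p) = (\<Sum>p\<in>?I. card (?P p))" by (rule card_UN_disjoint[OF _ _ dis]) (use finP in auto)
  then have "int (card (\<Union>p\<in>?I. ?P p)) = (\<Sum>p\<in>?I. pointed (fst p) (snd p) * pointed (n - fst p) (f - snd p))"
    by (simp add: card_cartesian_product card_vm_int)
  also have "\<dots> = (\<Sum>i\<le>n. \<Sum>g\<le>f. pointed i g * pointed (n - i) (f - g))"
    by (simp add: sum.cartesian_product case_prod_unfold)
  finally have cP: "int (card (\<Union>p\<in>?I. ?P p)) = (\<Sum>i\<le>n. \<Sum>g\<le>f. pointed i g * pointed (n - i) (f - g))" .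
  have finU: "finite (\<Union>p\<in>?I. ?P p)" using finP by blast
  note c = card_cm[of n f]
  show "finite {x \<in> corner_marked_maps <+> (vertex_marked_maps \<times> vertex_marked_maps). target_grade x = (Suc n, f)}"
    unfolding target_fibre U using finU c(2) by simp
  have "card (Inl ` (cm.marked n f // corner_marked_iso) \<union> Inr ` (\<Union>p\<in>?I. ?P p) :: ((nat rmap \<times> (nat \<times> nat)) set + (nat rmap \<times> nat set) set \<times> (nat rmap \<times> nat set) set) set)
      = card (cm.marked n f // corner_marked_iso) + card (\<Union>p\<in>?I. ?P p)"
    using finU c(2) by (subst card_Un_disjoint) (auto simp: card_image)
  then show "int (card {x \<in> corner_marked_maps <+> (vertex_marked_maps \<times> vertex_marked_maps). target_grade x = (Suc n, f)}) =
     (2 * int (Suc n) - 1) * int (Q n f) + (\<Sum>i\<le>n. \<Sum>g\<le>f. pointed i g * pointed (n - i) (f - g))"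
    unfolding target_fibre U using cP c(1) by (simp add: algebra_simps)
qed

lemma marked_bijection:
  "\<exists>\<Phi>. bij_betw \<Phi> node_marked_maps (corner_marked_maps <+> (vertex_marked_maps \<times> vertex_marked_maps)) \<and>
     (\<forall>C\<in>node_marked_maps. target_grade (\<Phi> C) = grade C)"
proof -
  let ?B = "corner_marked_maps <+> (vertex_marked_maps \<times> vertex_marked_maps)"
  have A: "finite {C \<in> node_marked_maps. grade C = p} \<and> finite {x \<in> ?B. target_grade x = p} \<and>
    card {C \<in> node_marked_maps. grade C = p} = card {x \<in> ?B. target_grade x = p}" for p
  proof -
    obtain n f where p: "p = (n, f)" by (cases p)
    show ?thesis
    proof (cases n)
      case 0
      \<comment> \<open>Because of the shift every target grade has at least one edge, matching the
        condition imposed on node-marked maps.\<close>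
      have e: "{x \<in> ?B. target_grade x = p} = {}" unfolding p 0 by (auto simp: target_grade_def split: sum.splits prod.splits)
      show ?thesis unfolding e by (simp add: p 0 node_fibre)
    next
      case (Suc m)
      have "int (card {C \<in> node_marked_maps. grade C = p}) = int (card {x \<in> ?B. target_grade x = p})"
        unfolding p Suc card_target_fibre(1) node_fibre
        using node_count[of "Suc m" f] by (simp add: node_marked_count_eq)
      then show ?thesis using card_target_fibre(2)[of m f] card_node_marked(2)[of n f] by (simp add: p Suc node_fibre)
    qed
  qed
  show ?thesis by (rule graded_bij) (use A in blast)+
qed

theorem theorem2:
  "(\<exists>\<Phi> :: (nat rmap \<times> nat set) set \<Rightarrow>
        (nat rmap \<times> (nat \<times> nat)) set + (nat rmap \<times> nat set) set \<times> (nat rmap \<times> nat set) set.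
      bij_betw \<Phi> node_marked_maps
        (corner_marked_maps <+> (vertex_marked_maps \<times> vertex_marked_maps)) \<and>
      (\<forall>C\<in>node_marked_maps. \<forall>(M, v)\<in>C.
         case \<Phi> C of
           Inl C' \<Rightarrow> \<forall>(M', c)\<in>C'.
             card (faces M') = card (faces M) \<and> card (edges M') + 1 = card (edges M)
         | Inr (C1, C2) \<Rightarrow> \<forall>(M1, v1)\<in>C1. \<forall>(M2, v2)\<in>C2.
             card (faces M1) + card (faces M2) = card (faces M) \<and>
             card (edges M1) + card (edges M2) + 1 = card (edges M))) \<and>
   (\<forall>n f :: nat. n \<ge> 1 \<longrightarrow> f \<ge> 1 \<longrightarrow>
      int (node_marked_count n f) =
        (2 * int n - 1) * int (Q (n - 1) f) +
        (\<Sum>(i, j)\<in>{(i :: nat, j :: nat). i + j = n - 1}.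
           \<Sum>(f1, f2)\<in>{(f1 :: nat, f2 :: nat). f1 + f2 = f \<and> f1 \<ge> 1 \<and> f2 \<ge> 1}.
             ((2 + int i - int f1) * int (Q i f1)) * ((2 + int j - int f2) * int (Q j f2))) \<and>
      int (leaf_marked_count n f) = (2 * int n - 1) * int (Q (n - 1) f) \<and>
      (2 + int n - int f) * int (Q n f) =
        2 * (2 * int n - 1) * int (Q (n - 1) f) +
        (\<Sum>(i, j)\<in>{(i :: nat, j :: nat). i + j = n - 1}.
           \<Sum>(f1, f2)\<in>{(f1 :: nat, f2 :: nat). f1 + f2 = f \<and> f1 \<ge> 1 \<and> f2 \<ge> 1}.
             ((2 + int i - int f1) * int (Q i f1)) * ((2 + int j - int f2) * int (Q j f2))))"
proof (intro conjI allI impI)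
  let ?B = "corner_marked_maps <+> (vertex_marked_maps \<times> vertex_marked_maps)"
  obtain \<Phi> where \<Phi>: "bij_betw \<Phi> node_marked_maps ?B" "\<And>C. C \<in> node_marked_maps \<Longrightarrow> target_grade (\<Phi> C) = grade C"
    using marked_bijection by blast
  \<comment> \<open>The theorem speaks of all elements of a class, so the grade has to be read off
    an arbitrary one rather than the chosen one.\<close>
  have V: "grade C = (card (edges M), card (faces M))" if "C \<in> vertex_marked_maps" "(M, v) \<in> C" for C M v
    using that grade_V unfolding vertex_marked_maps_eq by fastforce
  have Cn: "grade C = (card (edges M), card (faces M))" if "C \<in> corner_marked_maps" "(M, v) \<in> C" for C M v
    using that grade_C unfolding corner_marked_maps_eq by fastforce
  have NV: "C \<in> vertex_marked_maps" if "C \<in> node_marked_maps" for C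
    using that grade_node unfolding node_marked_maps_eq vertex_marked_maps_eq by blast
  have "case \<Phi> C of
           Inl C' \<Rightarrow> \<forall>(M', c)\<in>C'.
             card (faces M') = card (faces M) \<and> card (edges M') + 1 = card (edges M)
         | Inr (C1, C2) \<Rightarrow> \<forall>(M1, v1)\<in>C1. \<forall>(M2, v2)\<in>C2.
             card (faces M1) + card (faces M2) = card (faces M) \<and>
             card (edges M1) + card (edges M2) + 1 = card (edges M)"
    if C: "C \<in> node_marked_maps" "(M, v) \<in> C" for C M v
  proof -
    have g: "target_grade (\<Phi> C) = (card (edges M), card (faces M))" using \<Phi>(2)[OF C(1)] V[OF NV[OF C(1)] C(2)] by simp
    have "\<Phi> C \<in> ?B" using bij_betwE[OF \<Phi>(1)] C(1) by blast
    then consider C' where "\<Phi> C = Inl C'" "C' \<in> corner_marked_maps"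
      | C1 C2 where "\<Phi> C = Inr (C1, C2)" "C1 \<in> vertex_marked_maps" "C2 \<in> vertex_marked_maps" by auto
    then show ?thesis
    proof cases
      case 1
      then show ?thesis using g Cn[OF 1(2)] by (fastforce simp: target_grade_def)
    next
      case 2
      then show ?thesis using g V[OF 2(2)] V[OF 2(3)] by (fastforce simp: target_grade_def)
    qed
  qed
  then show "\<exists>\<Phi> :: (nat rmap \<times> nat set) set \<Rightarrow>
        (nat rmap \<times> (nat \<times> nat)) set + (nat rmap \<times> nat set) set \<times> (nat rmap \<times> nat set) set.
      bij_betw \<Phi> node_marked_maps ?B \<and>
      (\<forall>C\<in>node_marked_maps. \<forall>(M, v)\<in>C.
         case \<Phi> C of
           Inl C' \<Rightarrow> \<forall>(M', c)\<in>C'.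
             card (faces M') = card (faces M) \<and> card (edges M') + 1 = card (edges M)
         | Inr (C1, C2) \<Rightarrow> \<forall>(M1, v1)\<in>C1. \<forall>(M2, v2)\<in>C2.
             card (faces M1) + card (faces M2) = card (faces M) \<and>
             card (edges M1) + card (edges M2) + 1 = card (edges M))"
    using \<Phi>(1) by (intro exI[of _ \<Phi>]) blast
next
  fix n f :: nat assume n: "n \<ge> 1"
  show "int (node_marked_count n f) =
        (2 * int n - 1) * int (Q (n - 1) f) +
        (\<Sum>(i, j)\<in>{(i :: nat, j :: nat). i + j = n - 1}.
           \<Sum>(f1, f2)\<in>{(f1 :: nat, f2 :: nat). f1 + f2 = f \<and> f1 \<ge> 1 \<and> f2 \<ge> 1}.
             ((2 + int i - int f1) * int (Q i f1)) * ((2 + int j - int f2) * int (Q j f2)))"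
    using node_count[OF n, of f] pair_sum_eq[of f "n - 1"] unfolding pointed_def by linarith
  show "int (leaf_marked_count n f) = (2 * int n - 1) * int (Q (n - 1) f)" by (rule leaf_count[OF n])
  show "(2 + int n - int f) * int (Q n f) =
        2 * (2 * int n - 1) * int (Q (n - 1) f) +
        (\<Sum>(i, j)\<in>{(i :: nat, j :: nat). i + j = n - 1}.
           \<Sum>(f1, f2)\<in>{(f1 :: nat, f2 :: nat). f1 + f2 = f \<and> f1 \<ge> 1 \<and> f2 \<ge> 1}.
             ((2 + int i - int f1) * int (Q i f1)) * ((2 + int j - int f2) * int (Q j f2)))"
    using planar_identity[OF n, of f] pair_sum_eq[of f "n - 1"] unfolding pointed_def by linarith
qed

end
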